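(* Let $G$ be a locally compact group and $(\alpha,\mathcal H)$ a $G$-groupoid (with action $\alpha$). Then: (1) The crossed product groupoid $G\ltimes_\alpha\mathcal H$ has a canonical right module $P:=(G\times\mathcal H_0\to\mathcal H_0)$, with moment map the projection and action $(g,r\gamma)\cdot(h,\gamma)=(gh,h^{-1}s\gamma)$. (2) The induced groupoid $P\rtimes_q(G\ltimes_\alpha\mathcal H)$ is naturally a generalized principal $G$-bundle, namely it is $G\rtimes_q(G\ltimes_\alpha\mathcal H)$ for the quotient homomorphism $q:G\ltimes_\alpha\mathcal H\to G$, $q(h,\gamma)=h$. (3) The $G$-groupoids $(\alpha,\mathcal H)$ and $(\tau,P\rtimes_q(G\ltimes_\alpha\mathcal H))$ are $G$-equivariantly Morita equivalent, where $\tau$ is the left principal $G$-bundle action $g\cdot(g',h,\gamma)=(gg',h,\gamma)$.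
   Context: A groupoid $\mathcal G=(\mathcal G_1\rightrightarrows\mathcal G_0)$ is a topological groupoid with source $s$ and range $r$ (the product $\gamma_1\gamma_2$ is defined when $s\gamma_1=r\gamma_2$), whose arrow space is locally compact Hausdorff and second countable, equipped with a left Haar system. A $G$-groupoid is a groupoid with a continuous left $G$-action on arrows commuting with all structure maps and leaving the Haar system invariant. A left $\mathcal G$-module is a space $P$ with a continuous moment map $\varepsilon:P\to\mathcal G_0$ and a continuous action $\mathcal G_1\times_{s,\mathcal G_0,\varepsilon}P\to P$; right modules are analogous. It is principal if the action is free and proper. A Morita equivalence $(\mathcal G$-$\mathcal H)$-bimodule is a space $P$ with commuting principal left $\mathcal G$- and right $\mathcal H$-module structures such that the left moment map induces a homeomorphism $P/\mathcal H\cong\mathcal G_0$ and the right moment map a homeomorphism $\mathcal G\backslash P\cong\mathcal H_0$. A $G$-equivariant Morita equivalence of $G$-groupoids is such a $P$ with a $G$-action satisfying $g(\gamma p\eta)=g(\gamma)g(p)g(\eta)$. The crossed product groupoid $G\ltimes_\alpha\mathcal H=(G\times\mathcal H_1\rightrightarrows\mathcal H_0)$ has $s(g,\gamma)=s(g^{-1}\gamma)$, $r(g,\gamma)=r\gamma$, $(g,\gamma)(g',g^{-1}\gamma')=(gg',\gamma\gamma')$. For a homomorphism $\rho:\mathcal G\to G$ the generalized principal $G$-bundle $G\rtimes_\rho\mathcal G=(G\times\mathcal G_1\rightrightarrows G\times\mathcal G_0)$ has $s(g,\gamma)=(g\rho(\gamma),s\gamma)$, $r(g,\gamma)=(g,r\gamma)$,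 $(g,\gamma_1)(g\rho(\gamma_1),\gamma_2)=(g,\gamma_1\gamma_2)$. For a right $\mathcal G$-module $P$, the induced groupoid $P\rtimes\mathcal G$ has object space $P$, arrows $\{(p,\gamma): \varepsilon(p)=r\gamma\}$, range $p$ and source $p\gamma$. Explicitly, $P\rtimes_q(G\ltimes_\alpha\mathcal H)=(G\times G\times\mathcal H_1\rightrightarrows G\times\mathcal H_0)$ has $s(g,h,\gamma)=(gh,h^{-1}s\gamma)$, $r(g,h,\gamma)=(g,r\gamma)$, $(g,h_1,\gamma_1)(gh_1,h_2,h_1^{-1}\gamma_2)=(g,h_1h_2,\gamma_1\gamma_2)$. *)

theory Defs
  imports "HOL-Analysis.Analysis" "HOL-Algebra.Group"
begin

section \<open>Topological preliminaries\<close>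

definition quotient_topology :: "'a topology \<Rightarrow> ('a \<Rightarrow> 'b) \<Rightarrow> 'b topology" where
  "quotient_topology X f =
     topology (\<lambda>U. U \<subseteq> f ` topspace X \<and> openin X {x \<in> topspace X. f x \<in> U})"

lemma istopology_quotient:
  "istopology (\<lambda>U. U \<subseteq> f ` topspace X \<and> openin X {x \<in> topspace X. f x \<in> U})"
  unfolding istopology_def
proof (intro conjI allI impI)
  fix S T
  assume S: "S \<subseteq> f ` topspace X \<and> openin X {x \<in> topspace X. f x \<in> S}"
    and T: "T \<subseteq> f ` topspace X \<and> openin X {x \<in> topspace X. f x \<in> T}"
  have "{x \<in> topspace X. f x \<in> S \<inter> T}
      = {x \<in> topspace X. f x \<in> S} \<inter> {x \<in> topspace X. f x \<in> T}" by auto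
  with S T show "openin X {x \<in> topspace X. f x \<in> S \<inter> T}" by (simp add: openin_Int)
  from S show "S \<inter> T \<subseteq> f ` topspace X" by auto
next
  fix K
  assume K: "\<forall>S\<in>K. S \<subseteq> f ` topspace X \<and> openin X {x \<in> topspace X. f x \<in> S}"
  have "{x \<in> topspace X. f x \<in> \<Union>K} = (\<Union>S\<in>K. {x \<in> topspace X. f x \<in> S})" by auto
  with K show "openin X {x \<in> topspace X. f x \<in> \<Union>K}" by auto
  from K show "\<Union>K \<subseteq> f ` topspace X" by auto
qed

lemma openin_quotient_topology:
  "openin (quotient_topology X f) U
     \<longleftrightarrow> U \<subseteq> f ` topspace X \<and> openin X {x \<in> topspace X. f x \<in> U}"
  unfolding quotient_topology_def by (simp add: istopology_quotient)

definition borel_of :: "'a topology \<Rightarrow> 'a measure" where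
  "borel_of X = sigma (topspace X) {U. openin X U}"

text \<open>Only used on second countable locally compact Hausdorff spaces, where every Borel measure
  that is finite on compact sets is regular.\<close>

definition radon_measure :: "'a topology \<Rightarrow> 'a measure \<Rightarrow> bool" where
  "radon_measure X M \<longleftrightarrow>
     sets M = sets (borel_of X) \<and> (\<forall>K. compactin X K \<longrightarrow> emeasure M K < \<infinity>)"

text \<open>Real-valued functions suffice for Haar systems: the complex case follows by linearity.
  The values outside \<^term>\<open>topspace X\<close> are irrelevant.\<close>

definition Cc :: "'a topology \<Rightarrow> ('a \<Rightarrow> real) set" where
  "Cc X = {f. continuous_map X euclideanreal f \<and>
              compactin X (X closure_of {x \<in> topspace X. f x \<noteq> 0})}"

section \<open>Locally compact groups\<close>

record 'g top_group = "'g monoid" +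
  gtop :: "'g topology"

definition locally_compact_group :: "'g top_group \<Rightarrow> bool" where
  "locally_compact_group G \<longleftrightarrow>
     group G \<and> topspace (gtop G) = carrier G \<and>
     continuous_map (prod_topology (gtop G) (gtop G)) (gtop G) (\<lambda>(g, h). g \<otimes>\<^bsub>G\<^esub> h) \<and>
     continuous_map (gtop G) (gtop G) (\<lambda>g. inv\<^bsub>G\<^esub> g) \<and>
     Hausdorff_space (gtop G) \<and> locally_compact_space (gtop G)"

definition left_haar_measure :: "'g top_group \<Rightarrow> 'g measure \<Rightarrow> bool" where
  "left_haar_measure G \<mu> \<longleftrightarrow>
     radon_measure (gtop G) \<mu> \<and> emeasure \<mu> (carrier G) \<noteq> 0 \<and>
     (\<forall>g \<in> carrier G. \<forall>A \<in> sets \<mu>. emeasure \<mu> ((\<lambda>h. g \<otimes>\<^bsub>G\<^esub> h) ` A) = emeasure \<mu> A)"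

definition continuous_group_action ::
    "'g top_group \<Rightarrow> 'a topology \<Rightarrow> ('g \<Rightarrow> 'a \<Rightarrow> 'a) \<Rightarrow> bool" where
  "continuous_group_action G X a \<longleftrightarrow>
     continuous_map (prod_topology (gtop G) X) X (\<lambda>(g, x). a g x) \<and>
     (\<forall>x \<in> topspace X. a \<one>\<^bsub>G\<^esub> x = x) \<and>
     (\<forall>g \<in> carrier G. \<forall>h \<in> carrier G. \<forall>x \<in> topspace X. a (g \<otimes>\<^bsub>G\<^esub> h) x = a g (a h x))"

section \<open>Groupoids and Haar systems\<close>

text \<open>The points of a space are the elements of its \<^const>\<open>topspace\<close>. The operations are total
  functions, meaningful only on these points and, for \<open>gmul\<close>, on composable pairs.\<close>

record ('a, 'o) groupoid =
  arr :: "'a topology"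
  obj :: "'o topology"
  src :: "'a \<Rightarrow> 'o"
  rng :: "'a \<Rightarrow> 'o"
  gmul :: "'a \<Rightarrow> 'a \<Rightarrow> 'a"
  gone :: "'o \<Rightarrow> 'a"
  ginv :: "'a \<Rightarrow> 'a"

definition composable :: "('a, 'o) groupoid \<Rightarrow> ('a \<times> 'a) set" where
  "composable \<G> = {(\<gamma>, \<eta>). \<gamma> \<in> topspace (arr \<G>) \<and> \<eta> \<in> topspace (arr \<G>) \<and> src \<G> \<gamma> = rng \<G> \<eta>}"

definition topological_groupoid :: "('a, 'o) groupoid \<Rightarrow> bool" where
  "topological_groupoid \<G> \<longleftrightarrow>
     continuous_map (arr \<G>) (obj \<G>) (src \<G>) \<and>
     continuous_map (arr \<G>) (obj \<G>) (rng \<G>) \<and>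
     continuous_map (obj \<G>) (arr \<G>) (gone \<G>) \<and>
     continuous_map (arr \<G>) (arr \<G>) (ginv \<G>) \<and>
     continuous_map (subtopology (prod_topology (arr \<G>) (arr \<G>)) (composable \<G>)) (arr \<G>)
       (\<lambda>(\<gamma>, \<eta>). gmul \<G> \<gamma> \<eta>) \<and>
     (\<forall>(\<gamma>, \<eta>) \<in> composable \<G>.
        src \<G> (gmul \<G> \<gamma> \<eta>) = src \<G> \<eta> \<and> rng \<G> (gmul \<G> \<gamma> \<eta>) = rng \<G> \<gamma>) \<and>
     (\<forall>\<gamma> \<eta> \<zeta>. (\<gamma>, \<eta>) \<in> composable \<G> \<longrightarrow> (\<eta>, \<zeta>) \<in> composable \<G> \<longrightarrow>
        gmul \<G> (gmul \<G> \<gamma> \<eta>) \<zeta> = gmul \<G> \<gamma> (gmul \<G> \<eta> \<zeta>)) \<and>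
     (\<forall>x \<in> topspace (obj \<G>). src \<G> (gone \<G> x) = x \<and> rng \<G> (gone \<G> x) = x) \<and>
     (\<forall>\<gamma> \<in> topspace (arr \<G>).
        gmul \<G> (gone \<G> (rng \<G> \<gamma>)) \<gamma> = \<gamma> \<and> gmul \<G> \<gamma> (gone \<G> (src \<G> \<gamma>)) = \<gamma> \<and>
        src \<G> (ginv \<G> \<gamma>) = rng \<G> \<gamma> \<and> rng \<G> (ginv \<G> \<gamma>) = src \<G> \<gamma> \<and>
        gmul \<G> \<gamma> (ginv \<G> \<gamma>) = gone \<G> (rng \<G> \<gamma>) \<and>
        gmul \<G> (ginv \<G> \<gamma>) \<gamma> = gone \<G> (src \<G> \<gamma>))"

definition range_fibre :: "('a, 'o) groupoid \<Rightarrow> 'o \<Rightarrow> 'a set" where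
  "range_fibre \<G> x = {\<gamma> \<in> topspace (arr \<G>). rng \<G> \<gamma> = x}"

text \<open>A left Haar system: each \<open>\<nu> x\<close> is a Radon measure on the arrow space with support equal to
  the range fibre of \<open>x\<close>; the family is continuous and left invariant.\<close>

definition left_haar_system :: "('a, 'o) groupoid \<Rightarrow> ('o \<Rightarrow> 'a measure) \<Rightarrow> bool" where
  "left_haar_system \<G> \<nu> \<longleftrightarrow>
     (\<forall>x \<in> topspace (obj \<G>).
        radon_measure (arr \<G>) (\<nu> x) \<and>
        emeasure (\<nu> x) (topspace (arr \<G>) - range_fibre \<G> x) = 0 \<and>
        (\<forall>U. openin (arr \<G>) U \<longrightarrow> U \<inter> range_fibre \<G> x \<noteq> {} \<longrightarrow> emeasure (\<nu> x) U > 0)) \<and>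
     (\<forall>f \<in> Cc (arr \<G>). continuous_map (obj \<G>) euclideanreal (\<lambda>x. LINT \<gamma>|\<nu> x. f \<gamma>)) \<and>
     (\<forall>f \<in> Cc (arr \<G>). \<forall>\<gamma> \<in> topspace (arr \<G>).
        (LINT \<eta>:range_fibre \<G> (src \<G> \<gamma>)|\<nu> (src \<G> \<gamma>). f (gmul \<G> \<gamma> \<eta>))
          = (LINT \<eta>|\<nu> (rng \<G> \<gamma>). f \<eta>))"

definition groupoid_with_haar :: "('a, 'o) groupoid \<Rightarrow> ('o \<Rightarrow> 'a measure) \<Rightarrow> bool" where
  "groupoid_with_haar \<G> \<nu> \<longleftrightarrow>
     topological_groupoid \<G> \<and> locally_compact_space (arr \<G>) \<and> Hausdorff_space (arr \<G>) \<and>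
     second_countable (arr \<G>) \<and> left_haar_system \<G> \<nu>"

definition groupoid_iso ::
    "('a, 'o) groupoid \<Rightarrow> ('b, 'u) groupoid \<Rightarrow> ('a \<Rightarrow> 'b) \<Rightarrow> ('o \<Rightarrow> 'u) \<Rightarrow> bool" where
  "groupoid_iso \<G> \<H> \<Phi> \<phi> \<longleftrightarrow>
     homeomorphic_map (arr \<G>) (arr \<H>) \<Phi> \<and> homeomorphic_map (obj \<G>) (obj \<H>) \<phi> \<and>
     (\<forall>\<gamma> \<in> topspace (arr \<G>). src \<H> (\<Phi> \<gamma>) = \<phi> (src \<G> \<gamma>) \<and> rng \<H> (\<Phi> \<gamma>) = \<phi> (rng \<G> \<gamma>)) \<and>
     (\<forall>(\<gamma>, \<eta>) \<in> composable \<G>. \<Phi> (gmul \<G> \<gamma> \<eta>) = gmul \<H> (\<Phi> \<gamma>) (\<Phi> \<eta>))"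

definition hom_to_group :: "('a, 'o) groupoid \<Rightarrow> 'g top_group \<Rightarrow> ('a \<Rightarrow> 'g) \<Rightarrow> bool" where
  "hom_to_group \<G> G \<rho> \<longleftrightarrow>
     continuous_map (arr \<G>) (gtop G) \<rho> \<and>
     (\<forall>(\<gamma>, \<eta>) \<in> composable \<G>. \<rho> (gmul \<G> \<gamma> \<eta>) = \<rho> \<gamma> \<otimes>\<^bsub>G\<^esub> \<rho> \<eta>)"

section \<open>G-groupoids\<close>

text \<open>The group acts on arrows; the action on objects is the one induced via the units.\<close>

definition obj_act :: "('a, 'o) groupoid \<Rightarrow> ('g \<Rightarrow> 'a \<Rightarrow> 'a) \<Rightarrow> 'g \<Rightarrow> 'o \<Rightarrow> 'o" where
  "obj_act \<G> \<alpha> g x = rng \<G> (\<alpha> g (gone \<G> x))"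

definition topological_G_groupoid ::
    "'g top_group \<Rightarrow> ('a, 'o) groupoid \<Rightarrow> ('g \<Rightarrow> 'a \<Rightarrow> 'a) \<Rightarrow> bool" where
  "topological_G_groupoid G \<G> \<alpha> \<longleftrightarrow>
     topological_groupoid \<G> \<and> continuous_group_action G (arr \<G>) \<alpha> \<and>
     (\<forall>g \<in> carrier G.
        (\<forall>\<gamma> \<in> topspace (arr \<G>).
           src \<G> (\<alpha> g \<gamma>) = obj_act \<G> \<alpha> g (src \<G> \<gamma>) \<and>
           rng \<G> (\<alpha> g \<gamma>) = obj_act \<G> \<alpha> g (rng \<G> \<gamma>) \<and>
           ginv \<G> (\<alpha> g \<gamma>) = \<alpha> g (ginv \<G> \<gamma>)) \<and>
        (\<forall>x \<in> topspace (obj \<G>). gone \<G> (obj_act \<G> \<alpha> g x) = \<alpha> g (gone \<G> x)) \<and>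
        (\<forall>(\<gamma>, \<eta>) \<in> composable \<G>. \<alpha> g (gmul \<G> \<gamma> \<eta>) = gmul \<G> (\<alpha> g \<gamma>) (\<alpha> g \<eta>)))"

definition G_groupoid ::
    "'g top_group \<Rightarrow> ('a, 'o) groupoid \<Rightarrow> ('o \<Rightarrow> 'a measure) \<Rightarrow> ('g \<Rightarrow> 'a \<Rightarrow> 'a) \<Rightarrow> bool" where
  "G_groupoid G \<G> \<nu> \<alpha> \<longleftrightarrow>
     groupoid_with_haar \<G> \<nu> \<and> topological_G_groupoid G \<G> \<alpha> \<and>
     (\<forall>g \<in> carrier G. \<forall>x \<in> topspace (obj \<G>).
        distr (\<nu> x) (borel_of (arr \<G>)) (\<alpha> g) = \<nu> (obj_act \<G> \<alpha> g x))"

section \<open>Modules and Morita equivalence\<close>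

definition left_module ::
    "('a, 'o) groupoid \<Rightarrow> 'p topology \<Rightarrow> ('p \<Rightarrow> 'o) \<Rightarrow> ('a \<Rightarrow> 'p \<Rightarrow> 'p) \<Rightarrow> bool" where
  "left_module \<G> P \<epsilon> a \<longleftrightarrow>
     continuous_map P (obj \<G>) \<epsilon> \<and>
     continuous_map (subtopology (prod_topology (arr \<G>) P) {(\<gamma>, p). src \<G> \<gamma> = \<epsilon> p}) P
       (\<lambda>(\<gamma>, p). a \<gamma> p) \<and>
     (\<forall>p \<in> topspace P. a (gone \<G> (\<epsilon> p)) p = p) \<and>
     (\<forall>p \<in> topspace P. \<forall>\<gamma> \<in> topspace (arr \<G>). src \<G> \<gamma> = \<epsilon> p \<longrightarrow> \<epsilon> (a \<gamma> p) = rng \<G> \<gamma>) \<and>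
     (\<forall>p \<in> topspace P. \<forall>(\<gamma>, \<eta>) \<in> composable \<G>. src \<G> \<eta> = \<epsilon> p \<longrightarrow>
        a (gmul \<G> \<gamma> \<eta>) p = a \<gamma> (a \<eta> p))"

definition right_module ::
    "('a, 'o) groupoid \<Rightarrow> 'p topology \<Rightarrow> ('p \<Rightarrow> 'o) \<Rightarrow> ('p \<Rightarrow> 'a \<Rightarrow> 'p) \<Rightarrow> bool" where
  "right_module \<G> P \<epsilon> b \<longleftrightarrow>
     continuous_map P (obj \<G>) \<epsilon> \<and>
     continuous_map (subtopology (prod_topology P (arr \<G>)) {(p, \<gamma>). \<epsilon> p = rng \<G> \<gamma>}) P
       (\<lambda>(p, \<gamma>). b p \<gamma>) \<and>
     (\<forall>p \<in> topspace P. b p (gone \<G> (\<epsilon> p)) = p) \<and>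
     (\<forall>p \<in> topspace P. \<forall>\<gamma> \<in> topspace (arr \<G>). \<epsilon> p = rng \<G> \<gamma> \<longrightarrow> \<epsilon> (b p \<gamma>) = src \<G> \<gamma>) \<and>
     (\<forall>p \<in> topspace P. \<forall>(\<gamma>, \<eta>) \<in> composable \<G>. \<epsilon> p = rng \<G> \<gamma> \<longrightarrow>
        b p (gmul \<G> \<gamma> \<eta>) = b (b p \<gamma>) \<eta>)"

definition principal_left_module ::
    "('a, 'o) groupoid \<Rightarrow> 'p topology \<Rightarrow> ('p \<Rightarrow> 'o) \<Rightarrow> ('a \<Rightarrow> 'p \<Rightarrow> 'p) \<Rightarrow> bool" where
  "principal_left_module \<G> P \<epsilon> a \<longleftrightarrow>
     left_module \<G> P \<epsilon> a \<and>
     (\<forall>p \<in> topspace P. \<forall>\<gamma> \<in> topspace (arr \<G>). src \<G> \<gamma> = \<epsilon> p \<longrightarrow> a \<gamma> p = p \<longrightarrow>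
        \<gamma> = gone \<G> (\<epsilon> p)) \<and>
     proper_map (subtopology (prod_topology (arr \<G>) P) {(\<gamma>, p). src \<G> \<gamma> = \<epsilon> p})
       (prod_topology P P) (\<lambda>(\<gamma>, p). (a \<gamma> p, p))"

definition principal_right_module ::
    "('a, 'o) groupoid \<Rightarrow> 'p topology \<Rightarrow> ('p \<Rightarrow> 'o) \<Rightarrow> ('p \<Rightarrow> 'a \<Rightarrow> 'p) \<Rightarrow> bool" where
  "principal_right_module \<G> P \<epsilon> b \<longleftrightarrow>
     right_module \<G> P \<epsilon> b \<and>
     (\<forall>p \<in> topspace P. \<forall>\<gamma> \<in> topspace (arr \<G>). \<epsilon> p = rng \<G> \<gamma> \<longrightarrow> b p \<gamma> = p \<longrightarrow>
        \<gamma> = gone \<G> (\<epsilon> p)) \<and>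
     proper_map (subtopology (prod_topology P (arr \<G>)) {(p, \<gamma>). \<epsilon> p = rng \<G> \<gamma>})
       (prod_topology P P) (\<lambda>(p, \<gamma>). (p, b p \<gamma>))"

definition left_orbit ::
    "('a, 'o) groupoid \<Rightarrow> ('p \<Rightarrow> 'o) \<Rightarrow> ('a \<Rightarrow> 'p \<Rightarrow> 'p) \<Rightarrow> 'p \<Rightarrow> 'p set" where
  "left_orbit \<G> \<epsilon> a p = {a \<gamma> p |\<gamma>. \<gamma> \<in> topspace (arr \<G>) \<and> src \<G> \<gamma> = \<epsilon> p}"

definition right_orbit ::
    "('a, 'o) groupoid \<Rightarrow> ('p \<Rightarrow> 'o) \<Rightarrow> ('p \<Rightarrow> 'a \<Rightarrow> 'p) \<Rightarrow> 'p \<Rightarrow> 'p set" where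
  "right_orbit \<G> \<epsilon> b p = {b p \<gamma> |\<gamma>. \<gamma> \<in> topspace (arr \<G>) \<and> \<epsilon> p = rng \<G> \<gamma>}"

definition morita_equivalence ::
    "('a, 'o) groupoid \<Rightarrow> ('b, 'u) groupoid \<Rightarrow> 'p topology \<Rightarrow> ('p \<Rightarrow> 'o) \<Rightarrow> ('a \<Rightarrow> 'p \<Rightarrow> 'p) \<Rightarrow>
     ('p \<Rightarrow> 'u) \<Rightarrow> ('p \<Rightarrow> 'b \<Rightarrow> 'p) \<Rightarrow> bool" where
  "morita_equivalence \<G> \<H> P \<epsilon>l a \<epsilon>r b \<longleftrightarrow>
     topological_groupoid \<G> \<and> topological_groupoid \<H> \<and>
     principal_left_module \<G> P \<epsilon>l a \<and> principal_right_module \<H> P \<epsilon>r b \<and>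
     (\<forall>p \<in> topspace P. \<forall>\<gamma> \<in> topspace (arr \<G>). src \<G> \<gamma> = \<epsilon>l p \<longrightarrow> \<epsilon>r (a \<gamma> p) = \<epsilon>r p) \<and>
     (\<forall>p \<in> topspace P. \<forall>\<eta> \<in> topspace (arr \<H>). \<epsilon>r p = rng \<H> \<eta> \<longrightarrow> \<epsilon>l (b p \<eta>) = \<epsilon>l p) \<and>
     (\<forall>p \<in> topspace P. \<forall>\<gamma> \<in> topspace (arr \<G>). \<forall>\<eta> \<in> topspace (arr \<H>).
        src \<G> \<gamma> = \<epsilon>l p \<longrightarrow> \<epsilon>r p = rng \<H> \<eta> \<longrightarrow> b (a \<gamma> p) \<eta> = a \<gamma> (b p \<eta>)) \<and>
     (\<exists>\<phi>. homeomorphic_map (quotient_topology P (right_orbit \<H> \<epsilon>r b)) (obj \<G>) \<phi> \<and>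
          (\<forall>p \<in> topspace P. \<phi> (right_orbit \<H> \<epsilon>r b p) = \<epsilon>l p)) \<and>
     (\<exists>\<psi>. homeomorphic_map (quotient_topology P (left_orbit \<G> \<epsilon>l a)) (obj \<H>) \<psi> \<and>
          (\<forall>p \<in> topspace P. \<psi> (left_orbit \<G> \<epsilon>l a p) = \<epsilon>r p))"

text \<open>The equations for the moment maps are what makes \<open>g(\<gamma>) g(p) g(\<eta>)\<close> defined.\<close>

definition equivariant_morita_equivalence ::
    "'g top_group \<Rightarrow> ('a, 'o) groupoid \<Rightarrow> ('g \<Rightarrow> 'a \<Rightarrow> 'a) \<Rightarrow> ('b, 'u) groupoid \<Rightarrow> ('g \<Rightarrow> 'b \<Rightarrow> 'b) \<Rightarrow>
     'p topology \<Rightarrow> ('p \<Rightarrow> 'o) \<Rightarrow> ('a \<Rightarrow> 'p \<Rightarrow> 'p) \<Rightarrow> ('p \<Rightarrow> 'u) \<Rightarrow> ('p \<Rightarrow> 'b \<Rightarrow> 'p) \<Rightarrow>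
     ('g \<Rightarrow> 'p \<Rightarrow> 'p) \<Rightarrow> bool" where
  "equivariant_morita_equivalence G \<G> \<alpha> \<H> \<beta> P \<epsilon>l a \<epsilon>r b \<theta> \<longleftrightarrow>
     topological_G_groupoid G \<G> \<alpha> \<and> topological_G_groupoid G \<H> \<beta> \<and>
     morita_equivalence \<G> \<H> P \<epsilon>l a \<epsilon>r b \<and> continuous_group_action G P \<theta> \<and>
     (\<forall>g \<in> carrier G. \<forall>p \<in> topspace P.
        \<epsilon>l (\<theta> g p) = obj_act \<G> \<alpha> g (\<epsilon>l p) \<and> \<epsilon>r (\<theta> g p) = obj_act \<H> \<beta> g (\<epsilon>r p) \<and>
        (\<forall>\<gamma> \<in> topspace (arr \<G>). \<forall>\<eta> \<in> topspace (arr \<H>).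
           src \<G> \<gamma> = \<epsilon>l p \<longrightarrow> \<epsilon>r p = rng \<H> \<eta> \<longrightarrow>
           \<theta> g (b (a \<gamma> p) \<eta>) = b (a (\<alpha> g \<gamma>) (\<theta> g p)) (\<beta> g \<eta>)))"

section \<open>Crossed products, principal bundles and induced groupoids\<close>

text \<open>The product rule \<open>(g, \<gamma>) (g', g\<inverse>\<gamma>') = (g g', \<gamma> \<gamma>')\<close> reads
  \<open>(g, \<gamma>) (h, \<delta>) = (g h, \<gamma> (g \<delta>))\<close> in terms of the actual factors.\<close>

definition crossed_product ::
    "'g top_group \<Rightarrow> ('g \<Rightarrow> 'a \<Rightarrow> 'a) \<Rightarrow> ('a, 'o) groupoid \<Rightarrow> ('g \<times> 'a, 'o) groupoid" where
  "crossed_product G \<alpha> \<H> =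
     \<lparr> arr = prod_topology (gtop G) (arr \<H>),
       obj = obj \<H>,
       src = (\<lambda>(g, \<gamma>). src \<H> (\<alpha> (inv\<^bsub>G\<^esub> g) \<gamma>)),
       rng = (\<lambda>(g, \<gamma>). rng \<H> \<gamma>),
       gmul = (\<lambda>(g, \<gamma>) (h, \<delta>). (g \<otimes>\<^bsub>G\<^esub> h, gmul \<H> \<gamma> (\<alpha> g \<delta>))),
       gone = (\<lambda>x. (\<one>\<^bsub>G\<^esub>, gone \<H> x)),
       ginv = (\<lambda>(g, \<gamma>). (inv\<^bsub>G\<^esub> g, \<alpha> (inv\<^bsub>G\<^esub> g) (ginv \<H> \<gamma>))) \<rparr>"

definition crossed_haar :: "'g measure \<Rightarrow> ('o \<Rightarrow> 'a measure) \<Rightarrow> 'o \<Rightarrow> ('g \<times> 'a) measure" where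
  "crossed_haar \<mu> \<nu> x = \<mu> \<Otimes>\<^sub>M \<nu> x"

definition principal_bundle ::
    "'g top_group \<Rightarrow> ('a \<Rightarrow> 'g) \<Rightarrow> ('a, 'o) groupoid \<Rightarrow> ('g \<times> 'a, 'g \<times> 'o) groupoid" where
  "principal_bundle G \<rho> \<G> =
     \<lparr> arr = prod_topology (gtop G) (arr \<G>),
       obj = prod_topology (gtop G) (obj \<G>),
       src = (\<lambda>(g, \<gamma>). (g \<otimes>\<^bsub>G\<^esub> \<rho> \<gamma>, src \<G> \<gamma>)),
       rng = (\<lambda>(g, \<gamma>). (g, rng \<G> \<gamma>)),
       gmul = (\<lambda>(g, \<gamma>) (h, \<eta>). (g, gmul \<G> \<gamma> \<eta>)),
       gone = (\<lambda>(g, x). (g, gone \<G> x)),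
       ginv = (\<lambda>(g, \<gamma>). (g \<otimes>\<^bsub>G\<^esub> \<rho> \<gamma>, ginv \<G> \<gamma>)) \<rparr>"

definition principal_bundle_haar ::
    "'g top_group \<Rightarrow> ('a, 'o) groupoid \<Rightarrow> ('o \<Rightarrow> 'a measure) \<Rightarrow> 'g \<times> 'o \<Rightarrow> ('g \<times> 'a) measure" where
  "principal_bundle_haar G \<G> \<nu> =
     (\<lambda>(g, x). distr (\<nu> x) (borel_of (prod_topology (gtop G) (arr \<G>))) (\<lambda>\<gamma>. (g, \<gamma>)))"

definition principal_bundle_action :: "'g top_group \<Rightarrow> 'g \<Rightarrow> 'g \<times> 'a \<Rightarrow> 'g \<times> 'a" where
  "principal_bundle_action G k = (\<lambda>(g, \<gamma>). (k \<otimes>\<^bsub>G\<^esub> g, \<gamma>))"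

definition induced_groupoid ::
    "'p topology \<Rightarrow> ('p \<Rightarrow> 'o) \<Rightarrow> ('p \<Rightarrow> 'a \<Rightarrow> 'p) \<Rightarrow> ('a, 'o) groupoid \<Rightarrow> ('p \<times> 'a, 'p) groupoid" where
  "induced_groupoid P \<epsilon> b \<G> =
     \<lparr> arr = subtopology (prod_topology P (arr \<G>)) {(p, \<gamma>). \<epsilon> p = rng \<G> \<gamma>},
       obj = P,
       src = (\<lambda>(p, \<gamma>). b p \<gamma>),
       rng = (\<lambda>(p, \<gamma>). p),
       gmul = (\<lambda>(p, \<gamma>) (p', \<eta>). (p, gmul \<G> \<gamma> \<eta>)),
       gone = (\<lambda>p. (p, gone \<G> (\<epsilon> p))),
       ginv = (\<lambda>(p, \<gamma>). (b p \<gamma>, ginv \<G> \<gamma>)) \<rparr>"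

definition induced_haar ::
    "'p topology \<Rightarrow> ('p \<Rightarrow> 'o) \<Rightarrow> ('p \<Rightarrow> 'a \<Rightarrow> 'p) \<Rightarrow> ('a, 'o) groupoid \<Rightarrow> ('o \<Rightarrow> 'a measure) \<Rightarrow>
     'p \<Rightarrow> ('p \<times> 'a) measure" where
  "induced_haar P \<epsilon> b \<G> \<nu> p =
     distr (restrict_space (\<nu> (\<epsilon> p)) (range_fibre \<G> (\<epsilon> p)))
       (borel_of (arr (induced_groupoid P \<epsilon> b \<G>))) (\<lambda>\<gamma>. (p, \<gamma>))"

section \<open>The canonical module of a crossed product\<close>

definition canonical_space :: "'g top_group \<Rightarrow> ('a, 'o) groupoid \<Rightarrow> ('g \<times> 'o) topology" where
  "canonical_space G \<H> = prod_topology (gtop G) (obj \<H>)"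

text \<open>\<open>(g, r \<gamma>) \<cdot> (h, \<gamma>) = (g h, h\<inverse> s \<gamma>)\<close>; the object component of the left factor is
  determined by the arrow.\<close>

definition canonical_act ::
    "'g top_group \<Rightarrow> ('g \<Rightarrow> 'a \<Rightarrow> 'a) \<Rightarrow> ('a, 'o) groupoid \<Rightarrow> 'g \<times> 'o \<Rightarrow> 'g \<times> 'a \<Rightarrow> 'g \<times> 'o" where
  "canonical_act G \<alpha> \<H> = (\<lambda>(g, x) (h, \<gamma>). (g \<otimes>\<^bsub>G\<^esub> h, obj_act \<H> \<alpha> (inv\<^bsub>G\<^esub> h) (src \<H> \<gamma>)))"

definition canonical_induced ::
    "'g top_group \<Rightarrow> ('g \<Rightarrow> 'a \<Rightarrow> 'a) \<Rightarrow> ('a, 'o) groupoid \<Rightarrow>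
     (('g \<times> 'o) \<times> ('g \<times> 'a), 'g \<times> 'o) groupoid" where
  "canonical_induced G \<alpha> \<H> =
     induced_groupoid (canonical_space G \<H>) snd (canonical_act G \<alpha> \<H>) (crossed_product G \<alpha> \<H>)"

definition canonical_induced_haar ::
    "'g top_group \<Rightarrow> ('g \<Rightarrow> 'a \<Rightarrow> 'a) \<Rightarrow> ('a, 'o) groupoid \<Rightarrow> 'g measure \<Rightarrow> ('o \<Rightarrow> 'a measure) \<Rightarrow>
     'g \<times> 'o \<Rightarrow> (('g \<times> 'o) \<times> ('g \<times> 'a)) measure" where
  "canonical_induced_haar G \<alpha> \<H> \<mu> \<nu> =
     induced_haar (canonical_space G \<H>) snd (canonical_act G \<alpha> \<H>) (crossed_product G \<alpha> \<H>)
       (crossed_haar \<mu> \<nu>)"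

text \<open>An arrow of the induced groupoid is a pair \<open>((g, x), (h, \<gamma>))\<close> with \<open>x = r \<gamma>\<close>. Dropping the
  redundant \<open>x\<close> gives the description by triples \<open>(g, h, \<gamma>)\<close>. The action \<open>tau\<close> is
  \<open>k \<cdot> (g, h, \<gamma>) = (k g, h, \<gamma>)\<close> in these terms.\<close>

definition to_triple :: "('g \<times> 'o) \<times> ('g \<times> 'a) \<Rightarrow> 'g \<times> ('g \<times> 'a)" where
  "to_triple = (\<lambda>((g, x), (h, \<gamma>)). (g, (h, \<gamma>)))"

definition tau ::
    "'g top_group \<Rightarrow> 'g \<Rightarrow> ('g \<times> 'o) \<times> ('g \<times> 'a) \<Rightarrow> ('g \<times> 'o) \<times> ('g \<times> 'a)" where
  "tau G k = (\<lambda>((g, x), (h, \<gamma>)). ((k \<otimes>\<^bsub>G\<^esub> g, x), (h, \<gamma>)))"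

end

theory Submission
  imports Defs
begin

text \<open>The induced groupoid has the arrows \<open>(g, h, \<gamma>)\<close>, and \<open>(g, h, \<gamma>) \<mapsto> g \<gamma>\<close> is a homomorphism to \<open>\<H>\<close>
lying over the map \<open>(g, x) \<mapsto> g x\<close> of object spaces. An arrow of the induced groupoid is
determined by its end points and by its image, and every arrow of \<open>\<H>\<close> between the images of
two objects arises. So the induced groupoid is the pullback of \<open>\<H>\<close> along
\<open>(g, x) \<mapsto> g x\<close>, a map with a continuous section, and a groupoid is Morita equivalent to such a
pullback. The equivalence bimodule is the set of pairs of an object \<open>(g, x)\<close> and an arrow
\<open>\<gamma>\<close> with source \<open>g x\<close>; because \<open>x\<close> is redundant it is the space \<open>G \<times> \<H>\<^sub>1\<close>,
on which \<open>k\<close> acts by \<open>(g, \<gamma>) \<mapsto> (k g, k \<gamma>)\<close>.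

On this bimodule both division maps are given by formulas in the inverses of \<open>G\<close> and \<open>\<H>\<close>
and are defined on closed sets of pairs, which gives properness (\<open>principal_left\<close>,
\<open>principal_right\<close>). Both moment maps have continuous sections and the orbits of the opposite
action as fibres, which gives the two homeomorphisms of orbit spaces (\<open>morita\<close>). The
axioms of the crossed product, of its module and of the induced groupoid reduce to those of \<open>G\<close>
and \<open>\<H>\<close> through the reformulation \<open>crossed_composable\<close> of composability.

The measure-theoretic part rests on two general facts. A Haar system on a groupoid induces one on
\<open>P \<rtimes> \<G>\<close> for every second countable locally compact Hausdorff right module \<open>P\<close>
(\<open>induced_left_haar_system\<close>), because range fibres of the induced groupoid are range fibres
of \<open>\<G>\<close>; continuity follows by extending functions from the closed set of arrows
(\<open>Cc_extend\<close>) and from the joint continuity of parametric integrals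
(\<open>continuous_parametric_integral\<close>). For the crossed product the system
\<open>\<mu> \<times> \<nu> x\<close> is invariant by Fubini's theorem, the left invariance of \<open>\<mu>\<close> and \<open>\<nu>\<close>, and the
invariance of \<open>\<nu>\<close> under the action (\<open>invariant_crossed_haar\<close>).\<close>

section \<open>Proper maps, quotients and products\<close>

text \<open>A free action is proper once the pairs of points on a common orbit form a closed set and the
element that moves the first point to the second depends continuously on the pair: the map
\<open>f\<close> below is then a homeomorphism onto a closed subspace. Both actions on the Morita
bimodule are treated in this way.\<close>

lemma proper_map_closed_image:
  assumes f: "continuous_map X Y f" and C: "closedin Y C"
    and g: "continuous_map (subtopology Y C) X g"
    and fC: "\<And>x. x \<in> topspace X \<Longrightarrow> f x \<in> C"
    and gf: "\<And>x. x \<in> topspace X \<Longrightarrow> g (f x) = x"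
    and fg: "\<And>y. y \<in> C \<Longrightarrow> f (g y) = y"
  shows "proper_map X Y f"
proof -
  have "homeomorphic_maps X (subtopology Y C) f g"
    using assms by (auto simp: homeomorphic_maps_def continuous_map_in_subtopology)
  then have "proper_map X (subtopology Y C) f"
    using homeomorphic_imp_proper_map homeomorphic_map_maps by blast
  moreover have "proper_map (subtopology Y C) Y id"
    unfolding injective_imp_proper_eq_closed_map[OF inj_on_id] closed_map_inclusion_eq
    using C by (simp add: closedin_subset inf.absorb2)
  ultimately show ?thesis
    using proper_map_compose by fastforce
qed

text \<open>A map with a continuous section is a quotient map. With \<open>q\<close> sending a point to its orbit
and \<open>f\<close> a moment map whose fibres are the orbits, this identifies the orbit space with
the object space.\<close>

lemma homeomorphic_map_quotient_section:
  assumes f: "continuous_map P Y f" and s: "continuous_map Y P s"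
    and fs: "\<And>y. y \<in> topspace Y \<Longrightarrow> f (s y) = y"
    and q: "\<And>p p'. p \<in> topspace P \<Longrightarrow> p' \<in> topspace P \<Longrightarrow> q p = q p' \<longleftrightarrow> f p = f p'"
  shows "\<exists>\<phi>. homeomorphic_map (quotient_topology P q) Y \<phi> \<and> (\<forall>p \<in> topspace P. \<phi> (q p) = f p)"
proof -
  define \<phi> where "\<phi> z = f (SOME p. p \<in> topspace P \<and> q p = z)" for z
  have \<phi>: "\<phi> (q p) = f p" if "p \<in> topspace P" for p
  proof -
    have "\<exists>p'. p' \<in> topspace P \<and> q p' = q p" using that by blast
    from someI_ex[OF this] show ?thesis unfolding \<phi>_def using q that by metis
  qed
  have top: "topspace (quotient_topology P q) = q ` topspace P"
  proof (rule antisym)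
    show "topspace (quotient_topology P q) \<subseteq> q ` topspace P"
      using openin_quotient_topology[of P q "topspace (quotient_topology P q)"] by simp
    have "{x \<in> topspace P. q x \<in> q ` topspace P} = topspace P" by auto
    then have "openin (quotient_topology P q) (q ` topspace P)"
      by (simp add: openin_quotient_topology)
    then show "q ` topspace P \<subseteq> topspace (quotient_topology P q)"
      by (rule openin_subset)
  qed
  have "homeomorphic_maps (quotient_topology P q) Y \<phi> (q \<circ> s)"
    unfolding homeomorphic_maps_def
  proof (intro conjI ballI)
    show "continuous_map (quotient_topology P q) Y \<phi>"
      unfolding continuous_map
    proof (intro conjI allI impI)
      show "\<phi> ` topspace (quotient_topology P q) \<subseteq> topspace Y"
        using continuous_map_funspace[OF f] \<phi> by (auto simp: top)
      fix U assume U: "openin Y U"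
      have "{x \<in> topspace P. q x \<in> {z \<in> topspace (quotient_topology P q). \<phi> z \<in> U}}
          = {x \<in> topspace P. f x \<in> U}" using \<phi> q by (auto simp: top)
      then show "openin (quotient_topology P q) {z \<in> topspace (quotient_topology P q). \<phi> z \<in> U}"
        using openin_continuous_map_preimage[OF f U] by (auto simp: openin_quotient_topology top)
    qed
    have sP: "s y \<in> topspace P" if "y \<in> topspace Y" for y
      using continuous_map_funspace[OF s] that by auto
    show "continuous_map Y (quotient_topology P q) (q \<circ> s)"
      unfolding continuous_map
    proof (intro conjI allI impI)
      show "(q \<circ> s) ` topspace Y \<subseteq> topspace (quotient_topology P q)"
        using sP by (auto simp: top)
      fix U assume "openin (quotient_topology P q) U"
      then have "openin P {x \<in> topspace P. q x \<in> U}" by (simp add: openin_quotient_topology)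
      from openin_continuous_map_preimage[OF s this]
      show "openin Y {y \<in> topspace Y. (q \<circ> s) y \<in> U}"
        using sP by (simp add: conj_commute cong: conj_cong)
    qed
    show "(q \<circ> s) (\<phi> z) = z" if "z \<in> topspace (quotient_topology P q)" for z
    proof -
      obtain p where p: "p \<in> topspace P" "z = q p" using \<open>z \<in> _\<close> unfolding top by blast
      then have "f p \<in> topspace Y" using continuous_map_funspace[OF f] by blast
      then show ?thesis using p \<phi> q[OF sP p(1)] fs by simp
    qed
    show "\<phi> ((q \<circ> s) y) = y" if "y \<in> topspace Y" for y
      using that \<phi> sP fs by simp
  qed
  then show ?thesis using \<phi> homeomorphic_map_maps by blast
qed

lemma second_countable_prod_topology:
  assumes "second_countable X" "second_countable Y"
  shows "second_countable (prod_topology X Y)"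
proof -
  obtain A where "countable A \<and> (\<forall>V \<in> A. openin X V) \<and>
      (\<forall>U x. openin X U \<and> x \<in> U \<longrightarrow> (\<exists>V \<in> A. x \<in> V \<and> V \<subseteq> U))"
    using assms(1) unfolding second_countable_def ..
  note A = conjunct1[OF this] conjunct1[OF conjunct2[OF this]] conjunct2[OF conjunct2[OF this]]
  obtain B where "countable B \<and> (\<forall>V \<in> B. openin Y V) \<and>
      (\<forall>U x. openin Y U \<and> x \<in> U \<longrightarrow> (\<exists>V \<in> B. x \<in> V \<and> V \<subseteq> U))"
    using assms(2) unfolding second_countable_def ..
  note B = conjunct1[OF this] conjunct1[OF conjunct2[OF this]] conjunct2[OF conjunct2[OF this]]
  let ?C = "(\<lambda>(a, b). a \<times> b) ` (A \<times> B)"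
  have "\<exists>V\<in>?C. z \<in> V \<and> V \<subseteq> U" if U: "openin (prod_topology X Y) U" "z \<in> U" for U z
  proof -
    obtain x y where z: "z = (x, y)" by (cases z)
    obtain V W where VW: "openin X V" "openin Y W" "x \<in> V" "y \<in> W" "V \<times> W \<subseteq> U"
      using U(1)[unfolded openin_prod_topology_alt] U(2)[unfolded z] by meson
    obtain a where "a \<in> A" "x \<in> a" "a \<subseteq> V" using A(3)[rule_format, OF conjI, OF VW(1,3)] by blast
    moreover obtain b where "b \<in> B" "y \<in> b" "b \<subseteq> W" using B(3)[rule_format, OF conjI, OF VW(2,4)] by blast
    moreover note VW(5)
    ultimately show ?thesis unfolding z by (intro bexI[of _ "a \<times> b"]) auto
  qed
  moreover have "countable ?C" using A(1) B(1) by blast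
  ultimately show ?thesis unfolding second_countable_def
    using A(2) B(2) by (intro exI[of _ ?C]) (auto simp: openin_prod_Times_iff)
qed

section \<open>Compactly supported functions\<close>

lemma CcI:
  assumes "Hausdorff_space X" "continuous_map X euclideanreal f" "compactin X K"
    and "\<And>x. x \<in> topspace X \<Longrightarrow> x \<notin> K \<Longrightarrow> f x = 0"
  shows "f \<in> Cc X"
proof -
  have K: "closedin X K" using assms(1,3) by (rule compactin_imp_closedin)
  have "X closure_of {x \<in> topspace X. f x \<noteq> 0} \<subseteq> K"
    using K assms(4) by (intro closure_of_minimal) auto
  then have "compactin X (X closure_of {x \<in> topspace X. f x \<noteq> 0})"
    using assms(3) closed_compactin closedin_closure_of by blast
  then show ?thesis using assms(2) by (simp add: Cc_def)
qed

lemma Cc_compact_support: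
  assumes "f \<in> Cc X"
  obtains K where "compactin X K" "\<And>x. x \<in> topspace X \<Longrightarrow> x \<notin> K \<Longrightarrow> f x = 0"
proof
  show "compactin X (X closure_of {x \<in> topspace X. f x \<noteq> 0})"
    using assms by (simp add: Cc_def)
  show "f x = 0" if "x \<in> topspace X" "x \<notin> X closure_of {x \<in> topspace X. f x \<noteq> 0}" for x
    using that closure_of_subset[of "{x \<in> topspace X. f x \<noteq> 0}" X] by auto
qed

lemma Cc_continuous: "f \<in> Cc X \<Longrightarrow> continuous_map X euclideanreal f"
  by (simp add: Cc_def)

lemma compact_neighbourhood:
  assumes "locally_compact_space X" "Hausdorff_space X" "compactin X K"
  obtains U L where "openin X U" "compactin X L" "K \<subseteq> U" "U \<subseteq> L"
proof -
  have "\<forall>K. compactin X K \<longrightarrow>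
      (\<exists>U L. openin X U \<and> compactin X L \<and> closedin X L \<and> K \<subseteq> U \<and> U \<subseteq> L)"
    using locally_compact_space_compact_closed_compact[of X] assms(1,2) by simp
  from this[rule_format, OF assms(3)] that show ?thesis by (elim exE conjE)
qed

lemma Cc_cutoff:
  assumes X: "locally_compact_space X" "Hausdorff_space X" and K: "compactin X K"
  obtains \<phi> where "\<phi> \<in> Cc X" "\<And>x. x \<in> K \<Longrightarrow> \<phi> x = (1::real)" "\<And>x. x \<in> topspace X \<Longrightarrow> 0 \<le> \<phi> x"
proof -
  have cr: "completely_regular_space X"
    using X locally_compact_regular_imp_completely_regular_space by blast
  obtain U L where UL: "openin X U" "compactin X L" "K \<subseteq> U" "U \<subseteq> L"
    using compact_neighbourhood[OF X K] by metis
  have "closedin X (topspace X - U)" "disjnt K (topspace X - U)"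
    using UL by (auto simp: disjnt_def)
  then obtain \<phi> where \<phi>: "continuous_map X (top_of_set {0..1::real}) \<phi>"
      "\<phi> ` (topspace X - U) \<subseteq> {0}" "\<phi> ` K \<subseteq> {1}"
    using Urysohn_completely_regular_compact_closed[of 0 1, OF _ cr K] by force
  have "\<phi> \<in> Cc X"
    using \<phi>(1,2) UL X by (intro CcI[where K = L]) (auto simp: continuous_map_in_subtopology)
  moreover have "0 \<le> \<phi> x" if "x \<in> topspace X" for x
    using \<phi>(1) that by (auto simp: continuous_map_in_subtopology)
  ultimately show ?thesis using that \<phi>(3) by blast
qed

text \<open>In a locally compact Hausdorff space Tietze's theorem applies to compact sets. The extension is therefore made from
the part of \<open>Z\<close> inside a compact neighbourhood \<open>L\<close> of the support, and then multiplied by a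
cutoff function that vanishes outside \<open>L\<close>; on \<open>Z\<close> the product is \<open>f\<close>
again, since \<open>f\<close> is 0 wherever the cutoff differs from 1.\<close>

lemma Cc_extend:
  assumes X: "locally_compact_space X" "Hausdorff_space X"
    and Z: "closedin X Z" and f: "f \<in> Cc (subtopology X Z)"
  obtains F where "F \<in> Cc X" "\<And>x. x \<in> Z \<Longrightarrow> F x = f x"
proof -
  have cr: "completely_regular_space X"
    using X locally_compact_regular_imp_completely_regular_space by blast
  have ZX: "Z \<subseteq> topspace X" using Z by (rule closedin_subset)
  obtain K where K': "compactin (subtopology X Z) K"
    and K0: "\<And>x. x \<in> topspace (subtopology X Z) \<Longrightarrow> x \<notin> K \<Longrightarrow> f x = 0"
    using Cc_compact_support[OF f] by blast
  have K: "compactin X K" "K \<subseteq> Z" using K' by (auto simp: compactin_subtopology)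
  obtain U L where UL: "openin X U" "compactin X L" "K \<subseteq> U" "U \<subseteq> L"
    using compact_neighbourhood[OF X K(1)] by metis
  have S: "compactin X (L \<inter> Z)" using UL(2) Z by (rule compact_Int_closedin)
  have "continuous_map (subtopology X (L \<inter> Z)) euclideanreal f"
    using Cc_continuous[OF f] by (rule continuous_map_from_subtopology_mono) auto
  then obtain g where g: "continuous_map X euclideanreal g" "\<And>x. x \<in> L \<inter> Z \<Longrightarrow> g x = f x"
    using Tietze_extension_completely_regular[OF cr S is_interval_univ, of f] by auto
  have "closedin X (topspace X - U)" "disjnt K (topspace X - U)"
    using UL by (auto simp: disjnt_def)
  then obtain \<phi> where \<phi>: "continuous_map X euclideanreal \<phi>"
      "\<phi> ` (topspace X - U) \<subseteq> {0}" "\<phi> ` K \<subseteq> {1}"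
    using Urysohn_completely_regular_compact_closed_alt[of X K _ 0 1, OF cr K(1)] by metis
  show ?thesis
  proof
    show "(\<lambda>x. g x * \<phi> x) \<in> Cc X"
      using g(1) \<phi>(1,2) UL X by (intro CcI[where K = L] continuous_map_real_mult) auto
    fix x assume x: "x \<in> Z"
    then have xX: "x \<in> topspace X" using ZX by auto
    consider "x \<in> K" | "x \<in> U" "x \<notin> K" | "x \<notin> U" "x \<notin> K" using UL by blast
    then show "g x * \<phi> x = f x"
    proof cases
      case 1
      then have "\<phi> x = 1" "x \<in> L \<inter> Z" using \<phi>(3) UL x by auto
      then show ?thesis using g(2) by simp
    next
      case 2
      then have "x \<in> L \<inter> Z" "f x = 0" using UL x xX K0 by auto
      then show ?thesis using g(2) by simp
    next
      case 3
      then have "\<phi> x = 0" "f x = 0" using \<phi>(2) x xX K0 by auto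
      then show ?thesis by simp
    qed
  qed
qed

lemma Cc_slice:
  assumes A: "Hausdorff_space A" and f: "f \<in> Cc (prod_topology Y A)" and y: "y \<in> topspace Y"
  shows "(\<lambda>c. f (y, c)) \<in> Cc A"
proof -
  obtain K where K: "compactin (prod_topology Y A) K"
      "\<And>x. x \<in> topspace (prod_topology Y A) \<Longrightarrow> x \<notin> K \<Longrightarrow> f x = 0"
    using Cc_compact_support[OF f] by blast
  show ?thesis
  proof (rule CcI[OF A])
    have "continuous_map A (prod_topology Y A) (\<lambda>c. (y, c))"
      using y by (intro continuous_map_pairedI) auto
    then show "continuous_map A euclideanreal (\<lambda>c. f (y, c))"
      using continuous_map_compose[OF _ Cc_continuous[OF f]] by (simp add: o_def)
    show "compactin A (snd ` K)" using K(1) by (rule image_compactin) (rule continuous_map_snd)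
    show "f (y, c) = 0" if "c \<in> topspace A" "c \<notin> snd ` K" for c
      using that y K(2)[of "(y, c)"] by force
  qed
qed

section \<open>Borel sets and Radon measures\<close>

lemma space_borel_of [simp]: "space (borel_of X) = topspace X"
  unfolding borel_of_def by (rule space_measure_of) (auto dest: openin_subset)

lemma sets_borel_of: "sets (borel_of X) = sigma_sets (topspace X) {U. openin X U}"
  unfolding borel_of_def by (rule sets_measure_of) (auto dest: openin_subset)

lemma openin_sets_borel_of: "openin X U \<Longrightarrow> U \<in> sets (borel_of X)"
  by (simp add: sets_borel_of sigma_sets.Basic)

lemma closedin_sets_borel_of:
  assumes "closedin X C" shows "C \<in> sets (borel_of X)"
proof -
  have "space (borel_of X) - (topspace X - C) \<in> sets (borel_of X)"
    using assms by (intro sets.compl_sets openin_sets_borel_of) auto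
  moreover have "space (borel_of X) - (topspace X - C) = C"
    using closedin_subset[OF assms] by auto
  ultimately show ?thesis by simp
qed

text \<open>Translations in a groupoid are continuous on single range fibres only, hence the version for
maps defined on a subspace.\<close>

lemma continuous_map_measurable_subspace:
  assumes "continuous_map (subtopology X S) Y f" "sets M = sets (borel_of X)"
  shows "f \<in> restrict_space M S \<rightarrow>\<^sub>M borel_of Y"
proof -
  have sp: "space M = topspace X" using sets_eq_imp_space_eq[OF assms(2)] by simp
  show ?thesis unfolding borel_of_def[of Y]
  proof (rule measurable_measure_of)
    show "{U. openin Y U} \<subseteq> Pow (topspace Y)" by (auto dest: openin_subset)
    show "f \<in> space (restrict_space M S) \<rightarrow> topspace Y"
      using continuous_map_funspace[OF assms(1)] by (auto simp: space_restrict_space sp)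
    fix U assume "U \<in> {U. openin Y U}"
    then have "openin (subtopology X S) {x \<in> topspace (subtopology X S). f x \<in> U}"
      using assms(1) openin_continuous_map_preimage by blast
    then obtain T where T: "openin X T" "{x \<in> topspace (subtopology X S). f x \<in> U} = T \<inter> S"
      unfolding openin_subtopology by blast
    then have "f -` U \<inter> space (restrict_space M S) = S \<inter> T"
      by (auto simp: space_restrict_space sp)
    then show "f -` U \<inter> space (restrict_space M S) \<in> sets (restrict_space M S)"
      using openin_sets_borel_of[OF T(1)] by (auto simp: sets_restrict_space assms(2))
  qed
qed

lemma continuous_map_measurable:
  assumes "continuous_map X Y f" "sets M = sets (borel_of X)"
  shows "f \<in> M \<rightarrow>\<^sub>M borel_of Y"
proof -
  have sp: "space M = topspace X" using sets_eq_imp_space_eq[OF assms(2)] by simp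
  show ?thesis unfolding borel_of_def[of Y]
  proof (rule measurable_measure_of)
    show "{U. openin Y U} \<subseteq> Pow (topspace Y)" by (auto dest: openin_subset)
    show "f \<in> space M \<rightarrow> topspace Y"
      using continuous_map_funspace[OF assms(1)] by (auto simp: sp)
    fix U assume "U \<in> {U. openin Y U}"
    then have "openin X {x \<in> topspace X. f x \<in> U}"
      using assms(1) openin_continuous_map_preimage by blast
    moreover have "f -` U \<inter> space M = {x \<in> topspace X. f x \<in> U}" by (auto simp: sp)
    ultimately show "f -` U \<inter> space M \<in> sets M"
      using openin_sets_borel_of assms(2) by metis
  qed
qed

lemma sets_borel_of_euclidean: "sets (borel_of euclidean) = sets borel"
  by (simp add: sets_borel_of borel_def)

lemma continuous_map_borel_measurable:
  fixes f :: "'a \<Rightarrow> 'b::topological_space"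
  assumes "continuous_map X euclidean f" "sets M = sets (borel_of X)"
  shows "f \<in> borel_measurable M"
  using continuous_map_measurable[OF assms] measurable_cong_sets[OF refl sets_borel_of_euclidean]
  by blast

lemma radon_measure_sets: "radon_measure X M \<Longrightarrow> sets M = sets (borel_of X)"
  by (simp add: radon_measure_def)

lemma radon_measure_space: "radon_measure X M \<Longrightarrow> space M = topspace X"
  using sets_eq_imp_space_eq[OF radon_measure_sets] by simp

lemma compactin_sets_radon:
  assumes "Hausdorff_space X" "radon_measure X M" "compactin X K"
  shows "K \<in> sets M"
  using assms closedin_sets_borel_of compactin_imp_closedin radon_measure_sets by blast

lemma integrable_compact_support:
  fixes f :: "'a \<Rightarrow> real"
  assumes X: "Hausdorff_space X" "radon_measure X M" and K: "compactin X K"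
    and f: "f \<in> borel_measurable M" "\<And>x. x \<in> K \<Longrightarrow> \<bar>f x\<bar> \<le> B"
      "\<And>x. x \<in> topspace X \<Longrightarrow> x \<notin> K \<Longrightarrow> f x = 0"
  shows "integrable M f"
proof (rule integrableI_bounded_set)
  show "K \<in> sets M" using X K by (rule compactin_sets_radon)
  show "emeasure M K < \<infinity>" using X(2) K by (simp add: radon_measure_def)
  show "AE x in M. x \<in> K \<longrightarrow> norm (f x) \<le> B" using f(2) by auto
  show "AE x in M. x \<notin> K \<longrightarrow> f x = 0"
    using f(3) radon_measure_space[OF X(2)] by (intro AE_I2) auto
qed (rule f(1))

lemma continuous_map_bounded_on_compact:
  assumes "continuous_map X euclideanreal f" "compactin X K"
  obtains B where "\<And>x. x \<in> K \<Longrightarrow> \<bar>f x\<bar> \<le> B"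
proof -
  have "compact (f ` K)" using image_compactin[OF assms(2,1)] by simp
  then have "bounded (f ` K)" by (rule compact_imp_bounded)
  then show ?thesis using that unfolding bounded_iff by auto
qed

lemma integrable_Cc:
  assumes X: "Hausdorff_space X" "radon_measure X M" and f: "f \<in> Cc X"
  shows "integrable M f"
proof -
  obtain K where K: "compactin X K" "\<And>x. x \<in> topspace X \<Longrightarrow> x \<notin> K \<Longrightarrow> f x = 0"
    using Cc_compact_support[OF f] by blast
  obtain B where "\<And>x. x \<in> K \<Longrightarrow> \<bar>f x\<bar> \<le> B"
    using continuous_map_bounded_on_compact[OF Cc_continuous[OF f] K(1)] by blast
  then show ?thesis
    using continuous_map_borel_measurable[OF Cc_continuous[OF f] radon_measure_sets[OF X(2)]] K
    by (intro integrable_compact_support[OF X K(1), of f B]) auto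
qed

lemma sigma_finite_radon:
  assumes X: "Hausdorff_space X" "locally_compact_space X" "second_countable X"
    and M: "radon_measure X M"
  shows "sigma_finite_measure M"
proof
  define \<U> where "\<U> = {U. openin X U \<and> (\<exists>K. compactin X K \<and> U \<subseteq> K)}"
  have "\<Union>\<U> = topspace X"
  proof (intro antisym subsetI)
    fix x assume "x \<in> topspace X"
    then obtain U K where "openin X U \<and> compactin X K \<and> x \<in> U \<and> U \<subseteq> K"
      using X(2) unfolding locally_compact_space_def by meson
    then show "x \<in> \<Union>\<U>" unfolding \<U>_def by blast
  qed (auto simp: \<U>_def dest: openin_subset)
  then obtain \<V> where \<V>: "countable \<V>" "\<V> \<subseteq> \<U>" "\<Union>\<V> = topspace X"
    using Lindelof_spaceD[OF second_countable_imp_Lindelof_space[OF X(3)], of \<U>]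
    by (auto simp: \<U>_def)
  show "\<exists>A. countable A \<and> A \<subseteq> sets M \<and> \<Union>A = space M \<and> (\<forall>a\<in>A. emeasure M a \<noteq> \<infinity>)"
  proof (intro exI[of _ \<V>] conjI ballI)
    show "\<V> \<subseteq> sets M"
      using \<V>(2) openin_sets_borel_of[of X] unfolding radon_measure_sets[OF M] \<U>_def by blast
    fix V assume "V \<in> \<V>"
    then obtain K where K: "compactin X K" "V \<subseteq> K" using \<V>(2) by (auto simp: \<U>_def)
    then have "emeasure M V \<le> emeasure M K"
      using compactin_sets_radon[OF X(1) M] by (intro emeasure_mono) auto
    also have "\<dots> < \<infinity>" using M K(1) by (simp add: radon_measure_def)
    finally show "emeasure M V \<noteq> \<infinity>" by simp
  qed (use \<V> radon_measure_space[OF M] in auto)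
qed

text \<open>Every open set of a product is a union of open rectangles; second countability makes the
union countable, which is what puts it into the product sigma algebra.\<close>

lemma sets_borel_of_prod:
  assumes "second_countable X" "second_countable Y"
  shows "sets (borel_of (prod_topology X Y)) = sets (borel_of X \<Otimes>\<^sub>M borel_of Y)"
proof (rule antisym)
  obtain A where "countable A \<and> (\<forall>V \<in> A. openin X V) \<and>
      (\<forall>U x. openin X U \<and> x \<in> U \<longrightarrow> (\<exists>V \<in> A. x \<in> V \<and> V \<subseteq> U))"
    using assms(1) unfolding second_countable_def ..
  note A = conjunct1[OF this] conjunct1[OF conjunct2[OF this]] conjunct2[OF conjunct2[OF this]]
  obtain B where "countable B \<and> (\<forall>V \<in> B. openin Y V) \<and>
      (\<forall>U x. openin Y U \<and> x \<in> U \<longrightarrow> (\<exists>V \<in> B. x \<in> V \<and> V \<subseteq> U))"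
    using assms(2) unfolding second_countable_def ..
  note B = conjunct1[OF this] conjunct1[OF conjunct2[OF this]] conjunct2[OF conjunct2[OF this]]
  let ?N = "borel_of X \<Otimes>\<^sub>M borel_of Y"
  have "U \<in> sets ?N" if U: "openin (prod_topology X Y) U" for U
  proof -
    define C where "C = {c \<in> A \<times> B. fst c \<times> snd c \<subseteq> U}"
    have "U = (\<Union>c\<in>C. fst c \<times> snd c)"
    proof (intro antisym subsetI)
      fix z assume z: "z \<in> U"
      obtain x y where xy: "z = (x, y)" by (cases z)
      obtain V W where VW: "openin X V" "openin Y W" "x \<in> V" "y \<in> W" "V \<times> W \<subseteq> U"
        using U[unfolded openin_prod_topology_alt] z[unfolded xy] by meson
      obtain a where a: "a \<in> A" "x \<in> a" "a \<subseteq> V"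
        using A(3)[rule_format, OF conjI, OF VW(1,3)] by blast
      obtain b where b: "b \<in> B" "y \<in> b" "b \<subseteq> W"
        using B(3)[rule_format, OF conjI, OF VW(2,4)] by blast
      have "(a, b) \<in> C" using a b VW(5) by (auto simp: C_def)
      then show "z \<in> (\<Union>c\<in>C. fst c \<times> snd c)" using a b xy by force
    qed (auto simp: C_def)
    moreover have "countable C"
      using A(1) B(1) by (rule countable_subset[OF _ countable_SIGMA, rotated]) (auto simp: C_def)
    moreover have "fst c \<times> snd c \<in> sets ?N" if "c \<in> C" for c
      using that A(2) B(2) by (intro pair_measureI openin_sets_borel_of) (auto simp: C_def)
    ultimately show ?thesis using sets.countable_UN'[of C "\<lambda>c. fst c \<times> snd c" ?N] by auto
  qed
  then show "sets (borel_of (prod_topology X Y)) \<subseteq> sets ?N"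
    unfolding sets_borel_of[of "prod_topology X Y"]
    using sets.sigma_sets_subset[of "{U. openin (prod_topology X Y) U}" ?N]
    by (auto simp: space_pair_measure)
  show "sets ?N \<subseteq> sets (borel_of (prod_topology X Y))"
  proof (rule sets_pair_in_sets)
    fix a b assume a: "a \<in> sets (borel_of X)" and b: "b \<in> sets (borel_of Y)"
    let ?P = "borel_of (prod_topology X Y)"
    have "fst -` a \<inter> space ?P \<in> sets ?P" "snd -` b \<inter> space ?P \<in> sets ?P"
      by (rule measurable_sets[OF continuous_map_measurable a] measurable_sets[OF continuous_map_measurable b],
          (rule continuous_map_fst continuous_map_snd), rule refl)+
    then have "(fst -` a \<inter> space ?P) \<inter> (snd -` b \<inter> space ?P) \<in> sets ?P" by blast
    moreover have "(fst -` a \<inter> space ?P) \<inter> (snd -` b \<inter> space ?P) = a \<times> b"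
      using sets.sets_into_space[OF a] sets.sets_into_space[OF b] by auto
    ultimately show "a \<times> b \<in> sets ?P" by simp
  qed
qed

lemma radon_measure_pair:
  assumes X: "Hausdorff_space X" "locally_compact_space X" "second_countable X"
    and Y: "Hausdorff_space Y" "locally_compact_space Y" "second_countable Y"
    and M: "radon_measure X M" and N: "radon_measure Y N"
  shows "radon_measure (prod_topology X Y) (M \<Otimes>\<^sub>M N)"
  unfolding radon_measure_def
proof (intro conjI allI impI)
  show *: "sets (M \<Otimes>\<^sub>M N) = sets (borel_of (prod_topology X Y))"
    unfolding sets_borel_of_prod[OF X(3) Y(3)]
    using M N by (intro sets_pair_measure_cong) (auto simp: radon_measure_def)
  interpret N: sigma_finite_measure N using Y N by (rule sigma_finite_radon)
  fix K assume K: "compactin (prod_topology X Y) K"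
  have K1: "compactin X (fst ` K)" and K2: "compactin Y (snd ` K)"
    using K image_compactin continuous_map_fst continuous_map_snd by blast+
  note s = compactin_sets_radon[OF X(1) M K1] compactin_sets_radon[OF Y(1) N K2]
  have "emeasure (M \<Otimes>\<^sub>M N) K \<le> emeasure (M \<Otimes>\<^sub>M N) (fst ` K \<times> snd ` K)"
    using s by (intro emeasure_mono pair_measureI) (auto simp: image_iff; metis fst_conv snd_conv)+
  also have "\<dots> = emeasure M (fst ` K) * emeasure N (snd ` K)"
    using s by (rule N.emeasure_pair_measure_Times)
  also have "\<dots> < \<infinity>"
    using M N K1 K2 by (simp add: radon_measure_def ennreal_mult_less_top)
  finally show "emeasure (M \<Otimes>\<^sub>M N) K < \<infinity>" .
qed

section \<open>Integrals depending on a parameter\<close>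

lemma continuous_map_euclidean_metric:
  fixes f :: "'a \<Rightarrow> 'b::metric_space"
  shows "continuous_map X euclidean f \<longleftrightarrow>
    (\<forall>x \<in> topspace X. \<forall>e>0. \<exists>U. openin X U \<and> x \<in> U \<and> (\<forall>y\<in>U. dist (f x) (f y) < e))"
  using Met_TC.continuous_map_to_metric[of X f] by simp

text \<open>Moving \<open>y\<close> changes the slice \<open>f (y, \<cdot>)\<close> by at most a small multiple of a fixed
\<open>\<phi> \<in> Cc A\<close> that is 1 on \<open>K\<close>, and the integrals of \<open>\<phi>\<close> stay bounded near \<open>x0\<close>;
moving \<open>x\<close> with the slice fixed is covered by the assumed continuity of \<open>\<nu>\<close>. The compact
set \<open>K\<close> controls the second variable alone, so the lemma can be iterated: integrating one
variable of a function in \<open>Cc\<close> leaves a function of this kind.\<close>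

lemma continuous_parametric_integral:
  fixes f :: "'y \<times> 'a \<Rightarrow> real"
  assumes A: "locally_compact_space A" "Hausdorff_space A"
    and \<nu>: "\<And>x. x \<in> topspace X \<Longrightarrow> radon_measure A (\<nu> x)"
      "\<And>\<phi>. \<phi> \<in> Cc A \<Longrightarrow> continuous_map X euclideanreal (\<lambda>x. LINT c|\<nu> x. \<phi> c)"
    and f: "continuous_map (prod_topology Y A) euclideanreal f"
    and K: "compactin A K"
      "\<And>y c. y \<in> topspace Y \<Longrightarrow> c \<in> topspace A \<Longrightarrow> c \<notin> K \<Longrightarrow> f (y, c) = 0"
  shows "continuous_map (prod_topology Y X) euclideanreal (\<lambda>(y, x). LINT c|\<nu> x. f (y, c))"
  unfolding continuous_map_euclidean_metric
proof (intro ballI allI impI)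
  fix p and e :: real
  assume p: "p \<in> topspace (prod_topology Y X)" and e: "e > 0"
  obtain y0 x0 where p_eq: "p = (y0, x0)" and y0: "y0 \<in> topspace Y" and x0: "x0 \<in> topspace X"
    using p by (cases p) auto
  obtain \<phi> where \<phi>: "\<phi> \<in> Cc A" "\<And>x. x \<in> K \<Longrightarrow> \<phi> x = (1::real)" "\<And>x. x \<in> topspace A \<Longrightarrow> 0 \<le> \<phi> x"
    using Cc_cutoff[OF A K(1)] by blast
  define c0 where "c0 = (LINT c|\<nu> x0. \<phi> c)"
  have "c0 \<ge> 0" unfolding c0_def
    using \<phi>(3) radon_measure_space[OF \<nu>(1)[OF x0]] by (intro integral_nonneg_AE AE_I2) auto
  \<comment> \<open>Near \<open>x0\<close> the integral of \<open>\<phi>\<close> is below \<open>c0 + 1\<close>, so slices that differ by at most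
      \<open>d * \<phi>\<close> have integrals that differ by at most \<open>e / 2\<close>.\<close>
  define d where "d = e / (2 * (c0 + 1))"
  have d: "d > 0" "d * (c0 + 1) = e / 2" using \<open>c0 \<ge> 0\<close> e by (auto simp: d_def field_simps)
  have slice_cont: "continuous_map A euclideanreal (\<lambda>c. f (y, c))" if "y \<in> topspace Y" for y
  proof -
    have "continuous_map A (prod_topology Y A) (\<lambda>c. (y, c))"
      using that by (intro continuous_map_pairedI) auto
    then show ?thesis using continuous_map_compose[OF _ f] by (simp add: o_def)
  qed
  have slice: "(\<lambda>c. f (y, c)) \<in> Cc A" if "y \<in> topspace Y" for y
    using slice_cont[OF that] K that by (intro CcI[OF A(2)]) auto
  \<comment> \<open>By compactness of \<open>K\<close>, the slices of \<open>f\<close> near \<open>y0\<close> are uniformly close to the one at \<open>y0\<close>.\<close>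
  define W where "W = {z \<in> topspace (prod_topology Y A). \<bar>f z - f (y0, snd z)\<bar> < d}"
  have "continuous_map (prod_topology Y A) euclideanreal (\<lambda>z. \<bar>f z - f (y0, snd z)\<bar>)"
    using f continuous_map_compose[OF continuous_map_snd slice_cont[OF y0], of Y]
    by (intro continuous_map_real_abs continuous_map_diff) (auto simp: o_def)
  from openin_continuous_map_preimage[OF this, of "{..<d}"]
  have "openin (prod_topology Y A) W" by (simp add: W_def)
  moreover have "{y0} \<times> K \<subseteq> W"
    using y0 d compactin_subset_topspace[OF K(1)] by (auto simp: W_def)
  ultimately obtain V V' where V: "openin Y V" "y0 \<in> V" "K \<subseteq> V'" "V \<times> V' \<subseteq> W"
    using tube_lemma_right[OF _ K(1) y0] by metis
  have close: "\<bar>f (y, c) - f (y0, c)\<bar> \<le> d * \<phi> c" if "y \<in> V" "c \<in> topspace A" for y c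
  proof (cases "c \<in> K")
    case True
    then have "(y, c) \<in> W" using V that by blast
    then show ?thesis using \<phi>(2)[OF True] by (simp add: W_def)
  next
    case False
    have "y \<in> topspace Y" using V that openin_subset by blast
    then show ?thesis using K(2)[OF _ that(2) False] y0 \<phi>(3)[OF that(2)] d by simp
  qed
  obtain U1 where U1: "openin X U1" "x0 \<in> U1" "\<And>x. x \<in> U1 \<Longrightarrow> dist c0 (LINT c|\<nu> x. \<phi> c) < 1"
    using \<nu>(2)[OF \<phi>(1)] x0 unfolding continuous_map_euclidean_metric c0_def
    by (metis zero_less_one)
  obtain U2 where U2: "openin X U2" "x0 \<in> U2"
      "\<And>x. x \<in> U2 \<Longrightarrow> dist (LINT c|\<nu> x0. f (y0, c)) (LINT c|\<nu> x. f (y0, c)) < e / 2"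
    using \<nu>(2)[OF slice[OF y0]] x0 e unfolding continuous_map_euclidean_metric
    by (metis half_gt_zero)
  show "\<exists>U. openin (prod_topology Y X) U \<and> p \<in> U \<and> (\<forall>q\<in>U.
      dist (case p of (y, x) \<Rightarrow> LINT c|\<nu> x. f (y, c)) (case q of (y, x) \<Rightarrow> LINT c|\<nu> x. f (y, c)) < e)"
  proof (intro exI[of _ "V \<times> (U1 \<inter> U2)"] conjI ballI)
    show "openin (prod_topology Y X) (V \<times> (U1 \<inter> U2))"
      using V U1 U2 by (simp add: openin_prod_Times_iff openin_Int)
    show "p \<in> V \<times> (U1 \<inter> U2)" using V U1 U2 p_eq by simp
    fix q assume "q \<in> V \<times> (U1 \<inter> U2)"
    then obtain y x where q: "q = (y, x)" "y \<in> V" "x \<in> U1" "x \<in> U2" by blast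
    have y: "y \<in> topspace Y" and x: "x \<in> topspace X"
      using q V U1 openin_subset by blast+
    note int = integrable_Cc[OF A(2) \<nu>(1)[OF x]]
    have "\<bar>(LINT c|\<nu> x. f (y, c)) - (LINT c|\<nu> x. f (y0, c))\<bar>
        = \<bar>LINT c|\<nu> x. (f (y, c) - f (y0, c))\<bar>"
      using int[OF slice[OF y]] int[OF slice[OF y0]] by simp
    also have "\<dots> \<le> (LINT c|\<nu> x. \<bar>f (y, c) - f (y0, c)\<bar>)"
      by (rule integral_abs_bound)
    also have "\<dots> \<le> (LINT c|\<nu> x. d * \<phi> c)"
      using int[OF slice[OF y]] int[OF slice[OF y0]] int[OF \<phi>(1)] close[OF q(2)]
        radon_measure_space[OF \<nu>(1)[OF x]]
      by (intro integral_mono_AE AE_I2) auto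
    also have "\<dots> = d * (LINT c|\<nu> x. \<phi> c)" by simp
    also have "\<dots> \<le> d * (c0 + 1)"
      using U1(3)[OF q(3)] d by (intro mult_left_mono) (auto simp: dist_real_def)
    also have "\<dots> = e / 2" by (rule d)
    finally have "\<bar>(LINT c|\<nu> x. f (y, c)) - (LINT c|\<nu> x. f (y0, c))\<bar> \<le> e / 2" .
    then show "dist (case p of (y, x) \<Rightarrow> LINT c|\<nu> x. f (y, c)) (case q of (y, x) \<Rightarrow> LINT c|\<nu> x. f (y, c)) < e"
      using U2(3)[OF q(4)] unfolding p_eq q(1) dist_real_def prod.case by linarith
  qed
qed

section \<open>Topological groupoids\<close>

lemmas continuous_map_compose' = continuous_map_compose[unfolded o_def]

lemma continuous_map_fst': "continuous_map X (prod_topology Y Z) f \<Longrightarrow> continuous_map X Y (\<lambda>x. fst (f x))"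
  by (rule continuous_map_compose'[OF _ continuous_map_fst])

lemma continuous_map_snd': "continuous_map X (prod_topology Y Z) f \<Longrightarrow> continuous_map X Z (\<lambda>x. snd (f x))"
  by (rule continuous_map_compose'[OF _ continuous_map_snd])

lemma continuous_map_id': "continuous_map (subtopology X S) X (\<lambda>x. x)"
  using continuous_map_from_subtopology[OF continuous_map_id] by (simp add: id_def)

locale topo_groupoid =
  fixes \<G> :: "('a, 'o) groupoid"
  assumes groupoid: "topological_groupoid \<G>"
begin

abbreviation A where "A \<equiv> topspace (arr \<G>)"

lemma composableI: "\<gamma> \<in> A \<Longrightarrow> \<eta> \<in> A \<Longrightarrow> src \<G> \<gamma> = rng \<G> \<eta> \<Longrightarrow> (\<gamma>, \<eta>) \<in> composable \<G>"
  by (simp add: composable_def)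

lemma
  shows continuous_src: "continuous_map (arr \<G>) (obj \<G>) (src \<G>)"
    and continuous_rng: "continuous_map (arr \<G>) (obj \<G>) (rng \<G>)"
    and continuous_one: "continuous_map (obj \<G>) (arr \<G>) (gone \<G>)"
    and continuous_inv: "continuous_map (arr \<G>) (arr \<G>) (ginv \<G>)"
    and continuous_mul': "continuous_map (subtopology (prod_topology (arr \<G>) (arr \<G>)) (composable \<G>)) (arr \<G>)
       (\<lambda>(\<gamma>, \<eta>). gmul \<G> \<gamma> \<eta>)"
  using groupoid by (simp_all only: topological_groupoid_def)

lemma
  assumes "\<gamma> \<in> A" "\<eta> \<in> A" "src \<G> \<gamma> = rng \<G> \<eta>"
  shows src_mul: "src \<G> (gmul \<G> \<gamma> \<eta>) = src \<G> \<eta>"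
    and rng_mul: "rng \<G> (gmul \<G> \<gamma> \<eta>) = rng \<G> \<gamma>"
  using groupoid composableI[OF assms] by (auto simp: topological_groupoid_def)

lemma mul_assoc:
  assumes "\<gamma> \<in> A" "\<eta> \<in> A" "\<zeta> \<in> A" "src \<G> \<gamma> = rng \<G> \<eta>" "src \<G> \<eta> = rng \<G> \<zeta>"
  shows "gmul \<G> (gmul \<G> \<gamma> \<eta>) \<zeta> = gmul \<G> \<gamma> (gmul \<G> \<eta> \<zeta>)"
  using groupoid composableI[OF assms(1,2,4)] composableI[OF assms(2,3,5)]
  unfolding topological_groupoid_def by metis

lemma
  assumes "x \<in> topspace (obj \<G>)"
  shows src_one: "src \<G> (gone \<G> x) = x" and rng_one: "rng \<G> (gone \<G> x) = x"
  using groupoid assms by (simp_all add: topological_groupoid_def)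

lemma
  assumes "\<gamma> \<in> A"
  shows one_mul: "gmul \<G> (gone \<G> (rng \<G> \<gamma>)) \<gamma> = \<gamma>"
    and mul_one: "gmul \<G> \<gamma> (gone \<G> (src \<G> \<gamma>)) = \<gamma>"
    and src_inv: "src \<G> (ginv \<G> \<gamma>) = rng \<G> \<gamma>"
    and rng_inv: "rng \<G> (ginv \<G> \<gamma>) = src \<G> \<gamma>"
    and mul_inv: "gmul \<G> \<gamma> (ginv \<G> \<gamma>) = gone \<G> (rng \<G> \<gamma>)"
    and inv_mul: "gmul \<G> (ginv \<G> \<gamma>) \<gamma> = gone \<G> (src \<G> \<gamma>)"
  using groupoid assms by (simp_all add: topological_groupoid_def)

lemma continuous_mul:
  assumes "continuous_map X (arr \<G>) f" "continuous_map X (arr \<G>) g"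
    and "\<And>x. x \<in> topspace X \<Longrightarrow> src \<G> (f x) = rng \<G> (g x)"
  shows "continuous_map X (arr \<G>) (\<lambda>x. gmul \<G> (f x) (g x))"
proof -
  have "f x \<in> A" "g x \<in> A" if "x \<in> topspace X" for x
    using continuous_map_funspace[OF assms(1)] continuous_map_funspace[OF assms(2)] that by auto
  then have "continuous_map X (subtopology (prod_topology (arr \<G>) (arr \<G>)) (composable \<G>))
      (\<lambda>x. (f x, g x))"
    using assms by (intro continuous_map_into_subtopology continuous_map_pairedI) (auto intro!: composableI)
  from continuous_map_compose'[OF this continuous_mul'] show ?thesis by simp
qed

lemma
  shows src_in: "\<gamma> \<in> A \<Longrightarrow> src \<G> \<gamma> \<in> topspace (obj \<G>)"
    and rng_in: "\<gamma> \<in> A \<Longrightarrow> rng \<G> \<gamma> \<in> topspace (obj \<G>)"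
    and one_in: "x \<in> topspace (obj \<G>) \<Longrightarrow> gone \<G> x \<in> A"
    and inv_in: "\<gamma> \<in> A \<Longrightarrow> ginv \<G> \<gamma> \<in> A"
  using continuous_map_funspace[OF continuous_src] continuous_map_funspace[OF continuous_rng]
    continuous_map_funspace[OF continuous_one] continuous_map_funspace[OF continuous_inv] by auto

lemma mul_in: "\<gamma> \<in> A \<Longrightarrow> \<eta> \<in> A \<Longrightarrow> src \<G> \<gamma> = rng \<G> \<eta> \<Longrightarrow> gmul \<G> \<gamma> \<eta> \<in> A"
  using funcset_mem[OF continuous_map_funspace[OF continuous_mul'], of "(\<gamma>, \<eta>)"]
  by (simp add: composableI)

lemmas groupoid_simps [simp] = src_mul rng_mul src_one rng_one src_inv rng_inv mul_in
  src_in rng_in one_in inv_in one_mul mul_one mul_inv inv_mul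

lemma inv_mul_cancel:
  assumes "\<gamma> \<in> A" "\<eta> \<in> A" "src \<G> \<gamma> = rng \<G> \<eta>"
  shows "gmul \<G> (ginv \<G> \<gamma>) (gmul \<G> \<gamma> \<eta>) = \<eta>"
  using mul_assoc[of "ginv \<G> \<gamma>" \<gamma> \<eta>] assms by simp

lemma mul_inv_cancel:
  assumes "\<gamma> \<in> A" "\<eta> \<in> A" "rng \<G> \<gamma> = rng \<G> \<eta>"
  shows "gmul \<G> \<gamma> (gmul \<G> (ginv \<G> \<gamma>) \<eta>) = \<eta>"
  using mul_assoc[of \<gamma> "ginv \<G> \<gamma>" \<eta>] assms by simp

lemma mul_mul_inv_cancel:
  assumes "\<gamma> \<in> A" "\<eta> \<in> A" "src \<G> \<gamma> = rng \<G> \<eta>"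
  shows "gmul \<G> (gmul \<G> \<gamma> \<eta>) (ginv \<G> \<eta>) = \<gamma>"
proof -
  have "gmul \<G> \<gamma> (gone \<G> (rng \<G> \<eta>)) = \<gamma>" using mul_one[OF assms(1)] assms(3) by simp
  then show ?thesis using mul_assoc[of \<gamma> \<eta> "ginv \<G> \<eta>"] assms by simp
qed

lemma mul_inv_mul_cancel:
  assumes "\<gamma> \<in> A" "\<eta> \<in> A" "src \<G> \<gamma> = src \<G> \<eta>"
  shows "gmul \<G> (gmul \<G> \<gamma> (ginv \<G> \<eta>)) \<eta> = \<gamma>"
proof -
  have "gmul \<G> \<gamma> (gone \<G> (src \<G> \<eta>)) = \<gamma>" using mul_one[OF assms(1)] assms(3) by simp
  then show ?thesis using mul_assoc[of \<gamma> "ginv \<G> \<eta>" \<eta>] assms by simp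
qed

lemma mul_eq_self_left:
  assumes "\<gamma> \<in> A" "\<eta> \<in> A" "src \<G> \<gamma> = rng \<G> \<eta>" "gmul \<G> \<gamma> \<eta> = \<eta>"
  shows "\<gamma> = gone \<G> (rng \<G> \<eta>)"
  using mul_mul_inv_cancel[OF assms(1-3)] assms by simp

lemma mul_eq_self_right:
  assumes "\<gamma> \<in> A" "\<eta> \<in> A" "src \<G> \<gamma> = rng \<G> \<eta>" "gmul \<G> \<gamma> \<eta> = \<gamma>"
  shows "\<eta> = gone \<G> (src \<G> \<gamma>)"
  using inv_mul_cancel[OF assms(1-3)] assms by simp

text \<open>The units make the object space a retract of the arrow space, so it inherits the topological
properties of the latter.\<close>

lemma retraction_src: "retraction_map (arr \<G>) (obj \<G>) (src \<G>)"
  unfolding retraction_map_def retraction_maps_def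
  using continuous_src continuous_one by auto

lemma Hausdorff_obj: "Hausdorff_space (arr \<G>) \<Longrightarrow> Hausdorff_space (obj \<G>)"
  using retraction_src Hausdorff_space_retraction_map_image by blast

lemma locally_compact_obj: "locally_compact_space (arr \<G>) \<Longrightarrow> locally_compact_space (obj \<G>)"
  using retraction_src locally_compact_space_retraction_map_image by blast

lemma second_countable_obj: "second_countable (arr \<G>) \<Longrightarrow> second_countable (obj \<G>)"
  using retraction_src second_countable_retraction_map_image by blast

lemma closedin_range_fibre:
  assumes "Hausdorff_space (arr \<G>)" "x \<in> topspace (obj \<G>)"
  shows "closedin (arr \<G>) (range_fibre \<G> x)"
  unfolding range_fibre_def
  using closedin_continuous_maps_eq[OF Hausdorff_obj[OF assms(1)] continuous_rng, of "\<lambda>_. x"] assms(2)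
  by simp

text \<open>The product is unspecified off the range fibre over \<open>src \<G> \<gamma>\<close>, so measurability is
established on the fibre, a closed set, and extended by zero.\<close>

lemma left_translate_measurable:
  assumes "Hausdorff_space (arr \<G>)" "\<gamma> \<in> A" "continuous_map (arr \<G>) euclideanreal f"
  shows "(\<lambda>\<eta>. indicator (range_fibre \<G> (src \<G> \<gamma>)) \<eta> *\<^sub>R f (gmul \<G> \<gamma> \<eta>))
      \<in> borel_measurable (borel_of (arr \<G>))"
proof -
  let ?F = "range_fibre \<G> (src \<G> \<gamma>)"
  have F: "?F \<in> sets (borel_of (arr \<G>))"
    using assms by (intro closedin_sets_borel_of closedin_range_fibre) auto
  have "continuous_map (subtopology (arr \<G>) ?F) (arr \<G>) (\<lambda>\<eta>. gmul \<G> \<gamma> \<eta>)"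
    using assms(2) by (intro continuous_mul continuous_map_id') (auto simp: range_fibre_def)
  then have "continuous_map (subtopology (arr \<G>) ?F) euclideanreal (\<lambda>\<eta>. f (gmul \<G> \<gamma> \<eta>))"
    using assms(3) by (rule continuous_map_compose')
  then have "(\<lambda>\<eta>. f (gmul \<G> \<gamma> \<eta>)) \<in> restrict_space (borel_of (arr \<G>)) ?F \<rightarrow>\<^sub>M borel_of euclidean"
    by (rule continuous_map_measurable_subspace) (rule refl)
  then have "(\<lambda>\<eta>. f (gmul \<G> \<gamma> \<eta>)) \<in> borel_measurable (restrict_space (borel_of (arr \<G>)) ?F)"
    using measurable_cong_sets[OF refl sets_borel_of_euclidean] by blast
  then show ?thesis
    using F sets.sets_into_space[OF F] by (subst (asm) borel_measurable_restrict_space_iff) (auto simp: inf.absorb1)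
qed

text \<open>Left translation by \<open>\<gamma>\<close> carries the range fibre over its source homeomorphically onto the one
over its range, with inverse the translation by \<open>ginv \<G> \<gamma>\<close>. The support of the translated
function is thus the image of a compact set. This integrability is what allows the use of
Fubini's theorem for the crossed product.\<close>

lemma left_translate_integrable:
  assumes H: "Hausdorff_space (arr \<G>)" and \<gamma>: "\<gamma> \<in> A" and f: "f \<in> Cc (arr \<G>)"
    and M: "radon_measure (arr \<G>) M"
  shows "integrable M (\<lambda>\<eta>. indicator (range_fibre \<G> (src \<G> \<gamma>)) \<eta> *\<^sub>R f (gmul \<G> \<gamma> \<eta>))"
proof -
  let ?F = "range_fibre \<G> (src \<G> \<gamma>)" and ?R = "range_fibre \<G> (rng \<G> \<gamma>)"
  obtain K where K: "compactin (arr \<G>) K" "\<And>x. x \<in> A \<Longrightarrow> x \<notin> K \<Longrightarrow> f x = 0"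
    using Cc_compact_support[OF f] by metis
  obtain B where B: "\<And>x. x \<in> K \<Longrightarrow> \<bar>f x\<bar> \<le> B"
    using continuous_map_bounded_on_compact[OF Cc_continuous[OF f] K(1)] by metis
  let ?L = "(\<lambda>\<eta>. gmul \<G> (ginv \<G> \<gamma>) \<eta>) ` (K \<inter> ?R)"
  have "closedin (arr \<G>) ?R" using H \<gamma> by (intro closedin_range_fibre) auto
  then have "compactin (subtopology (arr \<G>) ?R) (K \<inter> ?R)"
    using K(1) by (simp add: compactin_subtopology compact_Int_closedin)
  moreover have "continuous_map (subtopology (arr \<G>) ?R) (arr \<G>) (\<lambda>\<eta>. gmul \<G> (ginv \<G> \<gamma>) \<eta>)"
    using \<gamma> by (intro continuous_mul continuous_map_id') (auto simp: range_fibre_def)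
  ultimately have L: "compactin (arr \<G>) ?L" by (rule image_compactin)
  have supp: "gmul \<G> \<gamma> \<eta> \<in> K \<longrightarrow> \<eta> \<in> ?L" if "\<eta> \<in> ?F" for \<eta>
  proof
    assume "gmul \<G> \<gamma> \<eta> \<in> K"
    then have "gmul \<G> \<gamma> \<eta> \<in> K \<inter> ?R" "\<eta> = gmul \<G> (ginv \<G> \<gamma>) (gmul \<G> \<gamma> \<eta>)"
      using that \<gamma> by (auto simp: range_fibre_def inv_mul_cancel)
    then show "\<eta> \<in> ?L" by blast
  qed
  have bound: "\<bar>f (gmul \<G> \<gamma> \<eta>)\<bar> \<le> max B 0" if "\<eta> \<in> ?F" for \<eta>
  proof (cases "gmul \<G> \<gamma> \<eta> \<in> K")
    case True
    then show ?thesis using B by fastforce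
  next
    case False
    then have "f (gmul \<G> \<gamma> \<eta>) = 0" using that \<gamma> by (intro K(2)) (auto simp: range_fibre_def)
    then show ?thesis by simp
  qed
  show ?thesis
  proof (rule integrable_compact_support[OF H M L])
    show "(\<lambda>\<eta>. indicator ?F \<eta> *\<^sub>R f (gmul \<G> \<gamma> \<eta>)) \<in> borel_measurable M"
      using left_translate_measurable[OF H \<gamma> Cc_continuous[OF f]]
        measurable_cong_sets[OF radon_measure_sets[OF M] refl] by blast
    show "\<bar>indicator ?F \<eta> *\<^sub>R f (gmul \<G> \<gamma> \<eta>)\<bar> \<le> max B 0" for \<eta>
      using bound[of \<eta>] by (simp add: indicator_def)
    show "indicator ?F \<eta> *\<^sub>R f (gmul \<G> \<gamma> \<eta>) = 0" if "\<eta> \<in> A" "\<eta> \<notin> ?L" for \<eta>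
    proof (cases "\<eta> \<in> ?F")
      case True
      then have "gmul \<G> \<gamma> \<eta> \<notin> K" using supp that(2) by blast
      then have "f (gmul \<G> \<gamma> \<eta>) = 0" using True \<gamma> by (intro K(2)) (auto simp: range_fibre_def)
      then show ?thesis by simp
    qed simp
  qed
qed

end

section \<open>Induced groupoids\<close>

locale right_groupoid_module = topo_groupoid \<G> for \<G> :: "('a, 'o) groupoid" +
  fixes P :: "'p topology" and \<epsilon> :: "'p \<Rightarrow> 'o" and b :: "'p \<Rightarrow> 'a \<Rightarrow> 'p"
  assumes module: "right_module \<G> P \<epsilon> b"
begin

lemma continuous_moment: "continuous_map P (obj \<G>) \<epsilon>"
  using module by (simp add: right_module_def)

lemma act_one: "p \<in> topspace P \<Longrightarrow> b p (gone \<G> (\<epsilon> p)) = p"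
  using module by (simp add: right_module_def)

lemma moment_act: "p \<in> topspace P \<Longrightarrow> \<gamma> \<in> A \<Longrightarrow> \<epsilon> p = rng \<G> \<gamma> \<Longrightarrow> \<epsilon> (b p \<gamma>) = src \<G> \<gamma>"
  using module by (simp add: right_module_def)

lemma act_mul:
  assumes "p \<in> topspace P" "\<gamma> \<in> A" "\<eta> \<in> A" "\<epsilon> p = rng \<G> \<gamma>" "src \<G> \<gamma> = rng \<G> \<eta>"
  shows "b p (gmul \<G> \<gamma> \<eta>) = b (b p \<gamma>) \<eta>"
  using module composableI[OF assms(2,3,5)] assms(1,4) by (fastforce simp: right_module_def)

lemma continuous_act:
  assumes "continuous_map X P f" "continuous_map X (arr \<G>) g"
    and "\<And>x. x \<in> topspace X \<Longrightarrow> \<epsilon> (f x) = rng \<G> (g x)"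
  shows "continuous_map X P (\<lambda>x. b (f x) (g x))"
proof -
  have "continuous_map X (subtopology (prod_topology P (arr \<G>)) {(p, \<gamma>). \<epsilon> p = rng \<G> \<gamma>})
      (\<lambda>x. (f x, g x))"
    using assms by (intro continuous_map_into_subtopology continuous_map_pairedI) auto
  moreover have "continuous_map (subtopology (prod_topology P (arr \<G>)) {(p, \<gamma>). \<epsilon> p = rng \<G> \<gamma>}) P
      (\<lambda>(p, \<gamma>). b p \<gamma>)" using module by (simp add: right_module_def)
  ultimately show ?thesis using continuous_map_compose' by fastforce
qed

lemma moment_in: "p \<in> topspace P \<Longrightarrow> \<epsilon> p \<in> topspace (obj \<G>)"
  using continuous_map_funspace[OF continuous_moment] by auto

lemma act_in:
  assumes "p \<in> topspace P" "\<gamma> \<in> A" "\<epsilon> p = rng \<G> \<gamma>"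
  shows "b p \<gamma> \<in> topspace P"
proof -
  have "continuous_map (subtopology (prod_topology P (arr \<G>)) {(p, \<gamma>). \<epsilon> p = rng \<G> \<gamma>}) P
      (\<lambda>(p, \<gamma>). b p \<gamma>)" using module by (simp add: right_module_def)
  from funcset_mem[OF continuous_map_funspace[OF this], of "(p, \<gamma>)"] show ?thesis
    using assms by simp
qed

lemmas module_simps [simp] = act_one moment_act moment_in act_in

abbreviation I where "I \<equiv> induced_groupoid P \<epsilon> b \<G>"

lemma topspace_induced: "topspace (arr I) = {(p, \<gamma>). p \<in> topspace P \<and> \<gamma> \<in> A \<and> \<epsilon> p = rng \<G> \<gamma>}"
  by (auto simp: induced_groupoid_def)

lemma induced_sel:
  "obj I = P" "src I (p, \<gamma>) = b p \<gamma>" "rng I (p, \<gamma>) = p"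
  "gmul I (p, \<gamma>) (p', \<eta>) = (p, gmul \<G> \<gamma> \<eta>)" "gone I p = (p, gone \<G> (\<epsilon> p))"
  "ginv I (p, \<gamma>) = (b p \<gamma>, ginv \<G> \<gamma>)"
  by (simp_all add: induced_groupoid_def)

lemma continuous_into_induced:
  assumes "continuous_map X P f" "continuous_map X (arr \<G>) g"
    and "\<And>x. x \<in> topspace X \<Longrightarrow> \<epsilon> (f x) = rng \<G> (g x)"
  shows "continuous_map X (arr I) (\<lambda>x. (f x, g x))"
  unfolding induced_groupoid_def using assms
  by (auto intro!: continuous_map_into_subtopology continuous_map_pairedI)

lemma continuous_induced_fst: "continuous_map (arr I) P fst"
  and continuous_induced_snd: "continuous_map (arr I) (arr \<G>) snd"
  unfolding induced_groupoid_def
  by (auto intro: continuous_map_from_subtopology continuous_map_fst continuous_map_snd)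

lemma topological_induced: "topological_groupoid I"
proof -
  let ?C = "subtopology (prod_topology (arr I) (arr I)) (composable I)"
  have C: "fst x \<in> topspace (arr I)" "snd x \<in> topspace (arr I)" "src I (fst x) = rng I (snd x)"
    if "x \<in> topspace ?C" for x
    using that by (auto simp: composable_def)
  have c1: "continuous_map ?C (arr I) fst" and c2: "continuous_map ?C (arr I) snd"
    by (auto intro: continuous_map_from_subtopology continuous_map_fst continuous_map_snd)
  have src: "continuous_map (arr I) P (\<lambda>z. b (fst z) (snd z))"
    by (intro continuous_act continuous_induced_fst continuous_induced_snd) (auto simp: topspace_induced)
  have srcI: "src I = (\<lambda>z. b (fst z) (snd z))" and rngI: "rng I = fst"
    and invI: "ginv I = (\<lambda>z. (b (fst z) (snd z), ginv \<G> (snd z)))"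
    by (auto simp: fun_eq_iff induced_sel)
  have mul: "continuous_map ?C (arr I) (\<lambda>z. (fst (fst z), gmul \<G> (snd (fst z)) (snd (snd z))))"
  proof (intro continuous_into_induced continuous_mul)
    show "continuous_map ?C P (\<lambda>z. fst (fst z))"
      using continuous_map_compose'[OF c1 continuous_induced_fst] .
    show "continuous_map ?C (arr \<G>) (\<lambda>z. snd (fst z))" "continuous_map ?C (arr \<G>) (\<lambda>z. snd (snd z))"
      using continuous_map_compose'[OF c1 continuous_induced_snd]
        continuous_map_compose'[OF c2 continuous_induced_snd] by auto
    fix x assume "x \<in> topspace ?C"
    from C[OF this] show "src \<G> (snd (fst x)) = rng \<G> (snd (snd x))"
      "\<epsilon> (fst (fst x)) = rng \<G> (gmul \<G> (snd (fst x)) (snd (snd x)))"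
      by (cases x; auto simp: topspace_induced induced_sel; metis moment_act rng_mul)+
  qed
  have mulI: "(\<lambda>(\<gamma>, \<eta>). gmul I \<gamma> \<eta>) = (\<lambda>z. (fst (fst z), gmul \<G> (snd (fst z)) (snd (snd z))))"
    by (auto simp: fun_eq_iff induced_sel)
  have comp: "\<epsilon> p = rng \<G> \<gamma> \<and> src \<G> \<gamma> = rng \<G> \<eta> \<and> p' = b p \<gamma> \<and> p \<in> topspace P \<and> \<gamma> \<in> A \<and> \<eta> \<in> A"
    if "((p, \<gamma>), (p', \<eta>)) \<in> composable I" for p p' \<gamma> \<eta>
    using that by (auto simp: composable_def topspace_induced induced_sel)
  show ?thesis unfolding topological_groupoid_def
  proof (intro conjI)
    show "continuous_map (arr I) (obj I) (src I)" using src by (simp add: srcI induced_sel)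
    show "continuous_map (arr I) (obj I) (rng I)"
      using continuous_induced_fst by (simp add: rngI induced_sel)
    have "continuous_map P (arr I) (\<lambda>p. (p, gone \<G> (\<epsilon> p)))"
      by (intro continuous_into_induced continuous_map_compose'[OF continuous_moment continuous_one]) auto
    then show "continuous_map (obj I) (arr I) (gone I)"
      by (simp add: induced_sel induced_groupoid_def)
    show "continuous_map (arr I) (arr I) (ginv I)" unfolding invI
      by (intro continuous_into_induced src continuous_map_compose'[OF continuous_induced_snd continuous_inv])
        (auto simp: topspace_induced)
    show "continuous_map ?C (arr I) (\<lambda>(\<gamma>, \<eta>). gmul I \<gamma> \<eta>)" unfolding mulI by (rule mul)
    show "\<forall>(\<gamma>, \<eta>)\<in>composable I. src I (gmul I \<gamma> \<eta>) = src I \<eta> \<and> rng I (gmul I \<gamma> \<eta>) = rng I \<gamma>"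
      using comp by (auto simp: induced_sel act_mul)
    show "\<forall>\<gamma> \<eta> \<zeta>. (\<gamma>, \<eta>) \<in> composable I \<longrightarrow> (\<eta>, \<zeta>) \<in> composable I \<longrightarrow>
        gmul I (gmul I \<gamma> \<eta>) \<zeta> = gmul I \<gamma> (gmul I \<eta> \<zeta>)"
      using comp by (auto simp: induced_sel mul_assoc)
    show "\<forall>x\<in>topspace (obj I). src I (gone I x) = x \<and> rng I (gone I x) = x"
      by (simp add: induced_sel)
    show "\<forall>\<gamma>\<in>topspace (arr I). gmul I (gone I (rng I \<gamma>)) \<gamma> = \<gamma> \<and> gmul I \<gamma> (gone I (src I \<gamma>)) = \<gamma> \<and>
        src I (ginv I \<gamma>) = rng I \<gamma> \<and> rng I (ginv I \<gamma>) = src I \<gamma> \<and>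
        gmul I \<gamma> (ginv I \<gamma>) = gone I (rng I \<gamma>) \<and> gmul I (ginv I \<gamma>) \<gamma> = gone I (src I \<gamma>)"
    proof -
      have "b (b p \<gamma>) (ginv \<G> \<gamma>) = p" if "p \<in> topspace P" "\<gamma> \<in> A" "\<epsilon> p = rng \<G> \<gamma>" for p \<gamma>
        using that act_mul[of p \<gamma> "ginv \<G> \<gamma>"] act_one[of p] by simp
      moreover have "gmul \<G> (gone \<G> (\<epsilon> p)) \<gamma> = \<gamma>" if "\<gamma> \<in> A" "\<epsilon> p = rng \<G> \<gamma>" for p \<gamma>
        using that by simp
      ultimately show ?thesis by (auto simp: topspace_induced induced_sel)
    qed
  qed
qed

end

section \<open>The Haar system of an induced groupoid\<close>

locale haar_groupoid = topo_groupoid \<G> for \<G> :: "('a, 'o) groupoid" +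
  fixes \<nu> :: "'o \<Rightarrow> 'a measure"
  assumes haar: "groupoid_with_haar \<G> \<nu>"
begin

lemma
  shows Hausdorff_arr: "Hausdorff_space (arr \<G>)"
    and locally_compact_arr: "locally_compact_space (arr \<G>)"
    and second_countable_arr: "second_countable (arr \<G>)"
    and haar_system: "left_haar_system \<G> \<nu>"
  using haar by (simp_all add: groupoid_with_haar_def)

lemma
  assumes "x \<in> topspace (obj \<G>)"
  shows haar_radon: "radon_measure (arr \<G>) (\<nu> x)"
    and haar_null: "emeasure (\<nu> x) (A - range_fibre \<G> x) = 0"
    and haar_pos: "\<And>U. openin (arr \<G>) U \<Longrightarrow> U \<inter> range_fibre \<G> x \<noteq> {} \<Longrightarrow> emeasure (\<nu> x) U > 0"
  using haar_system assms by (auto simp: left_haar_system_def)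

lemma haar_continuous:
  "f \<in> Cc (arr \<G>) \<Longrightarrow> continuous_map (obj \<G>) euclideanreal (\<lambda>x. LINT \<gamma>|\<nu> x. f \<gamma>)"
  using haar_system by (simp add: left_haar_system_def)

lemma haar_invariant:
  assumes "f \<in> Cc (arr \<G>)" "\<gamma> \<in> A"
  shows "(LINT \<eta>|\<nu> (src \<G> \<gamma>). indicator (range_fibre \<G> (src \<G> \<gamma>)) \<eta> *\<^sub>R f (gmul \<G> \<gamma> \<eta>))
    = (LINT \<eta>|\<nu> (rng \<G> \<gamma>). f \<eta>)"
  using haar_system assms by (simp add: left_haar_system_def set_lebesgue_integral_def)

lemma
  assumes "x \<in> topspace (obj \<G>)"
  shows sets_haar: "sets (\<nu> x) = sets (borel_of (arr \<G>))"
    and space_haar: "space (\<nu> x) = A"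
    and range_fibre_sets: "range_fibre \<G> x \<in> sets (\<nu> x)"
proof -
  show *: "sets (\<nu> x) = sets (borel_of (arr \<G>))" by (rule radon_measure_sets[OF haar_radon[OF assms]])
  show "space (\<nu> x) = A" by (rule radon_measure_space[OF haar_radon[OF assms]])
  show "range_fibre \<G> x \<in> sets (\<nu> x)"
    unfolding * by (rule closedin_sets_borel_of[OF closedin_range_fibre[OF Hausdorff_arr assms]])
qed

lemma AE_range_fibre:
  assumes "x \<in> topspace (obj \<G>)"
  shows "AE \<gamma> in \<nu> x. \<gamma> \<in> range_fibre \<G> x"
proof (rule AE_I)
  show "{\<gamma> \<in> space (\<nu> x). \<gamma> \<notin> range_fibre \<G> x} \<subseteq> A - range_fibre \<G> x"
    by (auto simp: space_haar[OF assms])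
  show "A - range_fibre \<G> x \<in> sets (\<nu> x)"
    using sets.compl_sets[OF range_fibre_sets[OF assms]] by (simp add: space_haar[OF assms])
qed (rule haar_null[OF assms])

end

locale haar_module = haar_groupoid \<G> \<nu> + right_groupoid_module \<G> P \<epsilon> b
  for \<G> :: "('a, 'o) groupoid" and \<nu> and P :: "'p topology" and \<epsilon> b +
  assumes Hausdorff_P: "Hausdorff_space P"
    and locally_compact_P: "locally_compact_space P"
    and second_countable_P: "second_countable P"
begin

abbreviation \<iota> where "\<iota> \<equiv> induced_haar P \<epsilon> b \<G> \<nu>"

lemma arr_induced_closed:
  obtains Z where "closedin (prod_topology P (arr \<G>)) Z" "arr I = subtopology (prod_topology P (arr \<G>)) Z"
proof
  let ?X = "prod_topology P (arr \<G>)"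
  let ?Z = "{z \<in> topspace ?X. \<epsilon> (fst z) = rng \<G> (snd z)}"
  show "closedin ?X ?Z"
    by (rule closedin_continuous_maps_eq[OF Hausdorff_obj[OF Hausdorff_arr]
      continuous_map_compose'[OF continuous_map_fst continuous_moment]
      continuous_map_compose'[OF continuous_map_snd continuous_rng]])
  have "?Z = topspace ?X \<inter> {(p, \<gamma>). \<epsilon> p = rng \<G> \<gamma>}" by auto
  then have "subtopology ?X ?Z = subtopology ?X {(p, \<gamma>). \<epsilon> p = rng \<G> \<gamma>}"
    by (simp only: subtopology_restrict)
  then show "arr I = subtopology ?X ?Z" by (simp add: induced_groupoid_def)
qed

lemma Hausdorff_induced: "Hausdorff_space (arr I)"
  unfolding induced_groupoid_def using Hausdorff_P Hausdorff_arr
  by (simp add: Hausdorff_space_subtopology Hausdorff_space_prod_topology)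

lemma locally_compact_induced: "locally_compact_space (arr I)"
proof -
  obtain Z where "closedin (prod_topology P (arr \<G>)) Z" "arr I = subtopology (prod_topology P (arr \<G>)) Z"
    using arr_induced_closed by metis
  then show ?thesis
    using locally_compact_P locally_compact_arr
    by (simp add: locally_compact_space_closed_subset locally_compact_space_prod_topology)
qed

lemma second_countable_induced: "second_countable (arr I)"
  unfolding induced_groupoid_def using second_countable_P second_countable_arr
  by (simp add: second_countable_subtopology second_countable_prod_topology)

lemma sets_induced_haar: "sets (\<iota> p) = sets (borel_of (arr I))"
  by (simp add: induced_haar_def)

context
  fixes p assumes p: "p \<in> topspace P"
begin

lemma measurable_Pair_fibre:
  "Pair p \<in> restrict_space (\<nu> (\<epsilon> p)) (range_fibre \<G> (\<epsilon> p)) \<rightarrow>\<^sub>M borel_of (arr I)"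
proof (rule continuous_map_measurable_subspace)
  show "continuous_map (subtopology (arr \<G>) (range_fibre \<G> (\<epsilon> p))) (arr I) (Pair p)"
    using p by (intro continuous_into_induced continuous_map_id') (auto simp: range_fibre_def)
qed (use p in \<open>simp add: sets_haar\<close>)

lemma range_fibre_sets': "range_fibre \<G> (\<epsilon> p) \<inter> space (\<nu> (\<epsilon> p)) \<in> sets (\<nu> (\<epsilon> p))"
  using range_fibre_sets[OF moment_in[OF p]] by auto

lemma emeasure_induced_haar:
  assumes "B \<in> sets (borel_of (arr I))"
  shows "emeasure (\<iota> p) B = emeasure (\<nu> (\<epsilon> p)) {\<gamma> \<in> range_fibre \<G> (\<epsilon> p). (p, \<gamma>) \<in> B}"
    and "{\<gamma> \<in> range_fibre \<G> (\<epsilon> p). (p, \<gamma>) \<in> B} \<in> sets (\<nu> (\<epsilon> p))"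
proof -
  let ?F = "range_fibre \<G> (\<epsilon> p)" and ?M = "\<nu> (\<epsilon> p)"
  have F: "?F \<inter> space ?M = ?F"
    by (auto simp: space_haar[OF moment_in[OF p]] range_fibre_def)
  have eq: "Pair p -` B \<inter> space (restrict_space ?M ?F) = {\<gamma> \<in> ?F. (p, \<gamma>) \<in> B}"
    using F by (auto simp: space_restrict_space)
  have "{\<gamma> \<in> ?F. (p, \<gamma>) \<in> B} \<in> sets (restrict_space ?M ?F)"
    using measurable_sets[OF measurable_Pair_fibre assms] by (simp add: eq)
  then show "{\<gamma> \<in> ?F. (p, \<gamma>) \<in> B} \<in> sets ?M"
    using sets_restrict_space_iff[OF range_fibre_sets'] by blast
  show "emeasure (\<iota> p) B = emeasure ?M {\<gamma> \<in> ?F. (p, \<gamma>) \<in> B}"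
    unfolding induced_haar_def emeasure_distr[OF measurable_Pair_fibre assms] eq
    by (rule emeasure_restrict_space[OF range_fibre_sets']) auto
qed

lemma integral_induced_haar:
  fixes f :: "'p \<times> 'a \<Rightarrow> real"
  assumes "f \<in> borel_measurable (borel_of (arr I))"
  shows "(LINT c|\<iota> p. f c) = (LINT \<gamma>|\<nu> (\<epsilon> p). indicator (range_fibre \<G> (\<epsilon> p)) \<gamma> *\<^sub>R f (p, \<gamma>))"
  unfolding induced_haar_def
  by (rule trans[OF integral_distr[OF measurable_Pair_fibre assms]
      integral_restrict_space[OF range_fibre_sets']])

text \<open>The arrows of the induced groupoid form a closed subset of \<open>P \<times> arr \<G>\<close>, and \<open>\<nu> x\<close> is
concentrated on a range fibre. Integrals can therefore be computed from an extension of the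
integrand to the whole product, to which the continuity and the invariance of \<open>\<nu>\<close> apply.\<close>

lemma integral_induced_haar_extension:
  assumes F: "F \<in> Cc (prod_topology P (arr \<G>))" and f: "f \<in> Cc (arr I)"
    and eq: "\<And>c. c \<in> topspace (arr I) \<Longrightarrow> F c = f c"
  shows "(LINT c|\<iota> p. f c) = (LINT \<gamma>|\<nu> (\<epsilon> p). F (p, \<gamma>))"
proof -
  note slice = Cc_slice[OF Hausdorff_arr F p]
  have m: "(\<lambda>\<gamma>. F (p, \<gamma>)) \<in> borel_measurable (\<nu> (\<epsilon> p))"
    using continuous_map_borel_measurable[OF Cc_continuous[OF slice] sets_haar[OF moment_in[OF p]]] .
  have "(LINT c|\<iota> p. f c) = (LINT \<gamma>|\<nu> (\<epsilon> p). indicator (range_fibre \<G> (\<epsilon> p)) \<gamma> *\<^sub>R f (p, \<gamma>))"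
    by (intro integral_induced_haar continuous_map_borel_measurable[OF Cc_continuous[OF f] refl])
  also have "\<dots> = (LINT \<gamma>|\<nu> (\<epsilon> p). indicator (range_fibre \<G> (\<epsilon> p)) \<gamma> *\<^sub>R F (p, \<gamma>))"
    using p by (intro Bochner_Integration.integral_cong refl)
      (auto simp: indicator_def range_fibre_def topspace_induced eq)
  also have "\<dots> = (LINT \<gamma>|\<nu> (\<epsilon> p). F (p, \<gamma>))"
  proof (rule integral_cong_AE)
    show "(\<lambda>\<gamma>. indicator (range_fibre \<G> (\<epsilon> p)) \<gamma> *\<^sub>R F (p, \<gamma>)) \<in> borel_measurable (\<nu> (\<epsilon> p))"
      by (rule borel_measurable_scaleR[OF borel_measurable_indicator[OF range_fibre_sets[OF moment_in[OF p]]] m])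
    show "AE \<gamma> in \<nu> (\<epsilon> p). indicator (range_fibre \<G> (\<epsilon> p)) \<gamma> *\<^sub>R F (p, \<gamma>) = F (p, \<gamma>)"
      using AE_range_fibre[OF moment_in[OF p]] by eventually_elim simp
  qed (rule m)
  finally show ?thesis .
qed

end

lemma induced_Cc_extension:
  assumes "f \<in> Cc (arr I)"
  obtains F where "F \<in> Cc (prod_topology P (arr \<G>))" "\<And>c. c \<in> topspace (arr I) \<Longrightarrow> F c = f c"
proof -
  obtain Z where Z: "closedin (prod_topology P (arr \<G>)) Z" "arr I = subtopology (prod_topology P (arr \<G>)) Z"
    using arr_induced_closed by metis
  have "Hausdorff_space (prod_topology P (arr \<G>))" "locally_compact_space (prod_topology P (arr \<G>))"
    using Hausdorff_P Hausdorff_arr locally_compact_P locally_compact_arr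
    by (simp_all add: Hausdorff_space_prod_topology locally_compact_space_prod_topology)
  from Cc_extend[OF this(2,1) Z(1)] assms obtain F where
    "F \<in> Cc (prod_topology P (arr \<G>))" "\<And>c. c \<in> Z \<Longrightarrow> F c = f c" unfolding Z(2) by metis
  then show ?thesis using that by (auto simp: Z(2))
qed

text \<open>The range fibre of \<open>p\<close> in the induced groupoid is a copy of the range fibre of \<open>\<epsilon> p\<close> in
\<open>\<G>\<close>, and left translation by \<open>(p, \<gamma>)\<close> becomes left translation by \<open>\<gamma>\<close>.\<close>

lemma induced_left_haar_system: "left_haar_system I \<iota>"
  unfolding left_haar_system_def
proof (intro conjI ballI allI impI)
  interpret I: topo_groupoid I by unfold_locales (rule topological_induced)
  fix p assume "p \<in> topspace (obj I)"
  then have p: "p \<in> topspace P" by (simp add: induced_sel)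
  note x = moment_in[OF p]
  show "radon_measure (arr I) (\<iota> p)"
    unfolding radon_measure_def sets_induced_haar
  proof (intro conjI allI impI refl)
    fix K assume K: "compactin (arr I) K"
    have Ks: "K \<in> sets (borel_of (arr I))"
      using compactin_imp_closedin[OF Hausdorff_induced K] by (rule closedin_sets_borel_of)
    have K2: "compactin (arr \<G>) (snd ` K)"
      using K continuous_induced_snd by (rule image_compactin)
    have "emeasure (\<iota> p) K = emeasure (\<nu> (\<epsilon> p)) {\<gamma> \<in> range_fibre \<G> (\<epsilon> p). (p, \<gamma>) \<in> K}"
      by (rule emeasure_induced_haar(1)[OF p Ks])
    also have "\<dots> \<le> emeasure (\<nu> (\<epsilon> p)) (snd ` K)"
      using compactin_sets_radon[OF Hausdorff_arr haar_radon[OF x] K2] by (intro emeasure_mono) force+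
    also have "\<dots> < \<infinity>" using haar_radon[OF x] K2 by (simp add: radon_measure_def)
    finally show "emeasure (\<iota> p) K < \<infinity>" .
  qed
  have N: "topspace (arr I) - range_fibre I p \<in> sets (borel_of (arr I))"
    using closedin_sets_borel_of[OF I.closedin_range_fibre[OF Hausdorff_induced \<open>p \<in> topspace (obj I)\<close>]]
    by (metis sets.compl_sets space_borel_of)
  have "{\<gamma> \<in> range_fibre \<G> (\<epsilon> p). (p, \<gamma>) \<in> topspace (arr I) - range_fibre I p} = {}"
    by (auto simp: range_fibre_def induced_sel)
  then show "emeasure (\<iota> p) (topspace (arr I) - range_fibre I p) = 0"
    unfolding emeasure_induced_haar(1)[OF p N] by (simp only: emeasure_empty)
  fix U assume U: "openin (arr I) U" and ne: "U \<inter> range_fibre I p \<noteq> {}"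
  let ?F = "range_fibre \<G> (\<epsilon> p)"
  have "continuous_map (subtopology (arr \<G>) ?F) (arr I) (Pair p)"
    using p by (intro continuous_into_induced continuous_map_id') (auto simp: range_fibre_def)
  from openin_continuous_map_preimage[OF this U] obtain V where V: "openin (arr \<G>) V"
      "{\<gamma> \<in> topspace (subtopology (arr \<G>) ?F). (p, \<gamma>) \<in> U} = V \<inter> ?F"
    unfolding openin_subtopology by blast
  have VF: "{\<gamma> \<in> ?F. (p, \<gamma>) \<in> U} = V \<inter> ?F" using V(2) by (auto simp: range_fibre_def)
  obtain \<gamma> where \<gamma>: "(p, \<gamma>) \<in> U" "(p, \<gamma>) \<in> topspace (arr I)"
    using ne by (auto simp: range_fibre_def induced_sel)
  then have "\<gamma> \<in> {\<gamma> \<in> ?F. (p, \<gamma>) \<in> U}" by (auto simp: range_fibre_def topspace_induced)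
  then have "0 < emeasure (\<nu> (\<epsilon> p)) V" using haar_pos[OF x V(1)] VF by blast
  also have "emeasure (\<nu> (\<epsilon> p)) V = emeasure (\<nu> (\<epsilon> p)) (V \<inter> ?F)"
    using AE_range_fibre[OF x] openin_sets_borel_of[OF V(1)] range_fibre_sets[OF x] sets_haar[OF x]
    by (intro emeasure_eq_AE) auto
  finally show "emeasure (\<iota> p) U > 0"
    using emeasure_induced_haar(1)[OF p openin_sets_borel_of[OF U]] VF by simp
next
  fix f assume f: "f \<in> Cc (arr I)"
  obtain F where F: "F \<in> Cc (prod_topology P (arr \<G>))" "\<And>c. c \<in> topspace (arr I) \<Longrightarrow> F c = f c"
    using induced_Cc_extension[OF f] by metis
  obtain K where K: "compactin (prod_topology P (arr \<G>)) K"
      "\<And>z. z \<in> topspace (prod_topology P (arr \<G>)) \<Longrightarrow> z \<notin> K \<Longrightarrow> F z = 0"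
    using Cc_compact_support[OF F(1)] by metis
  have "continuous_map (prod_topology P (obj \<G>)) euclideanreal (\<lambda>(p, x). LINT \<gamma>|\<nu> x. F (p, \<gamma>))"
  proof (rule continuous_parametric_integral[OF locally_compact_arr Hausdorff_arr haar_radon haar_continuous
        Cc_continuous[OF F(1)]])
    show "compactin (arr \<G>) (snd ` K)" using K(1) continuous_map_snd by (rule image_compactin)
    show "F (y, c) = 0" if "y \<in> topspace P" "c \<in> A" "c \<notin> snd ` K" for y c
      using that K(2)[of "(y, c)"] by force
  qed
  from continuous_map_compose'[OF _ this, of P "\<lambda>p. (p, \<epsilon> p)"]
  have "continuous_map P euclideanreal (\<lambda>p. LINT \<gamma>|\<nu> (\<epsilon> p). F (p, \<gamma>))"
    using continuous_map_id[of P] continuous_moment by (simp add: continuous_map_pairedI id_def)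
  then have "continuous_map P euclideanreal (\<lambda>p. LINT c|\<iota> p. f c)"
    by (rule continuous_map_eq) (simp add: integral_induced_haar_extension[OF _ F(1) f F(2)])
  then show "continuous_map (obj I) euclideanreal (\<lambda>p. LINT c|\<iota> p. f c)"
    by (simp add: induced_sel)
next
  interpret I: topo_groupoid I by unfold_locales (rule topological_induced)
  fix f c assume f: "f \<in> Cc (arr I)" and c: "c \<in> topspace (arr I)"
  obtain F where F: "F \<in> Cc (prod_topology P (arr \<G>))" "\<And>c. c \<in> topspace (arr I) \<Longrightarrow> F c = f c"
    using induced_Cc_extension[OF f] by metis
  obtain p \<gamma> where c_eq: "c = (p, \<gamma>)" and p: "p \<in> topspace P" and \<gamma>: "\<gamma> \<in> A" "\<epsilon> p = rng \<G> \<gamma>"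
    using c by (auto simp: topspace_induced)
  define p' where "p' = b p \<gamma>"
  have p': "p' \<in> topspace P" "\<epsilon> p' = src \<G> \<gamma>" using p \<gamma> by (auto simp: p'_def)
  let ?F = "range_fibre \<G> (src \<G> \<gamma>)"
  have src: "src I c = p'" and rng: "rng I c = p" by (auto simp: c_eq p'_def induced_sel)
  have "(LINT d:range_fibre I (src I c)|\<iota> (src I c). f (gmul I c d))
      = (LINT d|\<iota> p'. indicator (range_fibre I p') d *\<^sub>R f (gmul I c d))"
    by (simp add: set_lebesgue_integral_def src)
  also have "\<dots> = (LINT \<eta>|\<nu> (src \<G> \<gamma>). indicator ?F \<eta> *\<^sub>R (indicator (range_fibre I p') (p', \<eta>) *\<^sub>R f (gmul I c (p', \<eta>))))"
    using integral_induced_haar[OF p'(1), of "\<lambda>d. indicator (range_fibre I p') d *\<^sub>R f (gmul I c d)"]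
      I.left_translate_measurable[OF Hausdorff_induced c Cc_continuous[OF f]] by (simp add: src p'(2))
  also have "\<dots> = (LINT \<eta>|\<nu> (src \<G> \<gamma>). indicator ?F \<eta> *\<^sub>R F (p, gmul \<G> \<gamma> \<eta>))"
  proof (intro Bochner_Integration.integral_cong refl)
    fix \<eta>
    show "indicator ?F \<eta> *\<^sub>R (indicator (range_fibre I p') (p', \<eta>) *\<^sub>R f (gmul I c (p', \<eta>)))
        = indicator ?F \<eta> *\<^sub>R F (p, gmul \<G> \<gamma> \<eta>)"
    proof (cases "\<eta> \<in> ?F")
      case True
      then have \<eta>: "\<eta> \<in> A" "rng \<G> \<eta> = src \<G> \<gamma>" by (auto simp: range_fibre_def)
      then have "(p', \<eta>) \<in> range_fibre I p'" "(p, gmul \<G> \<gamma> \<eta>) \<in> topspace (arr I)"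
        using p p' \<gamma> by (auto simp: range_fibre_def topspace_induced induced_sel)
      then show ?thesis using F(2) by (simp add: c_eq induced_sel)
    qed simp
  qed
  also have "\<dots> = (LINT \<eta>|\<nu> (rng \<G> \<gamma>). F (p, \<eta>))"
    using haar_invariant[OF Cc_slice[OF Hausdorff_arr F(1) p] \<gamma>(1)] .
  also have "\<dots> = (LINT d|\<iota> p. f d)"
    using integral_induced_haar_extension[OF p F(1) f F(2)] \<gamma>(2) by simp
  finally show "(LINT d:range_fibre I (src I c)|\<iota> (src I c). f (gmul I c d)) = (LINT d|\<iota> (rng I c). f d)"
    by (simp add: rng)
qed

lemma induced_groupoid_with_haar: "groupoid_with_haar I \<iota>"
  unfolding groupoid_with_haar_def
  using topological_induced locally_compact_induced Hausdorff_induced second_countable_induced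
    induced_left_haar_system by blast

end

section \<open>Groupoids with a group action\<close>

locale lc_group =
  fixes G :: "'g top_group" (structure)
  assumes lc_group: "locally_compact_group G"

sublocale lc_group \<subseteq> group G
  using lc_group by (simp add: locally_compact_group_def)

context lc_group
begin

lemma
  shows topspace_group [simp]: "topspace (gtop G) = carrier G"
    and Hausdorff_group: "Hausdorff_space (gtop G)"
    and locally_compact_gtop: "locally_compact_space (gtop G)"
  using lc_group by (simp_all add: locally_compact_group_def)

lemma continuous_group_mult:
  assumes "continuous_map X (gtop G) f" "continuous_map X (gtop G) g"
  shows "continuous_map X (gtop G) (\<lambda>x. f x \<otimes> g x)"
proof -
  have "continuous_map (prod_topology (gtop G) (gtop G)) (gtop G) (\<lambda>(g, h). g \<otimes> h)"
    using lc_group by (simp add: locally_compact_group_def)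
  from continuous_map_compose'[OF continuous_map_pairedI[OF assms] this] show ?thesis by simp
qed

lemma continuous_group_inv:
  assumes "continuous_map X (gtop G) f"
  shows "continuous_map X (gtop G) (\<lambda>x. inv (f x))"
  using lc_group by (intro continuous_map_compose'[OF assms]) (simp add: locally_compact_group_def)

lemma inv_mult_cancel [simp]: "g \<in> carrier G \<Longrightarrow> h \<in> carrier G \<Longrightarrow> inv g \<otimes> (g \<otimes> h) = h"
  by (simp add: m_assoc[symmetric])

lemma mult_inv_cancel [simp]: "g \<in> carrier G \<Longrightarrow> h \<in> carrier G \<Longrightarrow> g \<otimes> (inv g \<otimes> h) = h"
  by (simp add: m_assoc[symmetric])

end

locale equivariant_groupoid = lc_group G + topo_groupoid \<H>
  for G :: "'g top_group" (structure) and \<H> :: "('a, 'o) groupoid" +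
  fixes \<alpha> :: "'g \<Rightarrow> 'a \<Rightarrow> 'a"
  assumes G_action: "topological_G_groupoid G \<H> \<alpha>"
begin

abbreviation oact where "oact \<equiv> obj_act \<H> \<alpha>"

lemma group_action: "continuous_group_action G (arr \<H>) \<alpha>"
  using G_action by (simp add: topological_G_groupoid_def)

lemma continuous_arrow_act:
  assumes "continuous_map X (gtop G) k" "continuous_map X (arr \<H>) f"
  shows "continuous_map X (arr \<H>) (\<lambda>x. \<alpha> (k x) (f x))"
proof -
  have "continuous_map (prod_topology (gtop G) (arr \<H>)) (arr \<H>) (\<lambda>(g, x). \<alpha> g x)"
    using group_action by (simp add: continuous_group_action_def)
  from continuous_map_compose'[OF continuous_map_pairedI[OF assms] this] show ?thesis by simp
qed

lemma act_in [simp]: "g \<in> carrier G \<Longrightarrow> \<gamma> \<in> A \<Longrightarrow> \<alpha> g \<gamma> \<in> A"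
  using continuous_map_funspace[OF continuous_arrow_act[of "arr \<H>" "\<lambda>_. g" "\<lambda>x. x"]]
    continuous_map_id[of "arr \<H>"] by (auto simp: topspace_group id_def)

lemma act_one [simp]: "\<gamma> \<in> A \<Longrightarrow> \<alpha> \<one> \<gamma> = \<gamma>"
  using group_action by (simp add: continuous_group_action_def)

lemma act_mult: "g \<in> carrier G \<Longrightarrow> h \<in> carrier G \<Longrightarrow> \<gamma> \<in> A \<Longrightarrow> \<alpha> (g \<otimes> h) \<gamma> = \<alpha> g (\<alpha> h \<gamma>)"
  using group_action by (simp add: continuous_group_action_def)

lemma act_inv_cancel [simp]:
  assumes "g \<in> carrier G" "\<gamma> \<in> A"
  shows "\<alpha> (inv g) (\<alpha> g \<gamma>) = \<gamma>" "\<alpha> g (\<alpha> (inv g) \<gamma>) = \<gamma>"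
  using assms act_mult[of "inv g" g \<gamma>] act_mult[of g "inv g" \<gamma>] by simp_all

lemma
  assumes "g \<in> carrier G"
  shows src_act [simp]: "\<gamma> \<in> A \<Longrightarrow> src \<H> (\<alpha> g \<gamma>) = oact g (src \<H> \<gamma>)"
    and rng_act [simp]: "\<gamma> \<in> A \<Longrightarrow> rng \<H> (\<alpha> g \<gamma>) = oact g (rng \<H> \<gamma>)"
    and inv_act: "\<gamma> \<in> A \<Longrightarrow> ginv \<H> (\<alpha> g \<gamma>) = \<alpha> g (ginv \<H> \<gamma>)"
    and act_unit [simp]: "x \<in> topspace (obj \<H>) \<Longrightarrow> \<alpha> g (gone \<H> x) = gone \<H> (oact g x)"
  using G_action assms by (simp_all add: topological_G_groupoid_def)

lemma act_mul:
  assumes "g \<in> carrier G" "\<gamma> \<in> A" "\<eta> \<in> A" "src \<H> \<gamma> = rng \<H> \<eta>"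
  shows "\<alpha> g (gmul \<H> \<gamma> \<eta>) = gmul \<H> (\<alpha> g \<gamma>) (\<alpha> g \<eta>)"
  using G_action assms composableI[OF assms(2-4)] unfolding topological_G_groupoid_def by fastforce

lemma continuous_obj_act:
  assumes "continuous_map X (gtop G) k" "continuous_map X (obj \<H>) f"
  shows "continuous_map X (obj \<H>) (\<lambda>x. oact (k x) (f x))"
  unfolding obj_act_def
  by (intro continuous_map_compose'[OF _ continuous_rng] continuous_arrow_act assms(1)
      continuous_map_compose'[OF assms(2) continuous_one])

lemma obj_act_in [simp]:
  assumes "g \<in> carrier G" "x \<in> topspace (obj \<H>)"
  shows "oact g x \<in> topspace (obj \<H>)"
  using src_in[OF act_in[OF assms(1) one_in[OF assms(2)]]] assms by (simp del: act_unit)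

lemma obj_act_one [simp]: "x \<in> topspace (obj \<H>) \<Longrightarrow> oact \<one> x = x"
  using src_act[of \<one> "gone \<H> x"] by (simp del: src_act act_unit)

lemma obj_act_mult [simp]:
  assumes "g \<in> carrier G" "h \<in> carrier G" "x \<in> topspace (obj \<H>)"
  shows "oact (g \<otimes> h) x = oact g (oact h x)"
  using act_mult[OF assms(1,2) one_in[OF assms(3)]] assms
  by (metis act_unit m_closed obj_act_in src_one)

lemma obj_act_inv_cancel [simp]:
  assumes "g \<in> carrier G" "x \<in> topspace (obj \<H>)"
  shows "oact (inv g) (oact g x) = x" "oact g (oact (inv g) x) = x"
  using assms obj_act_mult[of "inv g" g x] obj_act_mult[of g "inv g" x] by (simp_all del: obj_act_mult)

section \<open>The crossed product\<close>

abbreviation C where "C \<equiv> crossed_product G \<alpha> \<H>"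

lemma crossed_sel:
  "arr C = prod_topology (gtop G) (arr \<H>)" "obj C = obj \<H>"
  "src C (g, \<gamma>) = src \<H> (\<alpha> (inv g) \<gamma>)" "rng C (g, \<gamma>) = rng \<H> \<gamma>"
  "gmul C (g, \<gamma>) (h, \<delta>) = (g \<otimes> h, gmul \<H> \<gamma> (\<alpha> g \<delta>))"
  "gone C x = (\<one>, gone \<H> x)"
  "ginv C (g, \<gamma>) = (inv g, \<alpha> (inv g) (ginv \<H> \<gamma>))"
  by (simp_all add: crossed_product_def)

lemma topspace_crossed: "topspace (arr C) = carrier G \<times> A"
  by (simp add: crossed_sel topspace_group)

lemma obj_act_inv_eq_iff:
  assumes "g \<in> carrier G" "x \<in> topspace (obj \<H>)" "y \<in> topspace (obj \<H>)"
  shows "oact (inv g) x = y \<longleftrightarrow> x = oact g y"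
  using assms obj_act_inv_cancel by metis

text \<open>Composability of \<open>(g, \<gamma>)\<close> and \<open>(h, \<delta>)\<close> means that \<open>\<gamma>\<close> and \<open>\<alpha> g \<delta>\<close> are composable in
\<open>\<H>\<close>. In this form the groupoid axioms of the crossed product reduce to those of \<open>G\<close> and
\<open>\<H>\<close>.\<close>

lemma crossed_composable:
  "((g, \<gamma>), (h, \<delta>)) \<in> composable C \<longleftrightarrow>
    g \<in> carrier G \<and> \<gamma> \<in> A \<and> h \<in> carrier G \<and> \<delta> \<in> A \<and> src \<H> \<gamma> = oact g (rng \<H> \<delta>)"
  by (auto simp: composable_def topspace_crossed crossed_sel obj_act_inv_eq_iff)

lemma topological_crossed: "topological_groupoid C"
proof -
  let ?C = "subtopology (prod_topology (arr C) (arr C)) (composable C)"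
  have id: "continuous_map (arr C) (prod_topology (gtop G) (arr \<H>)) (\<lambda>z. z)"
    using continuous_map_id[of "arr C"] by (simp add: id_def crossed_sel)
  note p1 = continuous_map_fst'[OF id] and p2 = continuous_map_snd'[OF id]
  have id2: "continuous_map ?C (prod_topology (prod_topology (gtop G) (arr \<H>)) (prod_topology (gtop G) (arr \<H>))) (\<lambda>z. z)"
    unfolding crossed_sel by (rule continuous_map_id')
  note q1 = continuous_map_fst'[OF id2] and q2 = continuous_map_snd'[OF id2]
  note q = continuous_map_fst'[OF q1] continuous_map_snd'[OF q1] continuous_map_fst'[OF q2] continuous_map_snd'[OF q2]
  have srcC: "src C = (\<lambda>z. src \<H> (\<alpha> (inv (fst z)) (snd z)))" and rngC: "rng C = (\<lambda>z. rng \<H> (snd z))"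
    and invC: "ginv C = (\<lambda>z. (inv (fst z), \<alpha> (inv (fst z)) (ginv \<H> (snd z))))"
    and oneC: "gone C = (\<lambda>x. (\<one>, gone \<H> x))"
    and mulC: "(\<lambda>(c, d). gmul C c d) =
      (\<lambda>z. (fst (fst z) \<otimes> fst (snd z), gmul \<H> (snd (fst z)) (\<alpha> (fst (fst z)) (snd (snd z)))))"
    by (auto simp: fun_eq_iff crossed_sel)
  show ?thesis unfolding topological_groupoid_def
  proof (intro conjI)
    show "continuous_map (arr C) (obj C) (src C)" unfolding srcC crossed_sel(2)
      by (intro continuous_map_compose'[OF _ continuous_src] continuous_arrow_act continuous_group_inv p1 p2)
    show "continuous_map (arr C) (obj C) (rng C)" unfolding rngC crossed_sel(2)
      by (intro continuous_map_compose'[OF _ continuous_rng] p2)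
    show "continuous_map (obj C) (arr C) (gone C)" unfolding oneC crossed_sel(1,2)
      by (intro continuous_map_pairedI continuous_one) (simp add: topspace_group)
    show "continuous_map (arr C) (arr C) (ginv C)" unfolding invC crossed_sel(1)[symmetric]
      unfolding crossed_sel(1) using p1 p2
      by (intro continuous_map_pairedI continuous_arrow_act continuous_group_inv
          continuous_map_compose'[OF _ continuous_inv]) (simp_all add: crossed_sel)
    show "continuous_map ?C (arr C) (\<lambda>(c, d). gmul C c d)" unfolding mulC
    proof -
      have "continuous_map ?C (prod_topology (gtop G) (arr \<H>))
        (\<lambda>z. (fst (fst z) \<otimes> fst (snd z), gmul \<H> (snd (fst z)) (\<alpha> (fst (fst z)) (snd (snd z)))))"
        by (intro continuous_map_pairedI continuous_group_mult continuous_mul continuous_arrow_act q)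
          (auto simp: crossed_composable)
      then show "continuous_map ?C (arr C)
        (\<lambda>z. (fst (fst z) \<otimes> fst (snd z), gmul \<H> (snd (fst z)) (\<alpha> (fst (fst z)) (snd (snd z)))))"
        by (simp add: crossed_sel(1))
    qed
    show "\<forall>(c, d)\<in>composable C. src C (gmul C c d) = src C d \<and> rng C (gmul C c d) = rng C c"
      by (auto simp: crossed_composable crossed_sel inv_mult_group)
    show "\<forall>c d e. (c, d) \<in> composable C \<longrightarrow> (d, e) \<in> composable C \<longrightarrow>
        gmul C (gmul C c d) e = gmul C c (gmul C d e)"
      by (auto simp: crossed_composable crossed_sel m_assoc act_mult act_mul mul_assoc)
    show "\<forall>x\<in>topspace (obj C). src C (gone C x) = x \<and> rng C (gone C x) = x"
      by (auto simp: crossed_sel)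
    have "gmul \<H> \<gamma> (gone \<H> (oact g (src \<H> (\<alpha> (inv g) \<gamma>)))) = \<gamma>" if "g \<in> carrier G" "\<gamma> \<in> A" for g \<gamma>
      using that by simp
    moreover have "gmul \<H> (\<alpha> (inv g) (ginv \<H> \<gamma>)) (\<alpha> (inv g) \<gamma>) = gone \<H> (oact (inv g) (src \<H> \<gamma>))"
      if "g \<in> carrier G" "\<gamma> \<in> A" for g \<gamma>
      using that by (simp flip: act_mul)
    ultimately show "\<forall>c\<in>topspace (arr C). gmul C (gone C (rng C c)) c = c \<and> gmul C c (gone C (src C c)) = c \<and>
        src C (ginv C c) = rng C c \<and> rng C (ginv C c) = src C c \<and>
        gmul C c (ginv C c) = gone C (rng C c) \<and> gmul C (ginv C c) c = gone C (src C c)"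
      by (auto simp: topspace_crossed crossed_sel)
  qed
qed

section \<open>The canonical module and its induced groupoid\<close>

abbreviation Q where "Q \<equiv> canonical_space G \<H>"
abbreviation cact where "cact \<equiv> canonical_act G \<alpha> \<H>"
abbreviation J where "J \<equiv> canonical_induced G \<alpha> \<H>"

lemma topspace_canonical: "topspace Q = carrier G \<times> topspace (obj \<H>)"
  by (simp add: canonical_space_def topspace_group)

lemma canonical_act_apply: "cact (g, x) (h, \<gamma>) = (g \<otimes> h, oact (inv h) (src \<H> \<gamma>))"
  by (simp add: canonical_act_def)

lemma right_module_canonical: "right_module C Q snd cact"
proof -
  let ?X = "subtopology (prod_topology Q (arr C)) {(p, c). snd p = rng C c}"
  have id: "continuous_map ?X (prod_topology (prod_topology (gtop G) (obj \<H>)) (prod_topology (gtop G) (arr \<H>))) (\<lambda>z. z)"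
    unfolding canonical_space_def crossed_sel by (rule continuous_map_id')
  note q1 = continuous_map_fst'[OF id] and q2 = continuous_map_snd'[OF id]
  note q = continuous_map_fst'[OF q1] continuous_map_snd'[OF q1] continuous_map_fst'[OF q2] continuous_map_snd'[OF q2]
  have eq: "(\<lambda>(p, c). cact p c) = (\<lambda>z. (fst (fst z) \<otimes> fst (snd z), oact (inv (fst (snd z))) (src \<H> (snd (snd z)))))"
    by (auto simp: fun_eq_iff canonical_act_apply)
  show ?thesis unfolding right_module_def
  proof (intro conjI)
    show "continuous_map Q (obj C) snd"
      unfolding canonical_space_def crossed_sel by (rule continuous_map_snd)
    have "continuous_map ?X (prod_topology (gtop G) (obj \<H>))
        (\<lambda>z. (fst (fst z) \<otimes> fst (snd z), oact (inv (fst (snd z))) (src \<H> (snd (snd z)))))"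
      by (intro continuous_map_pairedI continuous_group_mult continuous_obj_act continuous_group_inv
          continuous_map_compose'[OF _ continuous_src] q)
    then show "continuous_map ?X Q (\<lambda>(p, c). cact p c)"
      unfolding eq by (simp add: canonical_space_def)
    show "\<forall>p\<in>topspace Q. cact p (gone C (snd p)) = p"
      by (auto simp: topspace_canonical canonical_act_apply crossed_sel)
    show "\<forall>p\<in>topspace Q. \<forall>c\<in>topspace (arr C). snd p = rng C c \<longrightarrow> snd (cact p c) = src C c"
      by (auto simp: topspace_canonical canonical_act_apply topspace_crossed crossed_sel)
    have "cact (g, x) (gmul C (h, \<gamma>) (k, \<delta>)) = cact (cact (g, x) (h, \<gamma>)) (k, \<delta>)"
      if "g \<in> carrier G" "((h, \<gamma>), (k, \<delta>)) \<in> composable C" for g x h \<gamma> k \<delta>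
      using that by (simp add: crossed_composable crossed_sel canonical_act_apply m_assoc inv_mult_group)
    then show "\<forall>p\<in>topspace Q. \<forall>(c, d)\<in>composable C. snd p = rng C c \<longrightarrow> cact p (gmul C c d) = cact (cact p c) d"
      by (auto simp: topspace_canonical)
  qed
qed

lemma hom_crossed: "hom_to_group C G (\<lambda>(h, \<gamma>). h)"
proof -
  have "(\<lambda>(h, \<gamma>). h) = (fst :: 'g \<times> 'a \<Rightarrow> 'g)" by auto
  then show ?thesis unfolding hom_to_group_def
    using continuous_map_fst[of "gtop G" "arr \<H>"] by (auto simp: crossed_sel)
qed

end

sublocale equivariant_groupoid \<subseteq> canonical: right_groupoid_module C Q snd cact
  by unfold_locales (rule topological_crossed right_module_canonical)+

context equivariant_groupoid
begin

lemma canonical_induced_eq: "canonical.I = J"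
  by (simp add: canonical_induced_def)

lemma topological_canonical: "topological_groupoid J"
  using canonical.topological_induced by (simp add: canonical_induced_eq)

lemma topspace_J:
  "topspace (arr J) = {((g, x), (h, \<gamma>)). g \<in> carrier G \<and> h \<in> carrier G \<and> \<gamma> \<in> A \<and> x = rng \<H> \<gamma>}"
  using canonical.topspace_induced
  by (auto simp: canonical_induced_eq topspace_canonical topspace_crossed crossed_sel)

lemma J_sel:
  "obj J = Q" "src J ((g, x), (h, \<gamma>)) = (g \<otimes> h, oact (inv h) (src \<H> \<gamma>))"
  "rng J (p, c) = p" "gmul J (p, (h, \<gamma>)) (p', (k, \<delta>)) = (p, (h \<otimes> k, gmul \<H> \<gamma> (\<alpha> h \<delta>)))"
  "gone J (g, x) = ((g, x), (\<one>, gone \<H> x))"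
  "ginv J ((g, x), (h, \<gamma>)) = ((g \<otimes> h, oact (inv h) (src \<H> \<gamma>)), (inv h, \<alpha> (inv h) (ginv \<H> \<gamma>)))"
  using canonical.induced_sel by (simp_all add: canonical_induced_eq crossed_sel canonical_act_apply)

lemma continuous_J_components:
  shows "continuous_map (arr J) (gtop G) (\<lambda>c. fst (fst c))"
    and "continuous_map (arr J) (obj \<H>) (\<lambda>c. snd (fst c))"
    and "continuous_map (arr J) (gtop G) (\<lambda>c. fst (snd c))"
    and "continuous_map (arr J) (arr \<H>) (\<lambda>c. snd (snd c))"
proof -
  have id: "continuous_map (arr J) (prod_topology (prod_topology (gtop G) (obj \<H>)) (prod_topology (gtop G) (arr \<H>))) (\<lambda>z. z)"
    unfolding canonical_induced_def induced_groupoid_def canonical_space_def crossed_sel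
    by (simp add: continuous_map_id')
  note q1 = continuous_map_fst'[OF id] and q2 = continuous_map_snd'[OF id]
  show "continuous_map (arr J) (gtop G) (\<lambda>c. fst (fst c))"
    "continuous_map (arr J) (obj \<H>) (\<lambda>c. snd (fst c))"
    "continuous_map (arr J) (gtop G) (\<lambda>c. fst (snd c))"
    "continuous_map (arr J) (arr \<H>) (\<lambda>c. snd (snd c))"
    by (rule continuous_map_fst'[OF q1] continuous_map_snd'[OF q1] continuous_map_fst'[OF q2] continuous_map_snd'[OF q2])+
qed

lemma continuous_into_J:
  assumes "continuous_map X (gtop G) g" "continuous_map X (obj \<H>) x"
    and "continuous_map X (gtop G) h" "continuous_map X (arr \<H>) \<gamma>"
    and "\<And>z. z \<in> topspace X \<Longrightarrow> x z = rng \<H> (\<gamma> z)"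
  shows "continuous_map X (arr J) (\<lambda>z. ((g z, x z), (h z, \<gamma> z)))"
  unfolding canonical_induced_eq[symmetric] using assms
  by (intro canonical.continuous_into_induced)
    (simp_all add: canonical_space_def crossed_sel continuous_map_pairedI)

text \<open>The component dropped by \<^const>\<open>to_triple\<close> is the range of the arrow, so it can be
restored continuously.\<close>

lemma groupoid_iso_principal_bundle:
  "groupoid_iso J (principal_bundle G (\<lambda>(h, \<gamma>). h) C) to_triple (\<lambda>p. p)"
proof -
  let ?B = "principal_bundle G (\<lambda>(h, \<gamma>). h) C"
  let ?inv = "\<lambda>z. ((fst z, rng \<H> (snd (snd z))), (fst (snd z), snd (snd z)))"
  have arrB: "arr ?B = prod_topology (gtop G) (prod_topology (gtop G) (arr \<H>))"
    and objB: "obj ?B = Q"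
    by (simp_all add: principal_bundle_def crossed_sel canonical_space_def)
  have tt: "to_triple = (\<lambda>c. (fst (fst c), (fst (snd c), snd (snd c))))"
    by (auto simp: fun_eq_iff to_triple_def)
  have id: "continuous_map (arr ?B) (prod_topology (gtop G) (prod_topology (gtop G) (arr \<H>))) (\<lambda>z. z)"
    using continuous_map_id[of "arr ?B"] by (simp add: arrB id_def)
  note r = continuous_map_fst'[OF id] continuous_map_fst'[OF continuous_map_snd'[OF id]]
    continuous_map_snd'[OF continuous_map_snd'[OF id]]
  have "continuous_map (arr J) (arr ?B) to_triple"
    unfolding arrB tt by (intro continuous_map_pairedI continuous_J_components)
  moreover have "continuous_map (arr ?B) (arr J) ?inv"
    by (intro continuous_into_J continuous_map_compose'[OF _ continuous_rng] r refl)
  ultimately have "homeomorphic_maps (arr J) (arr ?B) to_triple ?inv"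
    unfolding homeomorphic_maps_def by (auto simp: topspace_J to_triple_def)
  then have "homeomorphic_map (arr J) (arr ?B) to_triple"
    using homeomorphic_map_maps by blast
  moreover have "homeomorphic_map (obj J) (obj ?B) (\<lambda>p. p)"
    using homeomorphic_map_id[of Q Q] by (simp add: objB J_sel id_def)
  ultimately show ?thesis unfolding groupoid_iso_def
  proof (intro conjI)
    show "\<forall>\<gamma>\<in>topspace (arr J). src ?B (to_triple \<gamma>) = src J \<gamma> \<and> rng ?B (to_triple \<gamma>) = rng J \<gamma>"
      by (auto simp: topspace_J to_triple_def J_sel principal_bundle_def crossed_sel)
    show "\<forall>(\<gamma>, \<eta>)\<in>composable J. to_triple (gmul J \<gamma> \<eta>) = gmul ?B (to_triple \<gamma>) (to_triple \<eta>)"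
      by (auto simp: to_triple_def J_sel principal_bundle_def crossed_sel)
  qed
qed

lemma obj_act_tau:
  "k \<in> carrier G \<Longrightarrow> obj_act J (tau G) k (g, x) = (k \<otimes> g, x)"
  by (simp add: obj_act_def J_sel tau_def)

lemma G_groupoid_tau: "topological_G_groupoid G J (tau G)"
proof -
  have id: "continuous_map (prod_topology (gtop G) (arr J)) (prod_topology (gtop G) (arr J)) (\<lambda>z. z)"
    using continuous_map_id[of "prod_topology (gtop G) (arr J)"] by (simp add: id_def)
  note s = continuous_map_snd'[OF id]
  note r = continuous_map_fst'[OF id] continuous_J_components[THEN continuous_map_compose'[OF s]]
  have eq: "(\<lambda>(k, c). tau G k c) = (\<lambda>z. ((fst z \<otimes> fst (fst (snd z)), snd (fst (snd z))), (fst (snd (snd z)), snd (snd (snd z)))))"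
    by (auto simp: fun_eq_iff tau_def)
  have "continuous_map (prod_topology (gtop G) (arr J)) (arr J) (\<lambda>(k, c). tau G k c)"
    unfolding eq by (intro continuous_into_J continuous_group_mult r) (auto simp: topspace_J)
  then have "continuous_group_action G (arr J) (tau G)"
    unfolding continuous_group_action_def
  proof (intro conjI, assumption)
    show "\<forall>c\<in>topspace (arr J). tau G \<one> c = c"
      "\<forall>g\<in>carrier G. \<forall>h\<in>carrier G. \<forall>c\<in>topspace (arr J). tau G (g \<otimes> h) c = tau G g (tau G h c)"
      by (auto simp: topspace_J tau_def m_assoc)
  qed
  then show ?thesis unfolding topological_G_groupoid_def
  proof (intro conjI ballI topological_canonical, assumption)
    fix k assume k: "k \<in> carrier G"
    { fix c assume "c \<in> topspace (arr J)"
      then obtain g h \<gamma> where c: "c = ((g, rng \<H> \<gamma>), (h, \<gamma>))" "g \<in> carrier G" "h \<in> carrier G" "\<gamma> \<in> A"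
        by (auto simp: topspace_J)
      show "src J (tau G k c) = obj_act J (tau G) k (src J c)"
        "rng J (tau G k c) = obj_act J (tau G) k (rng J c)"
        "ginv J (tau G k c) = tau G k (ginv J c)"
        using c k by (simp_all add: obj_act_tau J_sel tau_def m_assoc) }
    show "gone J (obj_act J (tau G) k p) = tau G k (gone J p)" if "p \<in> topspace (obj J)" for p
      using k by (cases p) (simp add: obj_act_tau J_sel, simp add: tau_def)
    show "case d of (c, c') \<Rightarrow> tau G k (gmul J c c') = gmul J (tau G k c) (tau G k c')"
      if "d \<in> composable J" for d
      by (auto simp: tau_def J_sel split: prod.splits)
  qed
qed

end

section \<open>The equivariant Morita equivalence\<close>

locale Hausdorff_equivariant_groupoid = equivariant_groupoid G \<H> \<alpha>
  for G :: "'g top_group" (structure) and \<H> :: "('a, 'o) groupoid" and \<alpha> +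
  assumes Hausdorff_arrows: "Hausdorff_space (arr \<H>)"
begin

text \<open>The map \<open>(g, h, \<gamma>) \<mapsto> \<alpha> g \<gamma>\<close> exhibits the induced groupoid as the pullback of \<open>\<H>\<close> along
\<open>(g, x) \<mapsto> oact g x\<close>: an arrow is determined by its two end points \<open>(g, x)\<close>,
\<open>(g \<otimes> h, x')\<close> and by the arrow \<open>\<alpha> g \<gamma>\<close> of \<open>\<H>\<close> between their images. The bimodule
attached to such a pullback consists of the pairs \<open>(\<gamma>, (g, x))\<close> with \<open>src \<H> \<gamma> = oact g x\<close>.
Here \<open>x\<close> is determined by \<open>g\<close> and \<open>\<gamma>\<close>, which leaves the product of \<open>G\<close> with the
arrow space. The definitions below are the operations of that bimodule in these coordinates.\<close>

definition bimod where "bimod = prod_topology (gtop G) (arr \<H>)"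
definition left_moment where "left_moment = (\<lambda>(g :: 'g, \<gamma>). rng \<H> \<gamma>)"
definition left_act where "left_act \<eta> = (\<lambda>(g :: 'g, \<gamma>). (g, gmul \<H> \<eta> \<gamma>))"
definition right_moment where "right_moment = (\<lambda>(g, \<gamma>). (g, oact (inv g) (src \<H> \<gamma>)))"
definition right_act where
  "right_act = (\<lambda>(g, \<gamma>) (p :: 'g \<times> 'o, (h, \<delta>)). (g \<otimes> h, gmul \<H> \<gamma> (\<alpha> g \<delta>)))"
definition diag_act where "diag_act k = (\<lambda>(g, \<gamma>). (k \<otimes> g, \<alpha> k \<gamma>))"

lemma bimodule_apply [simp]:
  "left_moment (g, \<gamma>) = rng \<H> \<gamma>" "left_act \<eta> (g, \<gamma>) = (g, gmul \<H> \<eta> \<gamma>)"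
  "right_moment (g, \<gamma>) = (g, oact (inv g) (src \<H> \<gamma>))"
  "right_act (g, \<gamma>) (p, (h, \<delta>)) = (g \<otimes> h, gmul \<H> \<gamma> (\<alpha> g \<delta>))"
  "diag_act k (g, \<gamma>) = (k \<otimes> g, \<alpha> k \<gamma>)"
  by (simp_all add: left_moment_def left_act_def right_moment_def right_act_def diag_act_def)

lemma topspace_bimod: "topspace bimod = carrier G \<times> A"
  by (simp add: bimod_def)

lemma continuous_bimod:
  shows "continuous_map bimod (gtop G) fst" "continuous_map bimod (arr \<H>) snd"
  unfolding bimod_def by (rule continuous_map_fst continuous_map_snd)+

lemma continuous_into_bimod:
  "continuous_map X (gtop G) f \<Longrightarrow> continuous_map X (arr \<H>) g \<Longrightarrow> continuous_map X bimod (\<lambda>z. (f z, g z))"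
  unfolding bimod_def by (rule continuous_map_pairedI)

lemma continuous_left_moment: "continuous_map bimod (obj \<H>) left_moment"
proof -
  have "left_moment = (\<lambda>z. rng \<H> (snd z))" by (auto simp: fun_eq_iff)
  then show ?thesis using continuous_map_compose'[OF continuous_bimod(2) continuous_rng] by simp
qed

lemma continuous_right_moment: "continuous_map bimod Q right_moment"
proof -
  have eq: "right_moment = (\<lambda>z. (fst z, oact (inv (fst z)) (src \<H> (snd z))))"
    by (auto simp: fun_eq_iff)
  show ?thesis unfolding eq canonical_space_def
    by (intro continuous_map_pairedI continuous_obj_act continuous_group_inv continuous_bimod
        continuous_map_compose'[OF continuous_bimod(2) continuous_src])
qed

text \<open>An arrow \<open>\<eta>\<close> with \<open>\<eta> \<cdot> (g, \<gamma>) = (g', \<gamma>')\<close> exists exactly if \<open>g = g'\<close> and \<open>\<gamma>\<close>, \<open>\<gamma>'\<close> have the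
same source, and then \<open>\<eta> = \<gamma>' \<gamma>\<inverse>\<close>: a closed condition and a continuous solution.\<close>

lemma principal_left: "principal_left_module \<H> bimod left_moment left_act"
proof -
  let ?X = "subtopology (prod_topology (arr \<H>) bimod) {(\<gamma>, p). src \<H> \<gamma> = left_moment p}"
  let ?Y = "prod_topology bimod bimod"
  have idX: "continuous_map ?X (prod_topology (arr \<H>) (prod_topology (gtop G) (arr \<H>))) (\<lambda>z. z)"
    unfolding bimod_def by (rule continuous_map_id')
  note x1 = continuous_map_fst'[OF idX] and x2 = continuous_map_fst'[OF continuous_map_snd'[OF idX]]
    and x3 = continuous_map_snd'[OF continuous_map_snd'[OF idX]]
  have act: "continuous_map ?X bimod (\<lambda>z. (fst (snd z), gmul \<H> (fst z) (snd (snd z))))"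
    using x1 x2 x3 by (intro continuous_into_bimod continuous_mul) (auto simp: topspace_bimod)
  have eq: "(\<lambda>(\<gamma>, p). left_act \<gamma> p) = (\<lambda>z. (fst (snd z), gmul \<H> (fst z) (snd (snd z))))"
    by (auto simp: fun_eq_iff)
  have module: "left_module \<H> bimod left_moment left_act"
    unfolding left_module_def
  proof (intro conjI)
    show "continuous_map ?X bimod (\<lambda>(\<gamma>, p). left_act \<gamma> p)" unfolding eq by (rule act)
    show "\<forall>p\<in>topspace bimod. \<forall>(\<gamma>, \<eta>)\<in>composable \<H>. src \<H> \<eta> = left_moment p \<longrightarrow>
        left_act (gmul \<H> \<gamma> \<eta>) p = left_act \<gamma> (left_act \<eta> p)"
      by (auto simp: topspace_bimod composable_def mul_assoc)
  qed (auto simp: topspace_bimod continuous_left_moment)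
  let ?C = "{z \<in> topspace ?Y. (fst (fst z), src \<H> (snd (fst z))) = (fst (snd z), src \<H> (snd (snd z)))}"
  let ?g = "\<lambda>z. (gmul \<H> (snd (fst z)) (ginv \<H> (snd (snd z))), (fst (snd z), snd (snd z)))"
  have C: "closedin ?Y ?C"
  proof (rule closedin_continuous_maps_eq)
    show "Hausdorff_space (prod_topology (gtop G) (obj \<H>))"
      using Hausdorff_group Hausdorff_obj[OF Hausdorff_arrows] by (simp add: Hausdorff_space_prod_topology)
    have *: "continuous_map bimod (prod_topology (gtop G) (obj \<H>)) (\<lambda>z. (fst z, src \<H> (snd z)))"
      by (intro continuous_map_pairedI continuous_bimod continuous_map_compose'[OF continuous_bimod(2) continuous_src])
    show "continuous_map ?Y (prod_topology (gtop G) (obj \<H>)) (\<lambda>z. (fst (fst z), src \<H> (snd (fst z))))"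
      "continuous_map ?Y (prod_topology (gtop G) (obj \<H>)) (\<lambda>z. (fst (snd z), src \<H> (snd (snd z))))"
      using continuous_map_compose'[OF continuous_map_fst *] continuous_map_compose'[OF continuous_map_snd *]
      by auto
  qed
  have idC: "continuous_map (subtopology ?Y ?C) (prod_topology (prod_topology (gtop G) (arr \<H>)) (prod_topology (gtop G) (arr \<H>))) (\<lambda>z. z)"
    unfolding bimod_def by (rule continuous_map_id')
  note c1 = continuous_map_fst'[OF idC] and c2 = continuous_map_snd'[OF idC]
  note c = continuous_map_fst'[OF c1] continuous_map_snd'[OF c1] continuous_map_fst'[OF c2] continuous_map_snd'[OF c2]
  have inC: "fst (fst z) = fst (snd z)" "src \<H> (snd (fst z)) = src \<H> (snd (snd z))"
    "snd (fst z) \<in> A" "snd (snd z) \<in> A" if "z \<in> topspace (subtopology ?Y ?C)" for z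
    using that by (auto simp: topspace_bimod)
  have "proper_map ?X ?Y (\<lambda>z. ((fst (snd z), gmul \<H> (fst z) (snd (snd z))), snd z))"
  proof (rule proper_map_closed_image[OF _ C, where g = ?g])
    show "continuous_map ?X ?Y (\<lambda>z. ((fst (snd z), gmul \<H> (fst z) (snd (snd z))), snd z))"
      using continuous_map_snd'[OF idX] by (intro continuous_map_pairedI act) (simp add: bimod_def)
    show "continuous_map (subtopology ?Y ?C) ?X ?g"
    proof (intro continuous_map_into_subtopology continuous_map_pairedI continuous_into_bimod continuous_mul
        continuous_map_compose'[OF _ continuous_inv] c)
      show "src \<H> (snd (fst z)) = rng \<H> (ginv \<H> (snd (snd z)))" if "z \<in> topspace (subtopology ?Y ?C)" for z
        using inC[OF that] by simp
      show "?g \<in> topspace (subtopology ?Y ?C) \<rightarrow> {(\<gamma>, p). src \<H> \<gamma> = left_moment p}"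
      proof
        show "?g z \<in> {(\<gamma>, p). src \<H> \<gamma> = left_moment p}" if "z \<in> topspace (subtopology ?Y ?C)" for z
          using inC[OF that] by (simp add: left_moment_def case_prod_unfold)
      qed
    qed
  qed (auto simp: topspace_bimod mul_mul_inv_cancel mul_inv_mul_cancel)
  moreover have "(\<lambda>(\<gamma>, p). (left_act \<gamma> p, p)) = (\<lambda>z. ((fst (snd z), gmul \<H> (fst z) (snd (snd z))), snd z))"
    by (auto simp: fun_eq_iff)
  ultimately show ?thesis
    unfolding principal_left_module_def using module
    by (auto simp: topspace_bimod mul_eq_self_left)
qed

text \<open>The point \<open>(g, \<gamma>)\<close> can be moved to \<open>(k, \<zeta>)\<close> exactly if \<open>\<gamma>\<close> and \<open>\<zeta>\<close> have the same range,
and then only by the arrow with components \<open>h = g\<inverse> k\<close> and \<open>\<delta> = g\<inverse> (\<gamma>\<inverse> \<zeta>)\<close>. As for the left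
action, this is a closed condition with a continuous solution.\<close>

lemma principal_right: "principal_right_module J bimod right_moment right_act"
proof -
  let ?X = "subtopology (prod_topology bimod (arr J)) {(p, c). right_moment p = rng J c}"
  let ?Y = "prod_topology bimod bimod"
  have idX: "continuous_map ?X (prod_topology (prod_topology (gtop G) (arr \<H>)) (arr J)) (\<lambda>z. z)"
    unfolding bimod_def by (rule continuous_map_id')
  note s = continuous_map_snd'[OF idX]
  note x = continuous_map_fst'[OF continuous_map_fst'[OF idX]] continuous_map_snd'[OF continuous_map_fst'[OF idX]]
    continuous_J_components(3,4)[THEN continuous_map_compose'[OF s]]
  have inX: "z \<in> topspace ?X \<longleftrightarrow> (\<exists>g h \<gamma> \<delta>. z = ((g, \<gamma>), ((g, rng \<H> \<delta>), (h, \<delta>))) \<and>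
      g \<in> carrier G \<and> h \<in> carrier G \<and> \<gamma> \<in> A \<and> \<delta> \<in> A \<and> src \<H> \<gamma> = oact g (rng \<H> \<delta>))" for z
    by (auto simp: topspace_bimod topspace_J J_sel obj_act_inv_eq_iff)
  let ?act = "\<lambda>z. (fst (fst z) \<otimes> fst (snd (snd z)), gmul \<H> (snd (fst z)) (\<alpha> (fst (fst z)) (snd (snd (snd z)))))"
  have inX1: "src \<H> (snd (fst z)) = rng \<H> (\<alpha> (fst (fst z)) (snd (snd (snd z))))" if "z \<in> topspace ?X" for z
    using that unfolding inX by auto
  have act: "continuous_map ?X bimod ?act"
    by (intro continuous_into_bimod continuous_group_mult continuous_mul continuous_arrow_act x) (rule inX1)
  have eq: "(\<lambda>(p, c). right_act p c) = ?act"
    by (auto simp: fun_eq_iff)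
  have module: "right_module J bimod right_moment right_act"
    unfolding right_module_def
  proof (intro conjI)
    show "continuous_map bimod (obj J) right_moment" using continuous_right_moment by (simp add: J_sel)
    show "continuous_map ?X bimod (\<lambda>(p, c). right_act p c)" unfolding eq by (rule act)
    show "\<forall>p\<in>topspace bimod. right_act p (gone J (right_moment p)) = p"
      by (auto simp: topspace_bimod J_sel)
    show "\<forall>p\<in>topspace bimod. \<forall>c\<in>topspace (arr J). right_moment p = rng J c \<longrightarrow> right_moment (right_act p c) = src J c"
      by (auto simp: topspace_bimod topspace_J J_sel obj_act_inv_eq_iff inv_mult_group)
    have "right_act (g, \<gamma>) (gmul J (p, (h, \<delta>)) (p', (k, \<zeta>))) = right_act (right_act (g, \<gamma>) (p, (h, \<delta>))) (p', (k, \<zeta>))"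
      if "g \<in> carrier G" "\<gamma> \<in> A" "((p, (h, \<delta>)), (p', (k, \<zeta>))) \<in> composable J" "right_moment (g, \<gamma>) = p"
      for g \<gamma> p h \<delta> p' k \<zeta>
      using that by (auto simp: composable_def topspace_J J_sel obj_act_inv_eq_iff m_assoc act_mult act_mul mul_assoc)
    then show "\<forall>p\<in>topspace bimod. \<forall>(c, d)\<in>composable J. right_moment p = rng J c \<longrightarrow>
        right_act p (gmul J c d) = right_act (right_act p c) d"
      by (auto simp: topspace_bimod J_sel)
  qed
  let ?C = "{z \<in> topspace ?Y. rng \<H> (snd (fst z)) = rng \<H> (snd (snd z))}"
  let ?h = "\<lambda>z. inv (fst (fst z)) \<otimes> fst (snd z)"
  let ?\<delta> = "\<lambda>z. \<alpha> (inv (fst (fst z))) (gmul \<H> (ginv \<H> (snd (fst z))) (snd (snd z)))"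
  let ?g = "\<lambda>z. ((fst (fst z), snd (fst z)), ((fst (fst z), rng \<H> (?\<delta> z)), (?h z, ?\<delta> z)))"
  have C: "closedin ?Y ?C"
    by (rule closedin_continuous_maps_eq[OF Hausdorff_obj[OF Hausdorff_arrows]
        continuous_map_compose'[OF continuous_map_compose'[OF continuous_map_fst continuous_bimod(2)] continuous_rng]
        continuous_map_compose'[OF continuous_map_compose'[OF continuous_map_snd continuous_bimod(2)] continuous_rng]])
  have idC: "continuous_map (subtopology ?Y ?C) (prod_topology bimod bimod) (\<lambda>z. z)"
    by (rule continuous_map_id')
  note c1 = continuous_map_fst'[OF idC] and c2 = continuous_map_snd'[OF idC]
  note c = continuous_bimod[THEN continuous_map_compose'[OF c1]] continuous_bimod[THEN continuous_map_compose'[OF c2]]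
  have inC: "fst (fst z) \<in> carrier G" "fst (snd z) \<in> carrier G" "rng \<H> (snd (fst z)) = rng \<H> (snd (snd z))"
    "snd (fst z) \<in> A" "snd (snd z) \<in> A" if "z \<in> topspace (subtopology ?Y ?C)" for z
    using that by (auto simp: topspace_bimod)
  have \<delta>: "continuous_map (subtopology ?Y ?C) (arr \<H>) ?\<delta>"
  proof (intro continuous_arrow_act continuous_group_inv continuous_mul continuous_map_compose'[OF _ continuous_inv] c)
    show "src \<H> (ginv \<H> (snd (fst z))) = rng \<H> (snd (snd z))" if "z \<in> topspace (subtopology ?Y ?C)" for z
      using inC[OF that] by simp
  qed
  have "proper_map ?X ?Y (\<lambda>z. (fst z, ?act z))"
  proof (rule proper_map_closed_image[OF _ C, where g = ?g])
    show "continuous_map ?X ?Y (\<lambda>z. (fst z, ?act z))"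
      using continuous_map_fst'[OF idX] by (intro continuous_map_pairedI act) (simp add: bimod_def)
    show "continuous_map (subtopology ?Y ?C) ?X ?g"
    proof (intro continuous_map_into_subtopology continuous_map_pairedI continuous_into_bimod continuous_into_J
        continuous_group_mult continuous_group_inv continuous_map_compose'[OF \<delta> continuous_rng] c \<delta> refl)
      show "?g \<in> topspace (subtopology ?Y ?C) \<rightarrow> {(p, c). right_moment p = rng J c}"
      proof
        show "?g z \<in> {(p, c). right_moment p = rng J c}" if "z \<in> topspace (subtopology ?Y ?C)" for z
          using inC[OF that] by (simp add: J_sel right_moment_def case_prod_unfold)
      qed
    qed
    show "(fst z, ?act z) \<in> ?C" if "z \<in> topspace ?X" for z
      using that unfolding inX by (auto simp: topspace_bimod)
    show "?g (fst z, ?act z) = z" if "z \<in> topspace ?X" for z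
      using that unfolding inX by (auto simp: inv_mul_cancel)
    show "(fst (?g z), ?act (?g z)) = z" if "z \<in> ?C" for z
      using that by (auto simp: topspace_bimod mul_inv_cancel)
  qed
  moreover have "(\<lambda>(p, c). (p, right_act p c)) = (\<lambda>z. (fst z, ?act z))"
    by (auto simp: fun_eq_iff)
  moreover have "c = gone J (right_moment p)"
    if "p \<in> topspace bimod" "c \<in> topspace (arr J)" "right_moment p = rng J c" "right_act p c = p" for p c
  proof -
    have "(p, c) \<in> topspace ?X" using that by simp
    then obtain g h \<gamma> \<delta> where pc: "(p, c) = ((g, \<gamma>), ((g, rng \<H> \<delta>), (h, \<delta>)))"
      and in': "g \<in> carrier G" "h \<in> carrier G" "\<gamma> \<in> A" "\<delta> \<in> A" and s: "src \<H> \<gamma> = oact g (rng \<H> \<delta>)"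
      unfolding inX by blast
    then have *: "p = (g, \<gamma>)" "c = ((g, rng \<H> \<delta>), (h, \<delta>))" by auto
    have "g \<otimes> h = g" "gmul \<H> \<gamma> (\<alpha> g \<delta>) = \<gamma>" using that(4) * by auto
    then have "h = \<one>" "\<alpha> g \<delta> = gone \<H> (src \<H> \<gamma>)"
      using in' s mul_eq_self_right[of \<gamma> "\<alpha> g \<delta>"] by auto
    then have "\<delta> = \<alpha> (inv g) (gone \<H> (src \<H> \<gamma>))" using in' by (metis act_inv_cancel(1))
    then show ?thesis using * in' s \<open>h = \<one>\<close> by (simp add: J_sel)
  qed
  ultimately show ?thesis
    unfolding principal_right_module_def using module by auto
qed

lemma right_orbit_eq:
  assumes "p \<in> topspace bimod"
  shows "right_orbit J right_moment right_act p = {p' \<in> topspace bimod. left_moment p' = left_moment p}"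
proof -
  obtain g \<gamma> where p: "p = (g, \<gamma>)" and in': "g \<in> carrier G" "\<gamma> \<in> A" using assms by (auto simp: topspace_bimod)
  have "\<exists>c. (k, \<zeta>) = right_act p c \<and> c \<in> topspace (arr J) \<and> right_moment p = rng J c"
    if "k \<in> carrier G" "\<zeta> \<in> A" "rng \<H> \<zeta> = rng \<H> \<gamma>" for k \<zeta>
  proof (intro exI conjI)
    let ?\<delta> = "\<alpha> (inv g) (gmul \<H> (ginv \<H> \<gamma>) \<zeta>)"
    let ?c = "((g, rng \<H> ?\<delta>), (inv g \<otimes> k, ?\<delta>))"
    show "(k, \<zeta>) = right_act p ?c" using that in' by (simp add: p mul_inv_cancel)
    show "?c \<in> topspace (arr J)" "right_moment p = rng J ?c"
      using that in' by (simp_all add: p topspace_J J_sel)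
  qed
  note ex = this
  show ?thesis
  proof (intro antisym subsetI)
    fix p' assume "p' \<in> right_orbit J right_moment right_act p"
    then show "p' \<in> {p' \<in> topspace bimod. left_moment p' = left_moment p}"
      using in' by (auto simp: right_orbit_def p topspace_bimod topspace_J J_sel obj_act_inv_eq_iff)
  next
    fix p' assume "p' \<in> {p' \<in> topspace bimod. left_moment p' = left_moment p}"
    then obtain k \<zeta> where p': "p' = (k, \<zeta>)" "k \<in> carrier G" "\<zeta> \<in> A" "rng \<H> \<zeta> = rng \<H> \<gamma>"
      by (auto simp: topspace_bimod p)
    show "p' \<in> right_orbit J right_moment right_act p"
      using ex[OF p'(2-4)] unfolding right_orbit_def p'(1) by simp
  qed
qed

lemma left_orbit_eq:
  assumes "p \<in> topspace bimod"
  shows "left_orbit \<H> left_moment left_act p = {p' \<in> topspace bimod. right_moment p' = right_moment p}"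
proof -
  obtain g \<gamma> where p: "p = (g, \<gamma>)" and in': "g \<in> carrier G" "\<gamma> \<in> A" using assms by (auto simp: topspace_bimod)
  have "\<exists>\<eta>. (g, \<zeta>) = left_act \<eta> p \<and> \<eta> \<in> A \<and> src \<H> \<eta> = left_moment p"
    if "\<zeta> \<in> A" "oact (inv g) (src \<H> \<zeta>) = oact (inv g) (src \<H> \<gamma>)" for \<zeta>
  proof (intro exI conjI)
    have s: "src \<H> \<zeta> = src \<H> \<gamma>" using that in' by (metis obj_act_inv_cancel(2) src_in)
    let ?\<eta> = "gmul \<H> \<zeta> (ginv \<H> \<gamma>)"
    show "(g, \<zeta>) = left_act ?\<eta> p" "?\<eta> \<in> A" "src \<H> ?\<eta> = left_moment p"
      using that in' s by (simp_all add: p mul_inv_mul_cancel)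
  qed
  then show ?thesis
    unfolding left_orbit_def using in' by (auto simp: p topspace_bimod)
qed

text \<open>The orbits of either action are the fibres of the opposite moment map, and both moment maps have
continuous sections: a unit arrow over \<open>x\<close> placed at \<open>\<one>\<close>, and a unit arrow over \<open>oact g x\<close>
placed at \<open>g\<close>.\<close>

lemma morita: "morita_equivalence \<H> J bimod left_moment left_act right_moment right_act"
  unfolding morita_equivalence_def
proof (intro conjI groupoid topological_canonical principal_left principal_right)
  show "\<forall>p\<in>topspace bimod. \<forall>\<gamma>\<in>A. src \<H> \<gamma> = left_moment p \<longrightarrow> right_moment (left_act \<gamma> p) = right_moment p"
    by (auto simp: topspace_bimod)
  show "\<forall>p\<in>topspace bimod. \<forall>c\<in>topspace (arr J). right_moment p = rng J c \<longrightarrow> left_moment (right_act p c) = left_moment p"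
    by (auto simp: topspace_bimod topspace_J J_sel obj_act_inv_eq_iff)
  show "\<forall>p\<in>topspace bimod. \<forall>\<gamma>\<in>A. \<forall>c\<in>topspace (arr J). src \<H> \<gamma> = left_moment p \<longrightarrow>
      right_moment p = rng J c \<longrightarrow> right_act (left_act \<gamma> p) c = left_act \<gamma> (right_act p c)"
    by (auto simp: topspace_bimod topspace_J J_sel obj_act_inv_eq_iff mul_assoc)
  show "\<exists>\<phi>. homeomorphic_map (quotient_topology bimod (right_orbit J right_moment right_act)) (obj \<H>) \<phi> \<and>
      (\<forall>p\<in>topspace bimod. \<phi> (right_orbit J right_moment right_act p) = left_moment p)"
  proof (rule homeomorphic_map_quotient_section[OF continuous_left_moment])
    show "continuous_map (obj \<H>) bimod (\<lambda>x. (\<one>, gone \<H> x))"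
      by (intro continuous_into_bimod continuous_one) simp
    show "right_orbit J right_moment right_act p = right_orbit J right_moment right_act p'
        \<longleftrightarrow> left_moment p = left_moment p'" if "p \<in> topspace bimod" "p' \<in> topspace bimod" for p p'
      unfolding right_orbit_eq[OF that(1)] right_orbit_eq[OF that(2)] using that by auto
  qed simp
  show "\<exists>\<psi>. homeomorphic_map (quotient_topology bimod (left_orbit \<H> left_moment left_act)) (obj J) \<psi> \<and>
      (\<forall>p\<in>topspace bimod. \<psi> (left_orbit \<H> left_moment left_act p) = right_moment p)"
    unfolding J_sel
  proof (rule homeomorphic_map_quotient_section[OF continuous_right_moment])
    show "continuous_map Q bimod (\<lambda>z. (fst z, gone \<H> (oact (fst z) (snd z))))"
      unfolding canonical_space_def
      by (intro continuous_into_bimod continuous_map_compose'[OF _ continuous_one] continuous_obj_act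
          continuous_map_fst continuous_map_snd)
    show "left_orbit \<H> left_moment left_act p = left_orbit \<H> left_moment left_act p'
        \<longleftrightarrow> right_moment p = right_moment p'" if "p \<in> topspace bimod" "p' \<in> topspace bimod" for p p'
      unfolding left_orbit_eq[OF that(1)] left_orbit_eq[OF that(2)] using that by auto
  qed (auto simp: topspace_canonical)
qed

lemma equivariant_morita:
  "equivariant_morita_equivalence G \<H> \<alpha> J (tau G) bimod left_moment left_act right_moment right_act diag_act"
  unfolding equivariant_morita_equivalence_def
proof (intro conjI G_action G_groupoid_tau morita)
  have idE: "continuous_map (prod_topology (gtop G) bimod) (prod_topology (gtop G) bimod) (\<lambda>z. z)"
    using continuous_map_id[of "prod_topology (gtop G) bimod"] by (simp add: id_def)
  note r = continuous_map_fst'[OF idE] continuous_bimod[THEN continuous_map_compose'[OF continuous_map_snd'[OF idE]]]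
  have eq: "(\<lambda>(k, p). diag_act k p) = (\<lambda>z. (fst z \<otimes> fst (snd z), \<alpha> (fst z) (snd (snd z))))"
    by (auto simp: fun_eq_iff)
  have "continuous_map (prod_topology (gtop G) bimod) bimod (\<lambda>(k, p). diag_act k p)"
    unfolding eq by (intro continuous_into_bimod continuous_group_mult continuous_arrow_act r)
  then show "continuous_group_action G bimod diag_act"
    unfolding continuous_group_action_def by (auto simp: topspace_bimod m_assoc act_mult)
  have eqv: "left_moment (diag_act k p) = oact k (left_moment p) \<and>
      right_moment (diag_act k p) = obj_act J (tau G) k (right_moment p)"
    if "k \<in> carrier G" "p \<in> topspace bimod" for k p
    using that by (auto simp: topspace_bimod obj_act_tau inv_mult_group)
  have act: "diag_act k (right_act (left_act \<gamma> p) c) = right_act (left_act (\<alpha> k \<gamma>) (diag_act k p)) (tau G k c)"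
    if "k \<in> carrier G" "p \<in> topspace bimod" "\<gamma> \<in> A" "c \<in> topspace (arr J)" "src \<H> \<gamma> = left_moment p"
      "right_moment p = rng J c" for k p \<gamma> c
    using that
    by (auto simp: topspace_bimod topspace_J J_sel tau_def obj_act_inv_eq_iff m_assoc act_mult act_mul)
  show "\<forall>k\<in>carrier G. \<forall>p\<in>topspace bimod. left_moment (diag_act k p) = oact k (left_moment p) \<and>
      right_moment (diag_act k p) = obj_act J (tau G) k (right_moment p) \<and>
      (\<forall>\<gamma>\<in>A. \<forall>c\<in>topspace (arr J). src \<H> \<gamma> = left_moment p \<longrightarrow> right_moment p = rng J c \<longrightarrow>
        diag_act k (right_act (left_act \<gamma> p) c) = right_act (left_act (\<alpha> k \<gamma>) (diag_act k p)) (tau G k c))"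
    using eqv act by blast
qed

end

section \<open>Haar measures on groups\<close>

locale lc_group_haar = lc_group G for G :: "'g top_group" (structure) +
  fixes \<mu> :: "'g measure"
  assumes second_countable_group: "second_countable (gtop G)"
    and left_haar: "left_haar_measure G \<mu>"
begin

lemma radon_group: "radon_measure (gtop G) \<mu>"
  using left_haar by (simp add: left_haar_measure_def)

lemma sets_group_haar: "sets \<mu> = sets (borel_of (gtop G))"
  by (rule radon_measure_sets[OF radon_group])

lemma space_group_haar: "space \<mu> = carrier G"
  using radon_measure_space[OF radon_group] by simp

lemma group_haar_translate:
  "g \<in> carrier G \<Longrightarrow> B \<in> sets \<mu> \<Longrightarrow> emeasure \<mu> ((\<lambda>h. g \<otimes> h) ` B) = emeasure \<mu> B"
  using left_haar by (simp add: left_haar_measure_def)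

lemma sigma_finite_group: "sigma_finite_measure \<mu>"
  using sigma_finite_radon[OF Hausdorff_group locally_compact_gtop second_countable_group radon_group] .

lemma translate_preimage:
  assumes "g \<in> carrier G" "B \<subseteq> carrier G"
  shows "(\<lambda>h. g \<otimes> h) ` B = {h \<in> carrier G. inv g \<otimes> h \<in> B}"
proof (intro antisym subsetI)
  fix h assume "h \<in> {h \<in> carrier G. inv g \<otimes> h \<in> B}"
  then have "h = g \<otimes> (inv g \<otimes> h)" "inv g \<otimes> h \<in> B" using assms by auto
  then show "h \<in> (\<lambda>h. g \<otimes> h) ` B" by blast
qed (use assms in auto)

lemma continuous_left_translate:
  assumes "g \<in> carrier G"
  shows "continuous_map (gtop G) (gtop G) (\<lambda>h. g \<otimes> h)"
  using assms continuous_map_id[of "gtop G"] by (intro continuous_group_mult) (auto simp: id_def)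

text \<open>The translates of a nonempty open set cover the group, and by the Lindelof property countably
many of them do. All have the same measure, which is not 0 because the group is not null.\<close>

lemma group_haar_open_pos:
  assumes U: "openin (gtop G) U" "U \<noteq> {}"
  shows "emeasure \<mu> U > 0"
proof (rule ccontr)
  assume "\<not> emeasure \<mu> U > 0"
  then have U0: "emeasure \<mu> U = 0" by simp
  have UG: "U \<subseteq> carrier G" using openin_subset[OF U(1)] by simp
  obtain u where u: "u \<in> U" "u \<in> carrier G" using U(2) UG by blast
  let ?T = "\<lambda>g. (\<lambda>h. g \<otimes> h) ` U"
  have T: "openin (gtop G) (?T g)" if "g \<in> carrier G" for g
    using openin_continuous_map_preimage[OF continuous_left_translate U(1), of "inv g"] that
    by (simp add: translate_preimage[OF that UG])
  have "carrier G \<subseteq> \<Union> (?T ` carrier G)"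
  proof
    fix x assume x: "x \<in> carrier G"
    have "x = x \<otimes> inv u \<otimes> u" using x u(2) by (simp add: m_assoc)
    then have "x \<in> ?T (x \<otimes> inv u)" using u(1) by (rule image_eqI)
    moreover have "x \<otimes> inv u \<in> carrier G" using x u(2) by simp
    ultimately show "x \<in> \<Union> (?T ` carrier G)" by (intro UN_I)
  qed
  moreover have "\<Union> (?T ` carrier G) \<subseteq> carrier G" using UG by auto
  ultimately have "\<Union> (?T ` carrier G) = topspace (gtop G)" by auto
  then have "\<exists>\<V>. countable \<V> \<and> \<V> \<subseteq> ?T ` carrier G \<and> \<Union> \<V> = topspace (gtop G)"
    using T by (intro Lindelof_spaceD second_countable_imp_Lindelof_space second_countable_group) auto
  then obtain \<V> where \<V>: "countable \<V>" "\<V> \<subseteq> ?T ` carrier G" "\<Union> \<V> = carrier G"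
    unfolding topspace_group by (elim exE conjE)
  have "V \<in> null_sets \<mu>" if V: "V \<in> \<V>" for V
  proof -
    obtain g where g: "g \<in> carrier G" "V = ?T g" using V \<V>(2) by blast
    have "U \<in> sets \<mu>" "V \<in> sets \<mu>"
      using openin_sets_borel_of U(1) T[OF g(1)] by (auto simp: g(2) sets_group_haar)
    then show ?thesis using group_haar_translate[OF g(1)] U0 by (auto simp: null_sets_def g(2))
  qed
  then have "(\<Union>V\<in>\<V>. V) \<in> null_sets \<mu>" using \<V>(1) by (intro null_sets_UN') auto
  then have "emeasure \<mu> (carrier G) = 0" using \<V>(3) by auto
  then show False using left_haar by (simp add: left_haar_measure_def)
qed

lemma integral_left_translate:
  fixes \<phi> :: "'g \<Rightarrow> real"
  assumes g: "g \<in> carrier G" and \<phi>: "\<phi> \<in> borel_measurable \<mu>"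
  shows "(LINT h|\<mu>. \<phi> (g \<otimes> h)) = (LINT h|\<mu>. \<phi> h)"
proof -
  have m: "(\<lambda>h. g \<otimes> h) \<in> \<mu> \<rightarrow>\<^sub>M \<mu>"
    using continuous_map_measurable[OF continuous_left_translate[OF g] sets_group_haar]
      measurable_cong_sets[OF refl sets_group_haar] by blast
  have "distr \<mu> \<mu> (\<lambda>h. g \<otimes> h) = \<mu>"
  proof (rule measure_eqI)
    fix B assume "B \<in> sets (distr \<mu> \<mu> (\<lambda>h. g \<otimes> h))"
    then have B: "B \<in> sets \<mu>" by simp
    then have BG: "B \<subseteq> carrier G" using sets.sets_into_space space_group_haar by blast
    have "(\<lambda>h. g \<otimes> h) -` B \<inter> space \<mu> = (\<lambda>h. inv g \<otimes> h) ` B"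
      using g by (auto simp: translate_preimage[OF inv_closed[OF g] BG] space_group_haar)
    then show "emeasure (distr \<mu> \<mu> (\<lambda>h. g \<otimes> h)) B = emeasure \<mu> B"
      using group_haar_translate[OF inv_closed[OF g] B] by (simp add: emeasure_distr[OF m B])
  qed simp
  then show ?thesis using integral_distr[OF m \<phi>] by simp
qed

end

section \<open>The Haar system of the crossed product\<close>

locale haar_G_groupoid = lc_group_haar G \<mu> + haar_groupoid \<H> \<nu> + Hausdorff_equivariant_groupoid G \<H> \<alpha>
  for G :: "'g top_group" (structure) and \<mu> and \<H> :: "('a, 'o) groupoid" and \<nu> and \<alpha> +
  assumes G_groupoid: "G_groupoid G \<H> \<nu> \<alpha>"
begin

abbreviation \<kappa> where "\<kappa> \<equiv> crossed_haar \<mu> \<nu>"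

lemma arrow_act_continuous: "g \<in> carrier G \<Longrightarrow> continuous_map (arr \<H>) (arr \<H>) (\<alpha> g)"
  using continuous_arrow_act[of "arr \<H>" "\<lambda>_. g" "\<lambda>x. x"] continuous_map_id[of "arr \<H>"]
  by (simp add: id_def)

lemma integral_act:
  fixes f :: "'a \<Rightarrow> real"
  assumes g: "g \<in> carrier G" and x: "x \<in> topspace (obj \<H>)" and f: "f \<in> borel_measurable (borel_of (arr \<H>))"
  shows "(LINT \<gamma>|\<nu> x. f (\<alpha> g \<gamma>)) = (LINT \<gamma>|\<nu> (oact g x). f \<gamma>)"
proof -
  have "distr (\<nu> x) (borel_of (arr \<H>)) (\<alpha> g) = \<nu> (oact g x)"
    using G_groupoid g x by (simp add: G_groupoid_def)
  then show ?thesis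
    using integral_distr[OF continuous_map_measurable[OF arrow_act_continuous[OF g] sets_haar[OF x]] f]
    by simp
qed

lemma range_fibre_crossed: "range_fibre C x = carrier G \<times> range_fibre \<H> x"
  by (auto simp: range_fibre_def topspace_crossed crossed_sel)

lemma Hausdorff_crossed: "Hausdorff_space (arr C)"
  using Hausdorff_group Hausdorff_arr by (simp add: crossed_sel Hausdorff_space_prod_topology)

lemma locally_compact_crossed: "locally_compact_space (arr C)"
  using locally_compact_gtop locally_compact_arr by (simp add: crossed_sel locally_compact_space_prod_topology)

lemma second_countable_crossed: "second_countable (arr C)"
  using second_countable_group second_countable_arr
  by (simp add: crossed_sel second_countable_prod_topology)

lemma pair_sigma_finite: "x \<in> topspace (obj \<H>) \<Longrightarrow> pair_sigma_finite \<mu> (\<nu> x)"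
  unfolding pair_sigma_finite_def
  using sigma_finite_group sigma_finite_radon[OF Hausdorff_arr locally_compact_arr second_countable_arr haar_radon]
  by blast

lemma radon_crossed:
  assumes "x \<in> topspace (obj \<H>)"
  shows "radon_measure (arr C) (\<kappa> x)"
  unfolding crossed_haar_def crossed_sel
  by (rule radon_measure_pair[OF Hausdorff_group locally_compact_gtop second_countable_group
      Hausdorff_arr locally_compact_arr second_countable_arr radon_group haar_radon[OF assms]])

lemma crossed_haar_fubini:
  fixes f :: "'g \<times> 'a \<Rightarrow> real"
  assumes "x \<in> topspace (obj \<H>)" "integrable (\<kappa> x) f"
  shows "(LINT c|\<kappa> x. f c) = (LINT g|\<mu>. LINT \<gamma>|\<nu> x. f (g, \<gamma>))"
    and "(\<lambda>g. LINT \<gamma>|\<nu> x. f (g, \<gamma>)) \<in> borel_measurable \<mu>"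
proof -
  interpret pair_sigma_finite \<mu> "\<nu> x" using assms(1) by (rule pair_sigma_finite)
  show "(LINT c|\<kappa> x. f c) = (LINT g|\<mu>. LINT \<gamma>|\<nu> x. f (g, \<gamma>))"
    using integral_fst'[of f] assms(2) by (simp add: crossed_haar_def)
  show "(\<lambda>g. LINT \<gamma>|\<nu> x. f (g, \<gamma>)) \<in> borel_measurable \<mu>"
    using integrable_fst'[of f] assms(2) by (simp add: crossed_haar_def borel_measurable_integrable)
qed

text \<open>The integral over \<open>\<gamma>\<close> is a jointly continuous function of \<open>g\<close> and \<open>x\<close> that vanishes for
\<open>g\<close> outside a compact set independent of \<open>x\<close>, so the result on parametric integrals
applies a second time, to the integration over \<open>g\<close> with \<open>x\<close> as parameter.\<close>

lemma continuous_crossed_haar: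
  assumes f: "f \<in> Cc (arr C)"
  shows "continuous_map (obj \<H>) euclideanreal (\<lambda>x. LINT c|\<kappa> x. f c)"
proof -
  obtain K where K: "compactin (arr C) K" "\<And>z. z \<in> topspace (arr C) \<Longrightarrow> z \<notin> K \<Longrightarrow> f z = 0"
    using Cc_compact_support[OF f] by metis
  have K1: "compactin (gtop G) (fst ` K)" and K2: "compactin (arr \<H>) (snd ` K)"
    using K(1) image_compactin continuous_map_fst continuous_map_snd unfolding crossed_sel by metis+
  have f0: "f (g, \<gamma>) = 0" if "g \<in> carrier G" "\<gamma> \<in> A" "g \<notin> fst ` K \<or> \<gamma> \<notin> snd ` K" for g \<gamma>
    using that K(2)[of "(g, \<gamma>)"] by (force simp: topspace_crossed)
  have cf: "continuous_map (prod_topology (gtop G) (arr \<H>)) euclideanreal f"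
    using Cc_continuous[OF f] by (simp add: crossed_sel)
  have "continuous_map (prod_topology (gtop G) (obj \<H>)) euclideanreal (\<lambda>(g, x). LINT \<gamma>|\<nu> x. f (g, \<gamma>))"
    by (rule continuous_parametric_integral[OF locally_compact_arr Hausdorff_arr haar_radon haar_continuous cf K2])
      (auto intro: f0)
  from continuous_map_compose'[OF _ this, of "prod_topology (obj \<H>) (gtop G)" "\<lambda>z. (snd z, fst z)"]
  have c2: "continuous_map (prod_topology (obj \<H>) (gtop G)) euclideanreal (\<lambda>z. LINT \<gamma>|\<nu> (fst z). f (snd z, \<gamma>))"
    by (simp add: continuous_map_pairedI continuous_map_fst continuous_map_snd)
  have "continuous_map (prod_topology (obj \<H>) (obj \<H>)) euclideanreal
      (\<lambda>(x, x'). LINT g|\<mu>. LINT \<gamma>|\<nu> (fst (x, g)). f (snd (x, g), \<gamma>))"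
  proof (rule continuous_parametric_integral[OF locally_compact_gtop Hausdorff_group radon_group _ c2 K1])
    fix x g assume "x \<in> topspace (obj \<H>)" "g \<in> topspace (gtop G)" "g \<notin> fst ` K"
    then show "(LINT \<gamma>|\<nu> (fst (x, g)). f (snd (x, g), \<gamma>)) = 0"
      using f0 by (intro integral_eq_zero_AE AE_I2) (auto simp: space_haar)
  qed simp
  from continuous_map_compose'[OF _ this, of "obj \<H>" "\<lambda>x. (x, x)"] continuous_map_id[of "obj \<H>"]
  have "continuous_map (obj \<H>) euclideanreal (\<lambda>x. LINT g|\<mu>. LINT \<gamma>|\<nu> x. f (g, \<gamma>))"
    by (simp add: continuous_map_pairedI id_def)
  then show ?thesis
    by (rule continuous_map_eq)
      (simp add: crossed_haar_fubini(1) integrable_Cc[OF Hausdorff_crossed radon_crossed f])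
qed

text \<open>Translation by \<open>(g, \<gamma>)\<close> sends \<open>(h, \<delta>)\<close> to \<open>(g \<otimes> h, \<gamma> (\<alpha> g \<delta>))\<close>. In the inner integral,
the invariance of \<open>\<nu>\<close> under the action replaces \<open>\<alpha> g \<delta>\<close> by an arrow \<open>\<eta>\<close> integrated against
\<open>\<nu> (src \<H> \<gamma>)\<close>, and left invariance of \<open>\<nu>\<close> then absorbs \<open>\<gamma>\<close>. What remains in the
outer integral is the translation by \<open>g\<close>, absorbed by \<open>\<mu>\<close>.\<close>

lemma invariant_crossed_haar:
  assumes f: "f \<in> Cc (arr C)" and c: "c \<in> topspace (arr C)"
  shows "(LINT d|\<kappa> (src C c). indicator (range_fibre C (src C c)) d *\<^sub>R f (gmul C c d)) = (LINT d|\<kappa> (rng C c). f d)"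
proof -
  obtain g \<gamma> where c_eq: "c = (g, \<gamma>)" and g: "g \<in> carrier G" and \<gamma>: "\<gamma> \<in> A"
    using c by (auto simp: topspace_crossed)
  define s where "s = oact (inv g) (src \<H> \<gamma>)"
  have s: "src C c = s" "s \<in> topspace (obj \<H>)" "oact g s = src \<H> \<gamma>"
    using g \<gamma> by (simp_all add: c_eq crossed_sel s_def)
  have r: "rng C c = rng \<H> \<gamma>" by (simp add: c_eq crossed_sel)
  define \<Psi> where "\<Psi> h = (LINT \<eta>|\<nu> (rng \<H> \<gamma>). f (h, \<eta>))" for h
  have slice: "(\<lambda>\<eta>. f (h, \<eta>)) \<in> Cc (arr \<H>)" if "h \<in> carrier G" for h
    using Cc_slice[OF Hausdorff_arr f[unfolded crossed_sel]] that by simp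
  have int_f: "integrable (\<kappa> (rng \<H> \<gamma>)) f"
    using \<gamma> by (intro integrable_Cc[OF Hausdorff_crossed radon_crossed f]) simp
  let ?k = "\<lambda>d. indicator (range_fibre C s) d *\<^sub>R f (gmul C c d)"
  have inner: "(LINT \<delta>|\<nu> s. ?k (h, \<delta>)) = \<Psi> (g \<otimes> h)" if h: "h \<in> carrier G" for h
  proof -
    let ?u = "\<lambda>\<eta>. indicator (range_fibre \<H> (src \<H> \<gamma>)) \<eta> *\<^sub>R f (g \<otimes> h, gmul \<H> \<gamma> \<eta>)"
    note sl = slice[OF m_closed[OF g h]]
    have "(LINT \<delta>|\<nu> s. ?k (h, \<delta>)) = (LINT \<delta>|\<nu> s. ?u (\<alpha> g \<delta>))"
    proof (intro Bochner_Integration.integral_cong refl)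
      fix \<delta> assume "\<delta> \<in> space (\<nu> s)"
      then have \<delta>: "\<delta> \<in> A" using space_haar[OF s(2)] by simp
      have "rng \<H> \<delta> = s \<longleftrightarrow> oact g (rng \<H> \<delta>) = src \<H> \<gamma>"
        using g \<delta> \<gamma> s by (metis obj_act_inv_cancel(1) rng_in)
      then show "?k (h, \<delta>) = ?u (\<alpha> g \<delta>)"
        using g h \<delta> by (simp add: range_fibre_crossed c_eq crossed_sel indicator_def range_fibre_def)
    qed
    also have "\<dots> = (LINT \<eta>|\<nu> (src \<H> \<gamma>). ?u \<eta>)"
      using integral_act[OF g s(2) left_translate_measurable[OF Hausdorff_arr \<gamma> Cc_continuous[OF sl]]]
      by (simp add: s(3))
    also have "\<dots> = \<Psi> (g \<otimes> h)" unfolding \<Psi>_def by (rule haar_invariant[OF sl \<gamma>])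
    finally show ?thesis .
  qed
  have "integrable (\<kappa> s) ?k"
    using canonical.left_translate_integrable[OF Hausdorff_crossed c f radon_crossed[OF s(2)]] by (simp add: s(1))
  then have "(LINT d|\<kappa> s. ?k d) = (LINT h|\<mu>. LINT \<delta>|\<nu> s. ?k (h, \<delta>))"
    by (rule crossed_haar_fubini(1)[OF s(2)])
  also have "\<dots> = (LINT h|\<mu>. \<Psi> (g \<otimes> h))"
    using inner by (intro Bochner_Integration.integral_cong) (auto simp: space_group_haar)
  also have "\<dots> = (LINT h|\<mu>. \<Psi> h)"
    using crossed_haar_fubini(2)[OF rng_in[OF \<gamma>] int_f] unfolding \<Psi>_def
    by (rule integral_left_translate[OF g])
  also have "\<dots> = (LINT d|\<kappa> (rng \<H> \<gamma>). f d)"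
    unfolding \<Psi>_def by (rule crossed_haar_fubini(1)[OF rng_in[OF \<gamma>] int_f, symmetric])
  finally show ?thesis by (simp only: s(1) r)
qed

lemma crossed_left_haar_system: "left_haar_system C \<kappa>"
  unfolding left_haar_system_def
proof (intro conjI ballI allI impI)
  fix x assume "x \<in> topspace (obj C)"
  then have x: "x \<in> topspace (obj \<H>)" by (simp add: crossed_sel)
  interpret pair_sigma_finite \<mu> "\<nu> x" using x by (rule pair_sigma_finite)
  show "radon_measure (arr C) (\<kappa> x)" using x by (rule radon_crossed)
  have "topspace (arr C) - range_fibre C x = carrier G \<times> (A - range_fibre \<H> x)"
    by (auto simp: topspace_crossed range_fibre_crossed)
  moreover have "carrier G \<in> sets \<mu>" using sets.top[of \<mu>] by (simp add: space_group_haar)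
  moreover have "A - range_fibre \<H> x \<in> sets (\<nu> x)"
    using sets.compl_sets[OF range_fibre_sets[OF x]] by (simp add: space_haar[OF x])
  ultimately show "emeasure (\<kappa> x) (topspace (arr C) - range_fibre C x) = 0"
    using haar_null[OF x] by (simp add: crossed_haar_def M2.emeasure_pair_measure_Times)
  fix U assume U: "openin (arr C) U" and ne: "U \<inter> range_fibre C x \<noteq> {}"
  then obtain g \<gamma> where g\<gamma>: "(g, \<gamma>) \<in> U" "\<gamma> \<in> range_fibre \<H> x" by (auto simp: range_fibre_crossed)
  obtain V W where VW: "openin (gtop G) V" "openin (arr \<H>) W" "g \<in> V" "\<gamma> \<in> W" "V \<times> W \<subseteq> U"
    using U[unfolded crossed_sel openin_prod_topology_alt] g\<gamma>(1) by meson
  have sVW: "V \<in> sets \<mu>" "W \<in> sets (\<nu> x)"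
    using openin_sets_borel_of VW(1,2) by (simp_all add: sets_group_haar sets_haar[OF x])
  have "0 < emeasure \<mu> V" "0 < emeasure (\<nu> x) W"
    using group_haar_open_pos[OF VW(1)] haar_pos[OF x VW(2)] VW g\<gamma> by auto
  then have "0 < emeasure \<mu> V * emeasure (\<nu> x) W" by (simp add: ennreal_zero_less_mult_iff)
  also have "\<dots> = emeasure (\<kappa> x) (V \<times> W)"
    using sVW by (simp add: crossed_haar_def M2.emeasure_pair_measure_Times)
  also have "\<dots> \<le> emeasure (\<kappa> x) U"
    using VW(5) openin_sets_borel_of[OF U] radon_measure_sets[OF radon_crossed[OF x]]
    by (intro emeasure_mono) auto
  finally show "emeasure (\<kappa> x) U > 0" .
next
  fix f assume "f \<in> Cc (arr C)"
  from continuous_crossed_haar[OF this]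
  show "continuous_map (obj C) euclideanreal (\<lambda>x. LINT c|\<kappa> x. f c)" by (simp add: crossed_sel)
next
  fix f c assume "f \<in> Cc (arr C)" "c \<in> topspace (arr C)"
  from invariant_crossed_haar[OF this]
  show "(LINT d:range_fibre C (src C c)|\<kappa> (src C c). f (gmul C c d)) = (LINT d|\<kappa> (rng C c). f d)"
    by (simp add: set_lebesgue_integral_def)
qed

lemma crossed_groupoid_with_haar: "groupoid_with_haar C \<kappa>"
  unfolding groupoid_with_haar_def
  using topological_crossed locally_compact_crossed Hausdorff_crossed second_countable_crossed
    crossed_left_haar_system by blast

end

sublocale haar_G_groupoid \<subseteq> cm: haar_module C \<kappa> Q snd cact
proof unfold_locales
  show "groupoid_with_haar C \<kappa>" by (rule crossed_groupoid_with_haar)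
  show "Hausdorff_space Q" "locally_compact_space Q" "second_countable Q"
    using Hausdorff_group Hausdorff_obj[OF Hausdorff_arr] locally_compact_gtop locally_compact_obj[OF locally_compact_arr]
      second_countable_group second_countable_obj[OF second_countable_arr]
    by (simp_all add: canonical_space_def Hausdorff_space_prod_topology locally_compact_space_prod_topology
        second_countable_prod_topology)
qed

context haar_G_groupoid
begin

abbreviation \<iota>J where "\<iota>J \<equiv> canonical_induced_haar G \<alpha> \<H> \<mu> \<nu>"

lemma canonical_haar_eq: "cm.\<iota> = \<iota>J"
  by (simp add: canonical_induced_haar_def)

lemma emeasure_canonical_haar:
  assumes "p \<in> topspace Q" "B \<in> sets (borel_of (arr J))"
  shows "emeasure (\<iota>J p) B = emeasure (\<kappa> (snd p)) {c \<in> range_fibre C (snd p). (p, c) \<in> B}"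
    and "{c \<in> range_fibre C (snd p). (p, c) \<in> B} \<in> sets (\<kappa> (snd p))"
  using cm.emeasure_induced_haar[OF assms(1), unfolded canonical_induced_eq canonical_haar_eq, OF assms(2)] .

lemma sets_canonical_haar: "sets (\<iota>J p) = sets (borel_of (arr J))"
  using cm.sets_induced_haar by (simp only: canonical_induced_eq canonical_haar_eq)

lemma space_canonical_haar: "space (\<iota>J p) = topspace (arr J)"
  using sets_eq_imp_space_eq[OF sets_canonical_haar] by simp

lemma tau_invariant_haar:
  assumes k: "k \<in> carrier G" and p: "p \<in> topspace Q"
  shows "distr (\<iota>J p) (borel_of (arr J)) (tau G k) = \<iota>J (obj_act J (tau G) k p)"
proof (rule measure_eqI)
  show "sets (distr (\<iota>J p) (borel_of (arr J)) (tau G k)) = sets (\<iota>J (obj_act J (tau G) k p))"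
    by (simp add: sets_canonical_haar)
  fix B assume "B \<in> sets (distr (\<iota>J p) (borel_of (arr J)) (tau G k))"
  then have B: "B \<in> sets (borel_of (arr J))" by simp
  obtain g x where p_eq: "p = (g, x)" and gx: "g \<in> carrier G" "x \<in> topspace (obj \<H>)"
    using p by (auto simp: topspace_canonical)
  have "continuous_map (prod_topology (gtop G) (arr J)) (arr J) (\<lambda>(k, c). tau G k c)"
    using G_groupoid_tau by (simp add: topological_G_groupoid_def continuous_group_action_def)
  from continuous_map_compose'[OF _ this, of "arr J" "\<lambda>c. (k, c)"]
  have "continuous_map (arr J) (arr J) (tau G k)"
    using k continuous_map_id[of "arr J"] by (simp add: continuous_map_pairedI id_def)
  note m = continuous_map_measurable[OF this sets_canonical_haar]
  have "tau G k -` B \<inter> space (\<iota>J p) \<in> sets (borel_of (arr J))"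
    using measurable_sets[OF m B] by (simp add: sets_canonical_haar)
  then have "emeasure (distr (\<iota>J p) (borel_of (arr J)) (tau G k)) B
      = emeasure (\<kappa> x) {c \<in> range_fibre C x. (p, c) \<in> tau G k -` B \<inter> space (\<iota>J p)}"
    using emeasure_canonical_haar(1)[OF p] by (simp add: emeasure_distr[OF m B] p_eq)
  also have "{c \<in> range_fibre C x. (p, c) \<in> tau G k -` B \<inter> space (\<iota>J p)}
      = {c \<in> range_fibre C x. ((k \<otimes> g, x), c) \<in> B}"
    using gx by (auto simp: p_eq tau_def space_canonical_haar topspace_J range_fibre_def topspace_crossed crossed_sel)
  also have "emeasure (\<kappa> x) \<dots> = emeasure (\<iota>J (k \<otimes> g, x)) B"
    using emeasure_canonical_haar(1)[OF _ B, of "(k \<otimes> g, x)"] k gx by (simp add: topspace_canonical)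
  finally show "emeasure (distr (\<iota>J p) (borel_of (arr J)) (tau G k)) B = emeasure (\<iota>J (obj_act J (tau G) k p)) B"
    using k by (simp add: p_eq obj_act_tau)
qed

lemma canonical_G_groupoid: "G_groupoid G J \<iota>J (tau G)"
  unfolding G_groupoid_def
proof (intro conjI ballI G_groupoid_tau)
  show "groupoid_with_haar J \<iota>J"
    using cm.induced_groupoid_with_haar by (simp only: canonical_induced_eq canonical_haar_eq)
qed (use tau_invariant_haar in \<open>auto simp: J_sel\<close>)

text \<open>The measures on the induced groupoid come from restricting \<open>\<kappa> x\<close> to a range fibre, those on
the principal bundle from \<open>\<kappa> x\<close> itself; they agree because the complement of the fibre is null.\<close>

lemma canonical_haar_triple:
  assumes p: "p \<in> topspace Q"
  shows "distr (\<iota>J p) (borel_of (arr (principal_bundle G (\<lambda>(h, \<gamma>). h) C))) to_triple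
    = principal_bundle_haar G C \<kappa> p"
proof -
  let ?B = "principal_bundle G (\<lambda>(h, \<gamma>). h) C"
  obtain g x where p_eq: "p = (g, x)" and g: "g \<in> carrier G" and x: "x \<in> topspace (obj \<H>)"
    using p by (auto simp: topspace_canonical)
  have arrB: "arr ?B = prod_topology (gtop G) (arr C)" by (simp add: principal_bundle_def)
  have "continuous_map (arr J) (arr ?B) to_triple"
    using groupoid_iso_principal_bundle homeomorphic_imp_continuous_map by (auto simp: groupoid_iso_def)
  note m = continuous_map_measurable[OF this sets_canonical_haar]
  have "continuous_map (arr C) (arr ?B) (\<lambda>c. (g, c))"
    using g continuous_map_id[of "arr C"] unfolding arrB by (intro continuous_map_pairedI) (auto simp: id_def)
  note m' = continuous_map_measurable[OF this radon_measure_sets[OF radon_crossed[OF x]]]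
  have sp: "space (\<kappa> x) = topspace (arr C)" using radon_measure_space[OF radon_crossed[OF x]] .
  show ?thesis
  proof (rule measure_eqI)
    show "sets (distr (\<iota>J p) (borel_of (arr ?B)) to_triple) = sets (principal_bundle_haar G C \<kappa> p)"
      by (simp add: principal_bundle_haar_def p_eq arrB)
    fix D assume "D \<in> sets (distr (\<iota>J p) (borel_of (arr ?B)) to_triple)"
    then have D: "D \<in> sets (borel_of (arr ?B))" by simp
    have D': "to_triple -` D \<inter> space (\<iota>J p) \<in> sets (borel_of (arr J))"
      using measurable_sets[OF m D] by (simp add: sets_canonical_haar)
    have S: "(\<lambda>c. (g, c)) -` D \<inter> space (\<kappa> x) \<in> sets (\<kappa> x)" using measurable_sets[OF m' D] .
    have eq: "{c \<in> range_fibre C x. (p, c) \<in> to_triple -` D \<inter> space (\<iota>J p)}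
        = {c \<in> range_fibre C x. (g, c) \<in> D}"
      using g by (auto simp: p_eq to_triple_def space_canonical_haar topspace_J range_fibre_def topspace_crossed crossed_sel)
    have "emeasure (distr (\<iota>J p) (borel_of (arr ?B)) to_triple) D
        = emeasure (\<kappa> x) {c \<in> range_fibre C x. (g, c) \<in> D}"
      using emeasure_canonical_haar(1)[OF p D'] unfolding emeasure_distr[OF m D] p_eq snd_conv eq[unfolded p_eq] .
    also have "\<dots> = emeasure (\<kappa> x) ((\<lambda>c. (g, c)) -` D \<inter> space (\<kappa> x))"
    proof (rule emeasure_eq_AE)
      show "AE c in \<kappa> x. c \<in> {c \<in> range_fibre C x. (g, c) \<in> D} \<longleftrightarrow> c \<in> (\<lambda>c. (g, c)) -` D \<inter> space (\<kappa> x)"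
        using cm.AE_range_fibre[of x] x by (auto simp: crossed_sel range_fibre_def sp)
      show "{c \<in> range_fibre C x. (g, c) \<in> D} \<in> sets (\<kappa> x)"
        using emeasure_canonical_haar(2)[OF p D'] unfolding p_eq snd_conv eq[unfolded p_eq] .
    qed (rule S)
    also have "\<dots> = emeasure (principal_bundle_haar G C \<kappa> p) D"
      using emeasure_distr[OF m' D] by (simp add: principal_bundle_haar_def p_eq arrB)
    finally show "emeasure (distr (\<iota>J p) (borel_of (arr ?B)) to_triple) D = emeasure (principal_bundle_haar G C \<kappa> p) D" .
  qed
qed

end

section \<open>The canonical induced groupoid and its equivalence with \<open>\<H>\<close>\<close>

theorem theorem13p1:
  fixes G :: "'g top_group"
    and \<H> :: "('a, 'o) groupoid"
    and \<nu> :: "'o \<Rightarrow> 'a measure"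
    and \<alpha> :: "'g \<Rightarrow> 'a \<Rightarrow> 'a"
  assumes "locally_compact_group G"
    and "G_groupoid G \<H> \<nu> \<alpha>"
  shows
    \<comment> \<open>(1) the canonical right module\<close>
    "topological_groupoid (crossed_product G \<alpha> \<H>) \<and>
     right_module (crossed_product G \<alpha> \<H>) (canonical_space G \<H>) snd (canonical_act G \<alpha> \<H>) \<and>
     \<comment> \<open>(2) the induced groupoid is a generalized principal bundle\<close>
     hom_to_group (crossed_product G \<alpha> \<H>) G (\<lambda>(h, \<gamma>). h) \<and>
     topological_groupoid (canonical_induced G \<alpha> \<H>) \<and>
     groupoid_iso (canonical_induced G \<alpha> \<H>)
       (principal_bundle G (\<lambda>(h, \<gamma>). h) (crossed_product G \<alpha> \<H>)) to_triple (\<lambda>p. p) \<and>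
     (\<forall>k \<in> carrier G. \<forall>c \<in> topspace (arr (canonical_induced G \<alpha> \<H>)).
        to_triple (tau G k c) = principal_bundle_action G k (to_triple c)) \<and>
     \<comment> \<open>(3) equivariant Morita equivalence\<close>
     (\<exists>(P :: ('g \<times> 'a) topology) \<epsilon>l a \<epsilon>r b \<theta>.
        equivariant_morita_equivalence G \<H> \<alpha> (canonical_induced G \<alpha> \<H>) (tau G) P \<epsilon>l a \<epsilon>r b \<theta>) \<and>
     \<comment> \<open>Haar systems on the constructed groupoids\<close>
     (second_countable (gtop G) \<longrightarrow> (\<forall>\<mu>. left_haar_measure G \<mu> \<longrightarrow>
        groupoid_with_haar (crossed_product G \<alpha> \<H>) (crossed_haar \<mu> \<nu>) \<and>
        G_groupoid G (canonical_induced G \<alpha> \<H>) (canonical_induced_haar G \<alpha> \<H> \<mu> \<nu>) (tau G) \<and>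
        (\<forall>p \<in> topspace (canonical_space G \<H>).
           distr (canonical_induced_haar G \<alpha> \<H> \<mu> \<nu> p)
             (borel_of (arr (principal_bundle G (\<lambda>(h, \<gamma>). h) (crossed_product G \<alpha> \<H>)))) to_triple
           = principal_bundle_haar G (crossed_product G \<alpha> \<H>) (crossed_haar \<mu> \<nu>) p)))"
proof -
  have haar: "groupoid_with_haar \<H> \<nu>" and act: "topological_G_groupoid G \<H> \<alpha>"
    using assms(2) by (simp_all add: G_groupoid_def)
  interpret Hausdorff_equivariant_groupoid G \<H> \<alpha>
    using assms(1) haar act
    by unfold_locales (simp_all add: groupoid_with_haar_def)
  have tau: "to_triple (tau G k c) = principal_bundle_action G k (to_triple c)" for k c
    by (simp add: to_triple_def tau_def principal_bundle_action_def split: prod.split)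
  have "groupoid_with_haar C (crossed_haar \<mu> \<nu>) \<and>
      G_groupoid G J (canonical_induced_haar G \<alpha> \<H> \<mu> \<nu>) (tau G) \<and>
      (\<forall>p \<in> topspace Q. distr (canonical_induced_haar G \<alpha> \<H> \<mu> \<nu> p)
         (borel_of (arr (principal_bundle G (\<lambda>(h, \<gamma>). h) C))) to_triple
       = principal_bundle_haar G C (crossed_haar \<mu> \<nu>) p)"
    if "second_countable (gtop G)" "left_haar_measure G \<mu>" for \<mu>
  proof -
    interpret haar_G_groupoid G \<mu> \<H> \<nu> \<alpha>
      using that haar assms(2) by unfold_locales
    show ?thesis
      using crossed_groupoid_with_haar canonical_G_groupoid canonical_haar_triple by blast
  qed
  then show ?thesis
    using topological_crossed right_module_canonical hom_crossed topological_canonical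
      groupoid_iso_principal_bundle tau equivariant_morita by blast
qed

end
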